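(* Let $N\ge2$, $t>0$, $\boldsymbol{x}\in\mathbb{R}^N$, and let $p_k^s(t,\boldsymbol{y}|\boldsymbol{x})=\sum_{\rho\in S_N}p_k(t,\boldsymbol{y}|\rho\boldsymbol{x})$ be the transition density of the symmetric type-$A$ Dunkl process with parameter $k>0$. Then the limit as $k\to\infty$ of $k^{N/2}p_k^s(t,\sqrt k\,\boldsymbol{v}|\boldsymbol{x})$ (as a density in $\boldsymbol{v}\in\mathbb{R}^N$) is independent of $\boldsymbol{x}$ and equals $$p^s_\infty(t,\boldsymbol{v})=\sum_{\rho\in S_N}\delta^N\big(\boldsymbol{v}-\sqrt{2t}\,\rho\boldsymbol{z}_N\big),$$ where $\boldsymbol{z}_N=(z_{1,N},\dots,z_{N,N})$, $z_{1,N}<\dots<z_{N,N}$, are the roots of the $N$-th Hermite polynomial $H_N(x)=(-1)^Ne^{x^2}\frac{d^N}{dx^N}e^{-x^2}$.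
   Context: Type-$A$ Dunkl operators with parameter $k$: $T_if(\boldsymbol{x})=\partial_{x_i}f(\boldsymbol{x})+k\sum_{j\ne i}\frac{f(\boldsymbol{x})-f(\sigma_{ij}\boldsymbol{x})}{x_i-x_j}$, $\sigma_{ij}$ swapping coordinates $i,j$. $V_k$ is the linear degree-preserving operator on polynomials with $V_k1=1$ and $T_iV_k=V_k\partial_{x_i}$; the Dunkl kernel is $E_k(\boldsymbol{x},\boldsymbol{y})=V_ke^{\boldsymbol{x}\cdot\boldsymbol{y}}$ ($V_k$ acting on $\boldsymbol{x}$, termwise on the power series). The type-$A$ Dunkl process transition density is $$p_k(t,\boldsymbol{y}|\boldsymbol{x})=\prod_{j=1}^N\frac{\Gamma(1+k)}{\Gamma(1+jk)}\Big|h_N\big(\tfrac{\boldsymbol{y}}{\sqrt t}\big)\Big|^{2k}\frac{e^{-(|\boldsymbol{x}|^2+|\boldsymbol{y}|^2)/2t}}{(2\pi t)^{N/2}}E_k\Big(\frac{\boldsymbol{x}}{\sqrt t},\frac{\boldsymbol{y}}{\sqrt t}\Big),$$ with $h_N(\boldsymbol{y})=\prod_{1\le i<j\le N}(y_j-y_i)$; it solves $\partial_tp_k=\frac12\sum_iT_i^2p_k$ with initial condition $\delta^N(\boldsymbol{x}-\boldsymbol{y})$. $\rho\boldsymbol{x}=(x_{\rho(1)},\dots,x_{\rho(N)})$ for $\rho\in S_N$, and $\delta^N(\boldsymbol{w})=\prod_j\delta(w_j)$. Note $p_k^s$ integrates to $N!$ over $\boldsymbol{y}$. *)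

theory Defs
  imports "HOL-Analysis.Analysis" "HOL-Combinatorics.Permutations"
begin

inductive polyfun :: "(real^'n \<Rightarrow> real) \<Rightarrow> bool" where
  pf_const: "polyfun (\<lambda>_. c)"
| pf_coord: "polyfun (\<lambda>x. x $ i)"
| pf_add: "polyfun p \<Longrightarrow> polyfun q \<Longrightarrow> polyfun (\<lambda>x. p x + q x)"
| pf_mult: "polyfun p \<Longrightarrow> polyfun q \<Longrightarrow> polyfun (\<lambda>x. p x * q x)"

definition homog_poly :: "nat \<Rightarrow> (real^'n \<Rightarrow> real) \<Rightarrow> bool" where
  "homog_poly m p \<longleftrightarrow> polyfun p \<and> (\<forall>c x. p (c *\<^sub>R x) = c ^ m * p x)"

definition partial_i :: "'n \<Rightarrow> (real^'n \<Rightarrow> real) \<Rightarrow> real^'n \<Rightarrow> real" where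
  "partial_i i f x = deriv (\<lambda>s. f (x + s *\<^sub>R axis i 1)) 0"

definition swapvec :: "'n \<Rightarrow> 'n \<Rightarrow> real^'n \<Rightarrow> real^'n" where
  "swapvec i j x = (\<chi> l. if l = i then x $ j else if l = j then x $ i else x $ l)"

definition dunkl :: "real \<Rightarrow> 'n::finite \<Rightarrow> (real^'n \<Rightarrow> real) \<Rightarrow> real^'n \<Rightarrow> real" where
  "dunkl k i f x = partial_i i f x
     + k * (\<Sum>j\<in>UNIV - {i}. (f x - f (swapvec i j x)) / (x $ i - x $ j))"

text \<open>Points with pairwise distinct coordinates (where the difference quotients are defined).\<close>
definition distinct_coords :: "real^'n \<Rightarrow> bool" where
  "distinct_coords x \<longleftrightarrow> (\<forall>i j. i \<noteq> j \<longrightarrow> x $ i \<noteq> x $ j)"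

text \<open>Intertwining operator V_k: the linear, degree-preserving operator on polynomials with
  V_k 1 = 1 and T_i V_k = V_k \<partial>_i (normalized to 0 off polynomials so that it is unique).\<close>
definition Vk :: "real \<Rightarrow> (real^'n::finite \<Rightarrow> real) \<Rightarrow> (real^'n \<Rightarrow> real)" where
  "Vk k = (THE V.
      (\<forall>p. \<not> polyfun p \<longrightarrow> V p = (\<lambda>_. 0)) \<and>
      (\<forall>p. polyfun p \<longrightarrow> polyfun (V p)) \<and>
      (\<forall>p q. polyfun p \<longrightarrow> polyfun q \<longrightarrow> V (\<lambda>x. p x + q x) = (\<lambda>x. V p x + V q x)) \<and>
      (\<forall>c p. polyfun p \<longrightarrow> V (\<lambda>x. c * p x) = (\<lambda>x. c * V p x)) \<and>
      (\<forall>m p. homog_poly m p \<longrightarrow> homog_poly m (V p)) \<and>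
      V (\<lambda>_. 1) = (\<lambda>_. 1) \<and>
      (\<forall>i p x. polyfun p \<longrightarrow> distinct_coords x \<longrightarrow>
          dunkl k i (V p) x = V (partial_i i p) x))"

text \<open>Dunkl kernel E_k(x,y) = V_k e^{x.y}, V_k acting on x termwise on the power series.\<close>
definition dunkl_kernel :: "real \<Rightarrow> real^'n::finite \<Rightarrow> real^'n \<Rightarrow> real" where
  "dunkl_kernel k x y = (\<Sum>n. Vk k (\<lambda>w. (w \<bullet> y) ^ n / fact n) x)"

definition dimv :: "real^'n::finite \<Rightarrow> nat" where "dimv y = CARD('n)"


definition hN :: "real^'n::{finite,linorder} \<Rightarrow> real" where
  "hN y = (\<Prod>(i,j)\<in>{(i,j). i < j}. y $ j - y $ i)"

definition pk :: "real \<Rightarrow> real \<Rightarrow> real^'n::{finite,linorder} \<Rightarrow> real^'n::{finite,linorder} \<Rightarrow> real" where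
  "pk k t y x =
     (\<Prod>j=1..dimv y. Gamma (1 + k) / Gamma (1 + real j * k))
     * \<bar>hN ((1 / sqrt t) *\<^sub>R y)\<bar> powr (2 * k)
     * exp (- (norm x ^ 2 + norm y ^ 2) / (2 * t)) / (2 * pi * t) powr (real (dimv y) / 2)
     * dunkl_kernel k ((1 / sqrt t) *\<^sub>R x) ((1 / sqrt t) *\<^sub>R y)"

definition permvec :: "('n \<Rightarrow> 'n) \<Rightarrow> real^'n \<Rightarrow> real^'n" where
  "permvec \<rho> x = (\<chi> i. x $ \<rho> i)"

definition pk_sym :: "real \<Rightarrow> real \<Rightarrow> real^'n::{finite,linorder} \<Rightarrow> real^'n::{finite,linorder} \<Rightarrow> real" where
  "pk_sym k t y x = (\<Sum>\<rho>\<in>{\<rho>. \<rho> permutes (UNIV::'n set)}. pk k t y (permvec \<rho> x))"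

definition hermite :: "nat \<Rightarrow> real \<Rightarrow> real" where
  "hermite n x = (-1) ^ n * exp (x ^ 2) * (deriv ^^ n) (\<lambda>u. exp (- (u ^ 2))) x"

end

theory Submission
  imports Defs "HOL-Probability.Distributions"
    "HOL-Computational_Algebra.Fundamental_Theorem_Algebra" "HOL-Real_Asymp.Real_Asymp"
begin

text \<open>
  The intertwining operator is built degree by degree: by Euler's formula
  \<open>\<Sum> x\<^sub>i T\<^sub>i p = n p + k \<Sum>\<^sub>i\<^sub><\<^sub>j (p - \<sigma>\<^sub>i\<^sub>j p)\<close> on homogeneous polynomials of degree \<open>n\<close>, and the operator on the
  right is invertible because it obeys a maximum principle on orbits of the symmetric group. The same
  principle yields the symmetry of the homogeneous parts of the kernel, the bound
  \<open>\<bar>E\<^sub>k(x, y)\<bar> \<le> exp (\<bar>x\<bar> \<bar>y\<bar>)\<close>, and, combined with integration by parts against the weight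
  \<open>w(y) = \<bar>h(y)\<bar>\<^sup>2\<^sup>k exp (-\<bar>y\<bar>\<^sup>2/2)\<close>, the relations \<open>\<integral> E\<^sub>k(x, y) w(y) dy = exp (\<bar>x\<bar>\<^sup>2/2) \<integral> w\<close> and
  \<open>\<integral> E\<^sub>k(x, y)\<^sup>2 w(y) dy \<le> exp (2 \<bar>x\<bar>\<^sup>2) \<integral> w\<close>, the latter uniformly in \<open>k\<close>.

  For \<open>x = 0\<close> the density is the Gaussian ensemble \<open>w\<close>, which Laplace's method concentrates at the
  permutations of the scaled Hermite zeros: by the Stieltjes relations these are critical points of
  the strictly convex potential. The normalization follows from the discriminant of the Hermite
  polynomial, the eigenvalues \<open>1, \<dots>, N\<close> of the Hessian, and Stirling's formula. For general \<open>x\<close> the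
  kernel is a density relative to this ensemble with uniformly bounded second moment, so by
  Cauchy-Schwarz it does not see the fluctuations of a symmetric test function; only its total mass
  survives in the limit. Positivity of the kernel is never needed.
\<close>

subsection \<open>Permutations of coordinates and the reflection operator\<close>

text \<open>The pointwise bound exp (|x| |y|) settles only questions at fixed \<open>k\<close>: the
  ensemble lives at |y| of order sqrt k, where this bound grows like exp (C sqrt k). Control that is
  uniform in \<open>k\<close> appears only after averaging over the weight, hence the second moment.
  Its constant exp (2 |x|^2) is what the reproducing identity, integral of E(x,y) E(x',y) w(y) = exp
  ((|x|^2 + |x'|^2) / 2) E(x,x') times the mass of w, would give at x = x'. Cauchy-Schwarz then asks
  for a test function whose square is negligible for the ensemble. The ensemble charges all N!
  permutations of the scaled zeros equally, so subtracting a constant achieves this only for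
  symmetric functions. The sum over the permutations of x supplies the symmetry: it makes the sum of
  the kernels invariant in y, so the test function may be replaced by its average over the group.
  The Gamma product is identified as the correct normalization only asymptotically, by comparing
  Laplace's method with Stirling's formula.\<close>

definition sw :: "'n \<Rightarrow> 'n \<Rightarrow> 'n \<Rightarrow> 'n" where
  "sw i j l = (if l = i then j else if l = j then i else l)"

lemma sw_sw [simp]: "sw i j (sw i j l) = l"
  by (auto simp: sw_def)

lemma sw_o_sw [simp]: "sw i j \<circ> sw i j = id"
  by (auto simp: fun_eq_iff)

lemma bij_sw: "bij (sw i j)"
  by (rule o_bij[of "sw i j"]) auto

lemma sw_same [simp]: "sw i i = id"
  by (auto simp: sw_def fun_eq_iff)

lemma sw_commute: "sw i j = sw j i"
  by (auto simp: sw_def fun_eq_iff)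

lemma permvec_nth [simp]: "permvec g x $ i = x $ g i"
  by (simp add: permvec_def)

lemma swapvec_permvec: "swapvec i j x = permvec (sw i j) x"
  by (simp add: vec_eq_iff swapvec_def sw_def)

lemma swapvec_nth: "swapvec i j x $ l = x $ sw i j l"
  by (simp add: swapvec_permvec)

lemma permvec_permvec: "permvec g (permvec h x) = permvec (h \<circ> g) x"
  by (simp add: vec_eq_iff)

lemma permvec_id [simp]: "permvec id x = x"
  by (simp add: vec_eq_iff)

lemma swapvec_swapvec [simp]: "swapvec i j (swapvec i j x) = x"
  by (simp add: swapvec_permvec permvec_permvec)

lemma swapvec_same [simp]: "swapvec i i x = x"
  by (simp add: swapvec_permvec)

lemma swapvec_commute: "swapvec i j x = swapvec j i x"
  by (simp add: swapvec_permvec sw_commute)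

lemma permvec_add: "permvec g (x + y) = permvec g x + permvec g y"
  and permvec_scaleR: "permvec g (c *\<^sub>R x) = c *\<^sub>R permvec g x"
  by (simp_all add: vec_eq_iff)

lemma inner_permvec:
  fixes x y :: "real^'n"
  assumes "bij g" shows "permvec g x \<bullet> permvec g y = x \<bullet> y"
  unfolding inner_vec_def permvec_nth
  by (rule sum.reindex_bij_betw[of g UNIV UNIV "\<lambda>i. x $ i \<bullet> y $ i"]) (use assms in \<open>auto simp: bij_def bij_betw_def\<close>)

lemma norm_permvec: "bij g \<Longrightarrow> norm (permvec g x) = norm (x :: real^'n)"
  by (simp add: norm_eq_sqrt_inner inner_permvec)

lemma distinct_coords_permvec: "inj g \<Longrightarrow> distinct_coords x \<Longrightarrow> distinct_coords (permvec g x)"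
  by (simp add: distinct_coords_def inj_def) blast

text \<open>The double sum runs over ordered pairs, so every transposition occurs twice; this
  accounts for \<open>k / 2\<close>. With \<open>c = n\<close> this is the operator of Euler's
  formula in degree n, and a positive \<open>c\<close> makes it invertible.\<close>

definition reflop :: "real \<Rightarrow> real \<Rightarrow> (real^'n::finite \<Rightarrow> real) \<Rightarrow> real^'n \<Rightarrow> real" where
  "reflop k c u x = c * u x + k / 2 * (\<Sum>i\<in>UNIV. \<Sum>j\<in>UNIV. u x - u (swapvec i j x))"

text \<open>Where |u| is largest on \<open>S\<close>, every difference
  \<open>u m - u (\<tau> i j m)\<close> vanishes or has the sign of \<open>u m\<close>, so the
  reflection term can only enlarge |c u m|; hence c |u m| is at most |f m|. The set and the maps are
  abstract because three actions occur: on coefficients indexed by maps, on orbits of points, and on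
  pairs of an index and a point.\<close>

lemma max_principle:
  fixes u f :: "'a \<Rightarrow> real" and \<tau> :: "'n::finite \<Rightarrow> 'n \<Rightarrow> 'a \<Rightarrow> 'a"
  assumes fin: "finite S" and inv: "\<And>i j s. s \<in> S \<Longrightarrow> \<tau> i j s \<in> S" and c: "c > 0" and k: "k \<ge> 0"
    and eq: "\<And>s. s \<in> S \<Longrightarrow> c * u s + k / 2 * (\<Sum>i\<in>UNIV. \<Sum>j\<in>UNIV. u s - u (\<tau> i j s)) = f s"
    and bd: "\<And>s. s \<in> S \<Longrightarrow> \<bar>f s\<bar> \<le> F" and s: "s \<in> S"
  shows "\<bar>u s\<bar> \<le> F / c"
proof -
  have "Max ((\<lambda>s. \<bar>u s\<bar>) ` S) \<in> (\<lambda>s. \<bar>u s\<bar>) ` S" using fin s by (intro Max_in) auto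
  then obtain m where m: "m \<in> S" and Max: "Max ((\<lambda>s. \<bar>u s\<bar>) ` S) = \<bar>u m\<bar>" by auto
  have mx: "\<bar>u t\<bar> \<le> \<bar>u m\<bar>" if "t \<in> S" for t
    using Max_ge[of "(\<lambda>s. \<bar>u s\<bar>) ` S" "\<bar>u t\<bar>"] fin that by (simp add: Max)
  let ?T = "\<Sum>i\<in>UNIV. \<Sum>j\<in>UNIV. u m - u (\<tau> i j m)"
  have "c * \<bar>u m\<bar> \<le> F"
  proof (cases "u m \<ge> 0")
    case True
    have "0 \<le> ?T"
    proof (intro sum_nonneg)
      fix i j show "0 \<le> u m - u (\<tau> i j m)" using mx[OF inv[OF m, of i j]] True by linarith
    qed
    then have "0 \<le> k / 2 * ?T" using k by simp
    then show ?thesis using eq[OF m] bd[OF m] True by simp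
  next
    case False
    have "?T \<le> 0"
    proof (intro sum_nonpos)
      fix i j show "u m - u (\<tau> i j m) \<le> 0" using mx[OF inv[OF m, of i j]] False by linarith
    qed
    then have "k / 2 * ?T \<le> 0" using k by (simp add: mult_nonneg_nonpos)
    moreover have "c * \<bar>u m\<bar> = - (c * u m)" using False by simp
    ultimately show ?thesis using eq[OF m] bd[OF m] by linarith
  qed
  then have "\<bar>u m\<bar> \<le> F / c" using c by (simp add: field_simps)
  with mx[OF s] show ?thesis by linarith
qed

definition orbit :: "real^'n::finite \<Rightarrow> (real^'n) set" where
  "orbit x = (\<lambda>g. permvec g x) ` {g. bij g}"

lemma finite_orbit [simp]: "finite (orbit x)"
  by (simp add: orbit_def)

lemma orbit_self [simp]: "x \<in> orbit x"
  unfolding orbit_def by (rule image_eqI[of _ _ id]) auto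

lemma permvec_orbit: "bij g \<Longrightarrow> s \<in> orbit x \<Longrightarrow> permvec g s \<in> orbit x"
  unfolding orbit_def by (auto simp: permvec_permvec bij_comp)

lemma swapvec_orbit: "s \<in> orbit x \<Longrightarrow> swapvec i j s \<in> orbit x"
  by (simp add: swapvec_permvec permvec_orbit bij_sw)

lemma orbit_distinct: "s \<in> orbit x \<Longrightarrow> distinct_coords x \<Longrightarrow> distinct_coords s"
  unfolding orbit_def by (auto intro!: distinct_coords_permvec simp: bij_def)

lemma orbit_norm: "s \<in> orbit x \<Longrightarrow> norm s = norm x"
  unfolding orbit_def by (auto simp: norm_permvec)

lemma reflop_bound:
  assumes "c > 0" "k \<ge> 0" "\<And>s. s \<in> orbit x \<Longrightarrow> \<bar>reflop k c u s\<bar> \<le> F" "s \<in> orbit x"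
  shows "\<bar>u s\<bar> \<le> F / c"
  by (rule max_principle[where \<tau>=swapvec and S="orbit x" and k=k and f="reflop k c u"])
     (use assms in \<open>auto simp: swapvec_orbit reflop_def\<close>)

lemma reflop_diff: "reflop k c (\<lambda>x. u x - v x) x = reflop k c u x - reflop k c v x"
  unfolding reflop_def
  by (simp add: sum_subtractf algebra_simps sum.distrib)

lemma reflop_inj:
  assumes "c > 0" "k \<ge> 0" "\<And>s. s \<in> orbit x \<Longrightarrow> reflop k c u s = reflop k c v s"
  shows "u x = v x"
  using reflop_bound[of c k x "\<lambda>x. u x - v x" 0 x] assms by (simp add: reflop_diff)

text \<open>The inverse is sought as a fixed combination of the substitutions
  \<open>permvec g\<close>, so that it visibly preserves polynomials and degrees. This gives a
  square linear system for the coefficients, indexed by all self-maps of the index type. The maximum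
  principle for composition with transpositions yields injectivity, hence solvability.\<close>

lemma resolvent_ex:
  assumes c: "c > 0" and k: "k \<ge> 0"
  shows "\<exists>r :: ('n::finite \<Rightarrow> 'n) \<Rightarrow> real. \<forall>f x. reflop k c (\<lambda>x. \<Sum>g\<in>UNIV. r g * f (permvec g x)) x = f x"
proof -
  define L :: "real^('n\<Rightarrow>'n) \<Rightarrow> real^('n\<Rightarrow>'n)" where
    "L a = (\<chi> g. c * a $ g + k / 2 * (\<Sum>i\<in>UNIV. \<Sum>j\<in>UNIV. a $ g - a $ (sw i j \<circ> g)))" for a
  have lin: "linear L"
    by (rule linearI) (auto simp: L_def vec_eq_iff algebra_simps sum.distrib sum_subtractf sum_distrib_left)
  have "inj L"
  proof (subst linear_injective_0[OF lin], intro allI impI)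
    fix a assume a: "L a = 0"
    have "\<bar>a $ g\<bar> \<le> 0 / c" for g
    proof (rule max_principle[where \<tau>="\<lambda>i j g. sw i j \<circ> g" and S=UNIV and k=k and f="\<lambda>_. 0" and u="\<lambda>g. a $ g" and s=g])
      fix s show "c * a $ s + k / 2 * (\<Sum>i\<in>UNIV. \<Sum>j\<in>UNIV. a $ s - a $ (sw i j \<circ> s)) = 0"
        using arg_cong[OF a, of "\<lambda>v. v $ s"] by (simp add: L_def)
    qed (use c k in auto)
    then show "a = 0" by (simp add: vec_eq_iff)
  qed
  then have "surj L" using linear_injective_imp_surjective[OF lin] by simp
  then obtain a where a: "L a = axis id 1" by (metis surj_def)
  show ?thesis
  proof (intro exI[of _ "\<lambda>g. a $ g"] allI)
    fix f :: "real^'n \<Rightarrow> real" and x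
    have eq: "(\<Sum>g\<in>UNIV. a $ g * f (permvec g (swapvec i j x))) = (\<Sum>g\<in>UNIV. a $ (sw i j \<circ> g) * f (permvec g x))" for i j
    proof -
      have "(\<Sum>g\<in>UNIV. a $ g * f (permvec (sw i j \<circ> g) x)) = (\<Sum>g\<in>UNIV. a $ (sw i j \<circ> g) * f (permvec g x))"
        by (rule sum.reindex_bij_witness[of _ "\<lambda>g. sw i j \<circ> g" "\<lambda>g. sw i j \<circ> g"]) (auto simp: o_assoc)
      then show ?thesis by (simp add: swapvec_permvec permvec_permvec)
    qed
    have "reflop k c (\<lambda>x. \<Sum>g\<in>UNIV. a $ g * f (permvec g x)) x
      = c * (\<Sum>g\<in>UNIV. a $ g * f (permvec g x)) + k / 2 * (\<Sum>i\<in>UNIV. \<Sum>j\<in>UNIV. \<Sum>g\<in>UNIV. (a $ g - a $ (sw i j \<circ> g)) * f (permvec g x))"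
      by (simp add: reflop_def eq sum_subtractf left_diff_distrib)
    also have "(\<Sum>i\<in>UNIV. \<Sum>j\<in>UNIV. \<Sum>g\<in>UNIV. (a $ g - a $ (sw i j \<circ> g)) * f (permvec g x))
      = (\<Sum>g\<in>UNIV. \<Sum>i\<in>UNIV. \<Sum>j\<in>UNIV. (a $ g - a $ (sw i j \<circ> g)) * f (permvec g x))"
      by (subst sum.swap) (subst (2) sum.swap, subst sum.swap, rule sum.cong, simp, subst sum.swap, simp)
    also have "c * (\<Sum>g\<in>UNIV. a $ g * f (permvec g x)) + k / 2 * \<dots> = (\<Sum>g\<in>UNIV. L a $ g * f (permvec g x))"
      by (simp add: L_def sum_distrib_left sum_distrib_right sum.distrib algebra_simps)
    also have "\<dots> = (\<Sum>g\<in>UNIV. (if g = id then f (permvec g x) else 0))"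
      unfolding a by (rule sum.cong) (auto simp: axis_def)
    also have "\<dots> = f x" by simp
    finally show "reflop k c (\<lambda>x. \<Sum>g\<in>UNIV. a $ g * f (permvec g x)) x = f x" .
  qed
qed

definition resolv_coeff :: "real \<Rightarrow> real \<Rightarrow> ('n::finite \<Rightarrow> 'n) \<Rightarrow> real" where
  "resolv_coeff k c = (SOME r. \<forall>f x. reflop k c (\<lambda>x. \<Sum>g\<in>UNIV. r g * f (permvec g x)) x = f x)"

definition resolv :: "real \<Rightarrow> real \<Rightarrow> (real^'n::finite \<Rightarrow> real) \<Rightarrow> real^'n \<Rightarrow> real" where
  "resolv k c f x = (\<Sum>g\<in>UNIV. resolv_coeff k c g * f (permvec g x))"

lemma reflop_resolv:
  assumes "c > 0" "k \<ge> 0" shows "reflop k c (resolv k c f) x = f x"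
  using someI_ex[OF resolvent_ex[OF assms]] unfolding resolv_def[abs_def] resolv_coeff_def by blast

lemma resolv_add: "resolv k c (\<lambda>x. f x + g x) x = resolv k c f x + resolv k c g x"
  and resolv_cmult: "resolv k c (\<lambda>x. a * f x) x = a * resolv k c f x"
  by (simp_all add: resolv_def algebra_simps sum.distrib sum_distrib_left)

subsection \<open>Polynomial functions\<close>

lemma polyfun_sum: "finite A \<Longrightarrow> (\<And>a. a \<in> A \<Longrightarrow> polyfun (p a)) \<Longrightarrow> polyfun (\<lambda>x. \<Sum>a\<in>A. p a x)"
  by (induction A rule: finite_induct) (auto intro: polyfun.intros)

lemma polyfun_cmult: "polyfun p \<Longrightarrow> polyfun (\<lambda>x. c * p x)"
  by (intro polyfun.intros)

lemma polyfun_diff: "polyfun p \<Longrightarrow> polyfun q \<Longrightarrow> polyfun (\<lambda>x. p x - q x)"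
  using pf_add[of p "\<lambda>x. (-1) * q x"] polyfun_cmult[of q "-1"] by simp

lemma polyfun_power: "polyfun p \<Longrightarrow> polyfun (\<lambda>x. p x ^ m)"
  by (induction m) (auto intro: polyfun.intros)

lemma polyfun_permvec: "polyfun p \<Longrightarrow> polyfun (\<lambda>x. p (permvec g x))"
  by (induction p rule: polyfun.induct) (auto intro: polyfun.intros)

lemma polyfun_swapvec: "polyfun p \<Longrightarrow> polyfun (\<lambda>x. p (swapvec i j x))"
  by (simp add: swapvec_permvec polyfun_permvec)

lemma polyfun_inner: "polyfun (\<lambda>x. x \<bullet> y)"
  unfolding inner_vec_def by (intro polyfun_sum) (auto intro: polyfun.intros)

lemma polyfun_continuous: "polyfun p \<Longrightarrow> continuous_on S p"
  by (induction p rule: polyfun.induct) (auto intro!: continuous_intros)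

section \<open>Partial derivatives of polynomial functions\<close>

lemma polyfun_deriv_ex:
  fixes p :: "real^'n::finite \<Rightarrow> real"
  assumes "polyfun p"
  shows "\<exists>q. (\<forall>i. polyfun (q i)) \<and> (\<forall>x v s. ((\<lambda>s. p (x + s *\<^sub>R v)) has_real_derivative (\<Sum>i\<in>UNIV. v $ i * q i (x + s *\<^sub>R v))) (at s))"
  using assms
proof (induction p rule: polyfun.induct)
  case (pf_const c)
  show ?case by (rule exI[of _ "\<lambda>i x. 0"]) (auto intro: polyfun.intros)
next
  case (pf_coord l)
  have *: "(\<Sum>i\<in>UNIV. v $ i * (if i = l then 1 else 0)) = v $ l" for v :: "real^'n"
    by (simp add: if_distrib cong: if_cong)
  show ?case
    by (rule exI[of _ "\<lambda>i x. if i = l then 1 else 0"])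
       (auto simp: * intro!: polyfun.intros derivative_eq_intros)
next
  case (pf_add p q)
  then obtain p' q' where "\<forall>i. polyfun (p' i)" "\<forall>i. polyfun (q' i)"
    "\<forall>x v s. ((\<lambda>s. p (x + s *\<^sub>R v)) has_real_derivative (\<Sum>i\<in>UNIV. v $ i * p' i (x + s *\<^sub>R v))) (at s)"
    "\<forall>x v s. ((\<lambda>s. q (x + s *\<^sub>R v)) has_real_derivative (\<Sum>i\<in>UNIV. v $ i * q' i (x + s *\<^sub>R v))) (at s)" by blast
  then show ?case
    by (intro exI[of _ "\<lambda>i x. p' i x + q' i x"])
       (auto simp: sum.distrib algebra_simps intro!: polyfun.intros DERIV_add)
next
  case (pf_mult p q)
  then obtain p' q' where "\<forall>i. polyfun (p' i)" "\<forall>i. polyfun (q' i)"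
    "\<forall>x v s. ((\<lambda>s. p (x + s *\<^sub>R v)) has_real_derivative (\<Sum>i\<in>UNIV. v $ i * p' i (x + s *\<^sub>R v))) (at s)"
    "\<forall>x v s. ((\<lambda>s. q (x + s *\<^sub>R v)) has_real_derivative (\<Sum>i\<in>UNIV. v $ i * q' i (x + s *\<^sub>R v))) (at s)" by blast
  note pq = this
  have "((\<lambda>s. p (x + s *\<^sub>R v) * q (x + s *\<^sub>R v)) has_real_derivative (\<Sum>i\<in>UNIV. v $ i * (p' i (x + s *\<^sub>R v) * q (x + s *\<^sub>R v) + p (x + s *\<^sub>R v) * q' i (x + s *\<^sub>R v)))) (at s)" for x v s
    by (rule DERIV_cong[OF DERIV_mult[OF pq(3)[rule_format] pq(4)[rule_format]]])
       (simp add: sum.distrib sum_distrib_left sum_distrib_right algebra_simps)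
  with pq pf_mult.hyps show ?case
    by (intro exI[of _ "\<lambda>i x. p' i x * q x + p x * q' i x"]) (auto intro!: polyfun.intros)
qed

lemma
  fixes p :: "real^'n::finite \<Rightarrow> real"
  assumes "polyfun p"
  shows polyfun_partial: "polyfun (partial_i i p)"
    and polyfun_dir_deriv: "((\<lambda>s. p (x + s *\<^sub>R v)) has_real_derivative (\<Sum>i\<in>UNIV. v $ i * partial_i i p (x + s *\<^sub>R v))) (at s)"
proof -
  from polyfun_deriv_ex[OF assms] obtain q where q: "\<And>i. polyfun (q i)"
    "\<And>x v s. ((\<lambda>s. p (x + s *\<^sub>R v)) has_real_derivative (\<Sum>i\<in>UNIV. v $ i * q i (x + s *\<^sub>R v))) (at s)" by blast
  have "partial_i i p x = q i x" for i x
  proof -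
    have "((\<lambda>s. p (x + s *\<^sub>R axis i 1)) has_real_derivative (\<Sum>l\<in>UNIV. axis i 1 $ l * q l (x + 0 *\<^sub>R axis i 1))) (at 0)"
      by (rule q(2))
    moreover have "(\<Sum>l\<in>UNIV. axis i 1 $ l * q l (x + 0 *\<^sub>R axis i 1)) = q i x"
      by (simp add: axis_def if_distrib if_distribR cong: if_cong)
    ultimately show ?thesis unfolding partial_i_def by (metis DERIV_imp_deriv)
  qed
  then have "partial_i i p = q i" for i by auto
  with q show "polyfun (partial_i i p)"
    "((\<lambda>s. p (x + s *\<^sub>R v)) has_real_derivative (\<Sum>i\<in>UNIV. v $ i * partial_i i p (x + s *\<^sub>R v))) (at s)" by auto
qed

lemma axis_sum: "(\<Sum>l\<in>UNIV. axis i 1 $ l * f l) = (f i :: real)"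
  by (simp add: axis_def if_distrib if_distribR cong: if_cong)

lemma polyfun_partial_deriv:
  assumes "polyfun p"
  shows "((\<lambda>s. p (x + s *\<^sub>R axis i 1)) has_real_derivative partial_i i p (x + s *\<^sub>R axis i 1)) (at s)"
  using polyfun_dir_deriv[OF assms, of x "axis i 1" s] by (simp add: axis_sum)

lemma polyfun_partial_deriv0:
  assumes "polyfun p"
  shows "((\<lambda>s. p (x + s *\<^sub>R axis i 1)) has_real_derivative partial_i i p x) (at 0)"
  using polyfun_partial_deriv[OF assms, of x i 0] by simp

lemma partial_add: "polyfun p \<Longrightarrow> polyfun q \<Longrightarrow> partial_i i (\<lambda>x. p x + q x) x = partial_i i p x + partial_i i q x"
  unfolding partial_i_def[of i "\<lambda>x. p x + q x"]
  by (intro DERIV_imp_deriv DERIV_add polyfun_partial_deriv0)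

lemma partial_mult: "polyfun p \<Longrightarrow> polyfun q \<Longrightarrow> partial_i i (\<lambda>x. p x * q x) x = partial_i i p x * q x + p x * partial_i i q x"
  unfolding partial_i_def[of i "\<lambda>x. p x * q x"]
  by (rule DERIV_imp_deriv) (auto intro!: derivative_eq_intros polyfun_partial_deriv0)

lemma partial_const [simp]: "partial_i i (\<lambda>_. c) x = 0"
  by (simp add: partial_i_def)

lemma partial_coord: "partial_i i (\<lambda>x. x $ l) x = (if i = l then 1 else 0)"
  unfolding partial_i_def
  by (rule DERIV_imp_deriv) (auto intro!: derivative_eq_intros simp: axis_def)

lemma partial_cmult: "polyfun p \<Longrightarrow> partial_i i (\<lambda>x. c * p x) x = c * partial_i i p x"
  by (simp add: partial_mult[of "\<lambda>_. c" p] polyfun.intros)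

lemma partial_commute: "polyfun p \<Longrightarrow> partial_i i (partial_i j p) x = partial_i j (partial_i i p) x"
proof (induction p arbitrary: x rule: polyfun.induct)
  case (pf_const c)
  have "partial_i i (\<lambda>_. c) = (\<lambda>_. 0)" "partial_i j (\<lambda>_. c) = (\<lambda>_. 0)" by auto
  then show ?case by simp
next
  case (pf_coord l)
  have "partial_i m (\<lambda>x. x $ l) = (\<lambda>_. if m = l then 1 else 0)" for m by (auto simp: partial_coord)
  then show ?case by simp
next
  case (pf_add p q)
  have "partial_i m (\<lambda>x. p x + q x) = (\<lambda>x. partial_i m p x + partial_i m q x)" for m
    using pf_add.hyps by (auto simp: partial_add)
  then show ?case using pf_add by (simp add: partial_add polyfun_partial)
next
  case (pf_mult p q)
  have "partial_i m (\<lambda>x. p x * q x) = (\<lambda>x. partial_i m p x * q x + p x * partial_i m q x)" for m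
    using pf_mult.hyps by (auto simp: partial_mult)
  then show ?case using pf_mult
    by (simp add: partial_add partial_mult polyfun_partial polyfun.pf_mult algebra_simps)
qed

section \<open>Homogeneous polynomials\<close>

lemma homog_polyD: "homog_poly m p \<Longrightarrow> polyfun p"
  by (simp add: homog_poly_def)

lemma homog_zero [simp]: "homog_poly m (\<lambda>_. 0)"
  by (simp add: homog_poly_def polyfun.intros)

lemma homog_mult: "homog_poly a p \<Longrightarrow> homog_poly b q \<Longrightarrow> homog_poly (a + b) (\<lambda>x. p x * q x)"
  by (auto simp: homog_poly_def polyfun.intros power_add)

lemma homog_sum: "finite A \<Longrightarrow> (\<And>a. a \<in> A \<Longrightarrow> homog_poly m (p a)) \<Longrightarrow> homog_poly m (\<lambda>x. \<Sum>a\<in>A. p a x)"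
  by (auto simp: homog_poly_def polyfun_sum sum_distrib_left intro!: sum.cong)

lemma homog_cmult: "homog_poly m p \<Longrightarrow> homog_poly m (\<lambda>x. c * p x)"
  by (auto simp: homog_poly_def polyfun_cmult)

lemma homog_permvec: "homog_poly m p \<Longrightarrow> homog_poly m (\<lambda>x. p (permvec g x))"
  by (auto simp: homog_poly_def polyfun_permvec permvec_scaleR)

lemma homog_coord: "homog_poly 1 (\<lambda>x. x $ i)"
  by (auto simp: homog_poly_def polyfun.intros)

lemma homog_at_0: "homog_poly m p \<Longrightarrow> m > 0 \<Longrightarrow> p 0 = 0"
proof -
  assume "homog_poly m p" "m > 0"
  then have "p (0 *\<^sub>R 0) = 0 ^ m * p 0" unfolding homog_poly_def by blast
  with \<open>m > 0\<close> show ?thesis by (cases m) auto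
qed

lemma homog_0_const: "homog_poly 0 p \<Longrightarrow> p = (\<lambda>_. p 0)"
proof
  fix x assume "homog_poly 0 p"
  then have "p (0 *\<^sub>R x) = 0 ^ 0 * p x" unfolding homog_poly_def by blast
  then show "p x = p 0" by simp
qed

text \<open>A finite set has no interior, so every point is a limit of points where g vanishes. This
  carries identities across divisions by zero and across the diagonals.\<close>

lemma continuous_zero_off_finite:
  fixes g :: "real \<Rightarrow> real"
  assumes "finite A" "continuous_on UNIV g" "\<And>s. s \<notin> A \<Longrightarrow> g s = 0"
  shows "g a = 0"
proof -
  have "open (- (A - {a}))" by (intro open_Compl finite_imp_closed) (use assms(1) in auto)
  then have "\<forall>\<^sub>F s in at a. s \<in> - (A - {a})" by (rule eventually_at_in_open') auto
  moreover have "\<forall>\<^sub>F s in at a. s \<noteq> a" by (simp add: eventually_at_filter)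
  ultimately have "\<forall>\<^sub>F s in at a. g s = 0" by eventually_elim (use assms(3) in auto)
  then have "(g \<longlongrightarrow> 0) (at a)" by (rule tendsto_eventually)
  moreover have "(g \<longlongrightarrow> g a) (at a)" using assms(2) by (simp add: continuous_on_def)
  ultimately show ?thesis using tendsto_unique by (metis at_neq_bot)
qed

lemma homog_partial:
  assumes "homog_poly (Suc m) p" shows "homog_poly m (partial_i i p)"
proof -
  have p: "polyfun p" and h: "\<And>c x. p (c *\<^sub>R x) = c ^ Suc m * p x"
    using assms by (auto simp: homog_poly_def)
  have nz: "partial_i i p (c *\<^sub>R x) = c ^ m * partial_i i p x" if "c \<noteq> 0" for c x
  proof -
    have "((\<lambda>s. c ^ Suc m * p (x + s *\<^sub>R axis i 1)) has_real_derivative c ^ Suc m * partial_i i p x) (at 0)"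
      by (intro DERIV_cmult polyfun_partial_deriv0 p)
    moreover have "(\<lambda>s. c ^ Suc m * p (x + s *\<^sub>R axis i 1)) = (\<lambda>s. p (c *\<^sub>R x + s *\<^sub>R (c *\<^sub>R axis i 1)))"
      by (simp only: h[symmetric]) (simp add: scaleR_add_right mult.commute)
    moreover have "((\<lambda>s. p (c *\<^sub>R x + s *\<^sub>R (c *\<^sub>R axis i 1))) has_real_derivative c * partial_i i p (c *\<^sub>R x)) (at 0)"
    proof -
      have "(\<Sum>l\<in>UNIV. (c *\<^sub>R axis i 1) $ l * f l) = c * f i" for f :: "_ \<Rightarrow> real"
        using axis_sum[of i f] by (simp add: sum_distrib_left[symmetric] mult.assoc)
      then show ?thesis
        using polyfun_dir_deriv[OF p, of "c *\<^sub>R x" "c *\<^sub>R axis i 1" 0] by simp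
    qed
    ultimately have "c ^ Suc m * partial_i i p x = c * partial_i i p (c *\<^sub>R x)"
      by (metis DERIV_unique)
    with that show ?thesis by simp
  qed
  \<comment> \<open>The chain rule gives the identity after one factor \<open>c\<close> is
    cancelled; at \<open>c = 0\<close> it follows by continuity.\<close>
  have "partial_i i p (c *\<^sub>R x) - c ^ m * partial_i i p x = 0" for c x
  proof (rule continuous_zero_off_finite[of "{0}" "\<lambda>c. partial_i i p (c *\<^sub>R x) - c ^ m * partial_i i p x"])
    show "continuous_on UNIV (\<lambda>c. partial_i i p (c *\<^sub>R x) - c ^ m * partial_i i p x)"
      by (intro continuous_intros continuous_on_compose2[OF polyfun_continuous[OF polyfun_partial[OF p], of UNIV]]) auto
  qed (use nz in auto)
  then show ?thesis using polyfun_partial[OF p] by (simp add: homog_poly_def)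
qed

lemma partial_homog_0: "homog_poly 0 p \<Longrightarrow> partial_i i p = (\<lambda>_. 0)"
  by (subst homog_0_const) auto

lemma homog_euler:
  assumes "homog_poly m p" shows "(\<Sum>i\<in>UNIV. x $ i * partial_i i p x) = real m * p x"
proof -
  have p: "polyfun p" and h: "\<And>c x. p (c *\<^sub>R x) = c ^ m * p x"
    using assms by (auto simp: homog_poly_def)
  have "((\<lambda>s. p (x + s *\<^sub>R x)) has_real_derivative (\<Sum>i\<in>UNIV. x $ i * partial_i i p (x + 0 *\<^sub>R x))) (at 0)"
    by (rule polyfun_dir_deriv[OF p])
  moreover have "(\<lambda>s. p (x + s *\<^sub>R x)) = (\<lambda>s. (1 + s) ^ m * p x)"
    by (simp only: h[symmetric]) (simp add: algebra_simps)
  moreover have "((\<lambda>s. (1 + s) ^ m * p x) has_real_derivative real m * p x) (at 0)"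
    by (auto intro!: derivative_eq_intros)
  ultimately show ?thesis using DERIV_unique by fastforce
qed

text \<open>Finite sums of homogeneous polynomials contain the generators and are closed under sums
  and products, so they exhaust the polynomial functions. A list records the summands, several of
  which may have the same degree.\<close>

lemma polyfun_hom_induct [consumes 1, case_names zero add]:
  fixes p :: "real^'n::finite \<Rightarrow> real"
  assumes p: "polyfun p" and z: "P (\<lambda>_. 0)"
    and a: "\<And>m h q. homog_poly m h \<Longrightarrow> polyfun q \<Longrightarrow> P q \<Longrightarrow> P (\<lambda>x. h x + q x)"
  shows "P p"
proof -
  define H where "H = (\<lambda>p :: real^'n \<Rightarrow> real. \<exists>hs. (\<forall>h\<in>set hs. \<exists>m. homog_poly m h) \<and> p = (\<lambda>x. \<Sum>h\<leftarrow>hs. h x))"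
  have Hadd: "H (\<lambda>x. p x + q x)" if pq: "H p" "H q" for p q
  proof -
    from pq obtain hs hs' where 1: "\<forall>h\<in>set hs. \<exists>m. homog_poly m h" "p = (\<lambda>x. \<Sum>h\<leftarrow>hs. h x)"
      and 2: "\<forall>h\<in>set hs'. \<exists>m. homog_poly m h" "q = (\<lambda>x. \<Sum>h\<leftarrow>hs'. h x)"
      unfolding H_def by blast
    show ?thesis unfolding H_def by (rule exI[of _ "hs @ hs'"]) (use 1 2 in auto)
  qed
  have H0: "H (\<lambda>_. 0)" unfolding H_def by (rule exI[of _ "[]"]) auto
  have H1: "homog_poly m h \<Longrightarrow> H h" for m h unfolding H_def by (rule exI[of _ "[h]"]) auto
  have "H p" using p
  proof (induction p rule: polyfun.induct)
    case (pf_const c)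
    then show ?case by (rule H1[of 0]) (auto simp: homog_poly_def polyfun.intros)
  next
    case (pf_coord i)
    then show ?case by (rule H1[OF homog_coord])
  next
    case (pf_add p q)
    then show ?case by (intro Hadd)
  next
    case (pf_mult p q)
    then obtain hs hs' where 1: "\<forall>h\<in>set hs. \<exists>m. homog_poly m h" "p = (\<lambda>x. \<Sum>h\<leftarrow>hs. h x)"
      and 2: "\<forall>h\<in>set hs'. \<exists>m. homog_poly m h" "q = (\<lambda>x. \<Sum>h\<leftarrow>hs'. h x)"
      unfolding H_def by blast
    have s: "H (\<lambda>x. h x * (\<Sum>h\<leftarrow>hs'. h x))" if "homog_poly m h" for m h
      using 2(1)
    proof (induction hs')
      case (Cons h' hs')
      then obtain m' where "homog_poly m' h'" by auto
      from H1[OF homog_mult[OF that this]] Cons show ?case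
        by (simp add: distrib_left Hadd)
    qed (use H0 in simp)
    have "H (\<lambda>x. (\<Sum>h\<leftarrow>hs. h x) * (\<Sum>h\<leftarrow>hs'. h x))"
      using 1(1)
    proof (induction hs)
      case (Cons h hs)
      then obtain m where "homog_poly m h" by auto
      from s[OF this] Cons show ?case by (simp add: distrib_right Hadd)
    qed (use H0 in simp)
    then show ?case using 1 2 by simp
  qed
  then obtain hs where hs: "\<forall>h\<in>set hs. \<exists>m. homog_poly m h" "p = (\<lambda>x. \<Sum>h\<leftarrow>hs. h x)"
    unfolding H_def by blast
  have "P (\<lambda>x. \<Sum>h\<leftarrow>hs. h x) \<and> polyfun (\<lambda>x. \<Sum>h\<leftarrow>hs. h x)" using hs(1)
  proof (induction hs)
    case Nil
    then show ?case using z by (auto intro: polyfun.intros)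
  next
    case (Cons h hs)
    then show ?case using a by (auto intro!: polyfun.intros dest: homog_polyD)
  qed
  then show ?thesis using hs by simp
qed

lemma polyfun_eq_distinct:
  fixes p q :: "real^'n::finite \<Rightarrow> real"
  assumes p: "polyfun p" "polyfun q" and eq: "\<And>x. distinct_coords x \<Longrightarrow> p x = q x"
  shows "p = q"
proof
  fix x
  \<comment> \<open>Along a direction with pairwise different coordinates, two given coordinates of
    the moving point coincide for at most one parameter value, so the line leaves the distinct
    points only finitely often.\<close>
  obtain e :: "'n \<Rightarrow> nat" where e: "inj e" using finite_imp_inj_to_nat_seg[of "UNIV :: 'n set"] by auto
  define v :: "real^'n" where "v = (\<chi> i. real (e i))"
  define A where "A = (\<Union>i. \<Union>j. {- (x $ i - x $ j) / (v $ i - v $ j)})"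
  have fin: "finite A" unfolding A_def by auto
  have d: "distinct_coords (x + s *\<^sub>R v)" if "s \<notin> A" for s
    unfolding distinct_coords_def
  proof (intro allI impI notI)
    fix i j :: 'n assume ij: "i \<noteq> j" "(x + s *\<^sub>R v) $ i = (x + s *\<^sub>R v) $ j"
    then have "v $ i - v $ j \<noteq> 0" using e by (auto simp: v_def inj_def)
    with ij(2) have "s = - (x $ i - x $ j) / (v $ i - v $ j)" by (simp add: field_simps)
    with that show False unfolding A_def by auto
  qed
  have "p (x + 0 *\<^sub>R v) - q (x + 0 *\<^sub>R v) = 0"
  proof (rule continuous_zero_off_finite[OF fin, of "\<lambda>s. p (x + s *\<^sub>R v) - q (x + s *\<^sub>R v)"])
    show "continuous_on UNIV (\<lambda>s. p (x + s *\<^sub>R v) - q (x + s *\<^sub>R v))"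
      by (intro continuous_intros continuous_on_compose2[OF polyfun_continuous[OF p(1), of UNIV]]
            continuous_on_compose2[OF polyfun_continuous[OF p(2), of UNIV]]) auto
  qed (use d eq in auto)
  then show "p x = q x" by simp
qed

subsection \<open>Dunkl operators on polynomials\<close>

lemma dunkl_const [simp]: "dunkl k j (\<lambda>_. c) x = 0"
  by (simp add: dunkl_def)

lemma dunkl_add:
  "polyfun p \<Longrightarrow> polyfun q \<Longrightarrow> dunkl k j (\<lambda>x. p x + q x) x = dunkl k j p x + dunkl k j q x"
  unfolding dunkl_def partial_add
  by (simp add: algebra_simps add_divide_distrib diff_divide_distrib sum.distrib sum_subtractf)

lemma dunkl_cmult: "polyfun p \<Longrightarrow> dunkl k j (\<lambda>x. c * p x) x = c * dunkl k j p x"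
  unfolding dunkl_def partial_cmult
  by (simp add: algebra_simps diff_divide_distrib sum_distrib_left sum_subtractf)

lemma dunkl_diff:
  "polyfun p \<Longrightarrow> polyfun q \<Longrightarrow> dunkl k j (\<lambda>x. p x - q x) x = dunkl k j p x - dunkl k j q x"
  using dunkl_add[of p "\<lambda>x. (-1) * q x" k j x] dunkl_cmult[of q k j "-1" x] polyfun_cmult[of q "-1"] by simp

lemma dunkl_sum:
  "finite A \<Longrightarrow> (\<And>a. a \<in> A \<Longrightarrow> polyfun (p a)) \<Longrightarrow> dunkl k j (\<lambda>x. \<Sum>a\<in>A. p a x) x = (\<Sum>a\<in>A. dunkl k j (p a) x)"
  by (induction A rule: finite_induct) (auto simp: dunkl_add polyfun_sum)

lemma sw_eq_iff [simp]: "sw i l a = sw i l b \<longleftrightarrow> a = b"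
  by (metis sw_sw)

lemma sw_conj: "sw (sw i l j) (sw i l m) r = sw i l (sw j m (sw i l r))"
  by (auto simp: sw_def)

lemma swapvec_axis: "swapvec i l (axis j 1 :: real^'n) = axis (sw i l j) 1"
proof -
  have "sw i l m = j \<longleftrightarrow> m = sw i l j" for m by (metis sw_sw)
  then show ?thesis by (auto simp: vec_eq_iff swapvec_nth axis_def)
qed

lemma partial_swap:
  assumes "polyfun W"
  shows "partial_i j (\<lambda>x. W (swapvec i l x)) x = partial_i (sw i l j) W (swapvec i l x)"
proof -
  have "swapvec i l (x + s *\<^sub>R axis j 1) = swapvec i l x + s *\<^sub>R axis (sw i l j) 1" for s
    by (simp add: swapvec_permvec permvec_add permvec_scaleR swapvec_axis[unfolded swapvec_permvec])
  then show ?thesis by (simp add: partial_i_def)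
qed

text \<open>Equivariance of the Dunkl operators. The transposition permutes the difference quotients
  among themselves, quotient by quotient, so the identity holds on the diagonals as well.\<close>

lemma dunkl_swap:
  assumes "polyfun W"
  shows "dunkl k j (\<lambda>x. W (swapvec i l x)) x = dunkl k (sw i l j) W (swapvec i l x)"
proof -
  have sv: "swapvec (sw i l j) (sw i l m) (swapvec i l x) = swapvec i l (swapvec j m x)" for m
    by (simp add: vec_eq_iff swapvec_nth sw_conj)
  have "(\<Sum>m\<in>UNIV - {j}. (W (swapvec i l x) - W (swapvec i l (swapvec j m x))) / (x $ j - x $ m))
    = (\<Sum>m\<in>UNIV - {sw i l j}. (W (swapvec i l x) - W (swapvec (sw i l j) m (swapvec i l x))) / (swapvec i l x $ sw i l j - swapvec i l x $ m))"
    by (rule sum.reindex_bij_witness[of _ "sw i l" "sw i l"]) (auto simp: swapvec_nth simp flip: sv)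
  then show ?thesis by (simp add: dunkl_def partial_swap[OF assms])
qed

text \<open>By equivariance, T_j of the reflected sum is again a reflected sum, for the family of
  all T_j W, with transpositions moving the index together with the point.\<close>

lemma dunkl_reflop:
  assumes W: "polyfun W"
  shows "dunkl k j (reflop k c W) x = c * dunkl k j W x
    + k / 2 * (\<Sum>i\<in>UNIV. \<Sum>l\<in>UNIV. dunkl k j W x - dunkl k (sw i l j) W (swapvec i l x))"
proof -
  have P: "polyfun (\<lambda>x. W x - W (swapvec i l x))" for i l
    by (intro polyfun_diff polyfun_swapvec W)
  have P2: "polyfun (\<lambda>x. \<Sum>l\<in>UNIV. W x - W (swapvec i l x))" for i
    by (intro polyfun_sum P) auto
  have P3: "polyfun (\<lambda>x. \<Sum>i\<in>UNIV. \<Sum>l\<in>UNIV. W x - W (swapvec i l x))"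
    by (intro polyfun_sum P2) auto
  have "dunkl k j (\<lambda>x. c * W x + a * (\<Sum>i\<in>UNIV. \<Sum>l\<in>UNIV. W x - W (swapvec i l x))) x = c * dunkl k j W x
    + a * (\<Sum>i\<in>UNIV. \<Sum>l\<in>UNIV. dunkl k j W x - dunkl k (sw i l j) W (swapvec i l x))" for a
    by (simp add: dunkl_add dunkl_cmult polyfun_cmult W P P2 P3 dunkl_sum dunkl_diff polyfun_swapvec dunkl_swap)
  then show ?thesis unfolding reflop_def[abs_def] .
qed

text \<open>Commutator of T_j with multiplication by x_i. In the product rule for differences, x_i
  minus its value after swapping j and l is x_j - x_l, the negative of it, or 0, which cancels the
  denominator.\<close>

lemma dunkl_coord_mult:
  assumes V: "polyfun V" and x: "distinct_coords x"
  shows "dunkl k j (\<lambda>x. x $ i * V x) x = x $ i * dunkl k j V x + (if i = j then V x else 0)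
    + k * (\<Sum>l\<in>UNIV - {j}. ((if i = j then 1 else 0) - (if i = l then 1 else 0)) * V (swapvec j l x))"
proof -
  have t: "(x $ i * V x - swapvec j l x $ i * V (swapvec j l x)) / (x $ j - x $ l)
     = x $ i * ((V x - V (swapvec j l x)) / (x $ j - x $ l)) + ((if i = j then 1 else 0) - (if i = l then 1 else 0)) * V (swapvec j l x)"
    if l: "l \<in> UNIV - {j}" for l
  proof -
    have "x $ j - x $ l \<noteq> 0" using l x by (auto simp: distinct_coords_def)
    moreover have "x $ i - swapvec j l x $ i = ((if i = j then 1 else 0) - (if i = l then 1 else 0)) * (x $ j - x $ l)"
      using l by (auto simp: swapvec_nth sw_def)
    moreover have "x $ i * V x - swapvec j l x $ i * V (swapvec j l x)
       = x $ i * (V x - V (swapvec j l x)) + (x $ i - swapvec j l x $ i) * V (swapvec j l x)"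
      by (simp add: algebra_simps)
    ultimately show ?thesis by (simp add: add_divide_distrib)
  qed
  have "(\<Sum>l\<in>UNIV - {j}. (x $ i * V x - swapvec j l x $ i * V (swapvec j l x)) / (x $ j - x $ l))
    = x $ i * (\<Sum>l\<in>UNIV - {j}. (V x - V (swapvec j l x)) / (x $ j - x $ l))
    + (\<Sum>l\<in>UNIV - {j}. ((if i = j then 1 else 0) - (if i = l then 1 else 0)) * V (swapvec j l x))"
    using t by (simp add: sum.distrib sum_distrib_left)
  then show ?thesis
    by (simp add: dunkl_def partial_mult partial_coord polyfun.pf_coord V algebra_simps)
qed

text \<open>The contributions of (i, j) and (j, i) combine by x_i / (x_i - x_j) + x_j / (x_j - x_i)
  = 1, so the denominators disappear and plain differences remain. The gradient part is the
  classical Euler formula.\<close>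

lemma dunkl_euler:
  assumes p: "homog_poly n p" and x: "distinct_coords x"
  shows "(\<Sum>i\<in>UNIV. x $ i * dunkl k i p x) = reflop k (real n) p x"
proof -
  define D where "D i j = p x - p (swapvec i j x)" for i j
  have Ds: "D i j = D j i" "D i i = 0" for i j by (auto simp: D_def swapvec_commute)
  define t where "t i j = (if j = i then 0 else x $ i * D i j / (x $ i - x $ j))" for i j
  have sym: "t i j + t j i = D i j" for i j
  proof (cases "i = j")
    case False
    then have "x $ i - x $ j \<noteq> 0" "x $ j - x $ i \<noteq> 0" using x by (auto simp: distinct_coords_def)
    moreover have "x $ j * D i j / (x $ j - x $ i) = - (x $ j * D i j / (x $ i - x $ j))"
      by (metis minus_diff_eq minus_divide_right)
    ultimately show ?thesis using False unfolding t_def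
      by (simp add: Ds(1)[of j i] diff_divide_distrib[symmetric] left_diff_distrib[symmetric])
  qed (auto simp: t_def Ds)
  have "(\<Sum>i\<in>UNIV. \<Sum>j\<in>UNIV. D i j) = (\<Sum>i\<in>UNIV. \<Sum>j\<in>UNIV. t i j) + (\<Sum>i\<in>UNIV. \<Sum>j\<in>UNIV. t j i)"
    by (simp add: sym sum.distrib[symmetric])
  also have "(\<Sum>i\<in>UNIV. \<Sum>j\<in>UNIV. t j i) = (\<Sum>i\<in>UNIV. \<Sum>j\<in>UNIV. t i j)" by (rule sum.swap)
  finally have S: "(\<Sum>i\<in>UNIV. \<Sum>j\<in>UNIV. D i j) = 2 * (\<Sum>i\<in>UNIV. \<Sum>j\<in>UNIV. t i j)" by simp
  have St: "x $ i * (\<Sum>j\<in>UNIV - {i}. (p x - p (swapvec i j x)) / (x $ i - x $ j)) = (\<Sum>j\<in>UNIV. t i j)" for i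
  proof -
    have "(\<Sum>j\<in>UNIV. t i j) = (\<Sum>j\<in>UNIV - {i}. t i j)"
      by (rule sum.mono_neutral_right) (auto simp: t_def)
    also have "\<dots> = (\<Sum>j\<in>UNIV - {i}. x $ i * ((p x - p (swapvec i j x)) / (x $ i - x $ j)))"
      by (rule sum.cong) (auto simp: t_def D_def)
    finally show ?thesis by (simp add: sum_distrib_left)
  qed
  have "x $ i * dunkl k i p x = x $ i * partial_i i p x + k * (\<Sum>j\<in>UNIV. t i j)" for i
  proof -
    have "x $ i * (a + k * S) = x $ i * a + k * T" if "x $ i * S = T" for a S T
      using that by (simp add: algebra_simps)
    from this[OF St] show ?thesis unfolding dunkl_def .
  qed
  then have "(\<Sum>i\<in>UNIV. x $ i * dunkl k i p x) = (\<Sum>i\<in>UNIV. x $ i * partial_i i p x) + k * (\<Sum>i\<in>UNIV. \<Sum>j\<in>UNIV. t i j)"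
    by (simp add: sum.distrib sum_distrib_left)
  also have "\<dots> = reflop k (real n) p x"
    unfolding homog_euler[OF p] reflop_def D_def[symmetric] S by simp
  finally show ?thesis .
qed

text \<open>Meant for sums over transpositions (i l) of terms that vanish unless the fixed index j
  is moved.\<close>

lemma sum_cross:
  fixes D :: "'n::finite \<Rightarrow> 'n \<Rightarrow> real"
  assumes "\<And>i l. i \<noteq> j \<Longrightarrow> l \<noteq> j \<Longrightarrow> D i l = 0" "\<And>i l. D i l = D l i" "D j j = 0"
  shows "(\<Sum>i\<in>UNIV. \<Sum>l\<in>UNIV. D i l) = 2 * (\<Sum>l\<in>UNIV - {j}. D j l)"
proof -
  have 1: "(\<Sum>l\<in>UNIV. D i l) = D i j" if "i \<noteq> j" for i
  proof -
    have "(\<Sum>l\<in>UNIV. D i l) = (\<Sum>l\<in>{j}. D i l)"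
      by (rule sum.mono_neutral_right) (use assms(1) that in auto)
    then show ?thesis by simp
  qed
  have "(\<Sum>i\<in>UNIV. \<Sum>l\<in>UNIV. D i l) = (\<Sum>l\<in>UNIV. D j l) + (\<Sum>i\<in>UNIV - {j}. \<Sum>l\<in>UNIV. D i l)"
    by (subst sum.remove[of _ j]) auto
  also have "(\<Sum>l\<in>UNIV. D j l) = (\<Sum>l\<in>UNIV - {j}. D j l)"
    by (subst sum.remove[of _ j]) (auto simp: assms(3))
  also have "(\<Sum>i\<in>UNIV - {j}. \<Sum>l\<in>UNIV. D i l) = (\<Sum>i\<in>UNIV - {j}. D j i)"
    by (rule sum.cong) (auto simp: 1 assms(2)[of _ j])
  finally show ?thesis by simp
qed

text \<open>The defects \<open>T\<^sub>j W - V\<^sub>j\<close>, viewed as functions of \<open>(j, x)\<close>, satisfy the homogeneous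
  reflection equation for the joint action of the symmetric group on index and point; hence they
  vanish by the maximum principle.\<close>

lemma dunkl_poincare:
  fixes V :: "'n::finite \<Rightarrow> real^'n \<Rightarrow> real"
  assumes k: "k \<ge> 0" and V: "\<And>i. homog_poly n (V i)" and W: "polyfun W"
    and eq: "\<And>x. reflop k (real (Suc n)) W x = (\<Sum>i\<in>UNIV. x $ i * V i x)"
    and cl: "\<And>i j x. distinct_coords x \<Longrightarrow> dunkl k j (V i) x = dunkl k i (V j) x"
    and x: "distinct_coords x"
  shows "dunkl k j W x = V j x"
proof -
  have Vp: "polyfun (V i)" for i using V homog_polyD by blast
  have key: "real (Suc n) * (dunkl k j W y - V j y)
     + k / 2 * (\<Sum>i\<in>UNIV. \<Sum>l\<in>UNIV. (dunkl k j W y - V j y) - (dunkl k (sw i l j) W (swapvec i l y) - V (sw i l j) (swapvec i l y))) = 0"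
    if y: "distinct_coords y" for j y
  proof -
    have "reflop k (real (Suc n)) W = (\<lambda>x. \<Sum>i\<in>UNIV. x $ i * V i x)" using eq by auto
    then have "dunkl k j (reflop k (real (Suc n)) W) y = (\<Sum>i\<in>UNIV. dunkl k j (\<lambda>x. x $ i * V i x) y)"
      by (simp add: dunkl_sum polyfun.intros Vp)
    also have "\<dots> = (\<Sum>i\<in>UNIV. y $ i * dunkl k j (V i) y) + V j y
       + k * (\<Sum>i\<in>UNIV. \<Sum>l\<in>UNIV - {j}. ((if i = j then 1 else 0) - (if i = l then 1 else 0)) * V i (swapvec j l y))"
      by (simp add: dunkl_coord_mult[OF Vp y] sum.distrib sum_distrib_left)
    \<comment> \<open>Closedness exchanges the indices i and j, after which Euler's formula applies
      to the homogeneous \<open>V j\<close>.\<close>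
    also have "(\<Sum>i\<in>UNIV. y $ i * dunkl k j (V i) y) = reflop k (real n) (V j) y"
      using cl[OF y] dunkl_euler[OF V y, of k j] by simp
    also have "(\<Sum>i\<in>UNIV. \<Sum>l\<in>UNIV - {j}. ((if i = j then 1 else 0) - (if i = l then 1 else 0)) * V i (swapvec j l y))
       = (\<Sum>l\<in>UNIV - {j}. V j (swapvec j l y) - V l (swapvec j l y))"
    proof (subst sum.swap, rule sum.cong[OF refl])
      fix l
      have "(\<Sum>i\<in>UNIV. ((if i = j then 1 else 0) - (if i = l then 1 else 0)) * V i (swapvec j l y))
        = (\<Sum>i\<in>UNIV. (if i = j then V i (swapvec j l y) else 0) - (if i = l then V i (swapvec j l y) else 0))"
        by (rule sum.cong) auto
      then show "(\<Sum>i\<in>UNIV. ((if i = j then 1 else 0) - (if i = l then 1 else 0)) * V i (swapvec j l y))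
        = V j (swapvec j l y) - V l (swapvec j l y)"
        by (simp add: sum_subtractf)
    qed
    finally have E: "dunkl k j (reflop k (real (Suc n)) W) y = reflop k (real n) (V j) y + V j y
       + k * (\<Sum>l\<in>UNIV - {j}. V j (swapvec j l y) - V l (swapvec j l y))" .
    \<comment> \<open>\<open>D\<close> is the difference between reflecting the point alone and
      reflecting index and point together; the commutator terms from \<open>dunkl_coord_mult\<close>
      supply exactly this correction.\<close>
    define D where "D i l = V j (swapvec i l y) - V (sw i l j) (swapvec i l y)" for i l
    have "(\<Sum>i\<in>UNIV. \<Sum>l\<in>UNIV. D i l) = 2 * (\<Sum>l\<in>UNIV - {j}. D j l)"
      by (rule sum_cross) (auto simp: D_def sw_def swapvec_commute)
    moreover have "D j l = V j (swapvec j l y) - V l (swapvec j l y)" for l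
      by (simp add: D_def sw_def)
    ultimately have "(\<Sum>l\<in>UNIV - {j}. V j (swapvec j l y) - V l (swapvec j l y)) = (\<Sum>i\<in>UNIV. \<Sum>l\<in>UNIV. D i l) / 2"
      by simp
    with E have "dunkl k j (reflop k (real (Suc n)) W) y = reflop k (real n) (V j) y + V j y
       + k / 2 * (\<Sum>i\<in>UNIV. \<Sum>l\<in>UNIV. D i l)" by simp
    also have "\<dots> = real (Suc n) * V j y + k / 2 * (\<Sum>i\<in>UNIV. \<Sum>l\<in>UNIV. V j y - V (sw i l j) (swapvec i l y))"
      by (simp add: reflop_def D_def sum_subtractf algebra_simps)
    finally show ?thesis
      unfolding dunkl_reflop[OF W]
      by (simp add: sum_subtractf sum.distrib right_diff_distrib)
  qed
  have "\<bar>case (j, x) of (j, x) \<Rightarrow> dunkl k j W x - V j x\<bar> \<le> 0 / real (Suc n)"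
  proof (rule max_principle[where \<tau>="\<lambda>i l (j, y). (sw i l j, swapvec i l y)" and S="UNIV \<times> orbit x" and k=k and f="\<lambda>_. 0"
        and u="\<lambda>(j, x). dunkl k j W x - V j x" and s="(j, x)"])
    fix s :: "'n \<times> (real^'n)" assume "s \<in> UNIV \<times> orbit x"
    then obtain j y where s: "s = (j, y)" "y \<in> orbit x" by auto
    with key[OF orbit_distinct[OF s(2) x], of j]
    show "real (Suc n) * (case s of (j, x) \<Rightarrow> dunkl k j W x - V j x)
       + k / 2 * (\<Sum>i\<in>UNIV. \<Sum>l\<in>UNIV. (case s of (j, x) \<Rightarrow> dunkl k j W x - V j x)
          - (case (case s of (j, y) \<Rightarrow> (sw i l j, swapvec i l y)) of (j, x) \<Rightarrow> dunkl k j W x - V j x)) = 0"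
      by simp
  qed (use k in \<open>auto simp: swapvec_orbit\<close>)
  then show ?thesis by simp
qed

subsection \<open>The intertwining operator\<close>

text \<open>The component of the intertwining operator in degree n: it ignores all other homogeneous
  parts of p (\<open>Vn_homog_ne\<close>). Intertwining forces the sum of x_i T_i V p to equal the
  sum of x_i V (partial_i p); the recursion solves this relation by inverting the reflection
  operator.\<close>

primrec Vn :: "real \<Rightarrow> nat \<Rightarrow> (real^'n::finite \<Rightarrow> real) \<Rightarrow> real^'n \<Rightarrow> real" where
  "Vn k 0 p = (\<lambda>_. p 0)"
| "Vn k (Suc n) p = resolv k (real (Suc n)) (\<lambda>x. \<Sum>i\<in>UNIV. x $ i * Vn k n (partial_i i p) x)"

lemma Vn_homog: "polyfun p \<Longrightarrow> homog_poly n (Vn k n p)"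
proof (induction n arbitrary: p)
  case 0
  then show ?case by (simp add: homog_poly_def polyfun.intros)
next
  case (Suc n)
  have "homog_poly (1 + n) (\<lambda>x. x $ i * Vn k n (partial_i i p) x)" for i
    by (intro homog_mult homog_coord Suc polyfun_partial)
  moreover define F where "F = (\<lambda>x. \<Sum>i\<in>UNIV. x $ i * Vn k n (partial_i i p) x)"
  ultimately have "homog_poly (Suc n) F" unfolding F_def by (intro homog_sum) auto
  then have "homog_poly (Suc n) (\<lambda>x. \<Sum>g\<in>UNIV. resolv_coeff k (real (Suc n)) g * F (permvec g x))"
    by (intro homog_sum homog_cmult homog_permvec) auto
  then show ?case unfolding Vn.simps resolv_def[abs_def] F_def .
qed

lemma Vn_polyfun: "polyfun p \<Longrightarrow> polyfun (Vn k n p)"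
  using Vn_homog homog_polyD by blast

lemma Vn_add: "polyfun p \<Longrightarrow> polyfun q \<Longrightarrow> Vn k n (\<lambda>x. p x + q x) = (\<lambda>x. Vn k n p x + Vn k n q x)"
proof (induction n arbitrary: p q)
  case (Suc n)
  have "partial_i i (\<lambda>x. p x + q x) = (\<lambda>x. partial_i i p x + partial_i i q x)" for i
    using Suc.prems by (auto simp: partial_add)
  then show ?case
    using Suc by (auto simp: polyfun_partial distrib_left sum.distrib resolv_add)
qed simp

lemma Vn_cmult: "polyfun p \<Longrightarrow> Vn k n (\<lambda>x. c * p x) = (\<lambda>x. c * Vn k n p x)"
proof (induction n arbitrary: p)
  case (Suc n)
  have "partial_i i (\<lambda>x. c * p x) = (\<lambda>x. c * partial_i i p x)" for i
    using Suc.prems by (auto simp: partial_cmult)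
  then have "(\<lambda>x. \<Sum>i\<in>UNIV. x $ i * Vn k n (partial_i i (\<lambda>x. c * p x)) x) = (\<lambda>x. c * (\<Sum>i\<in>UNIV. x $ i * Vn k n (partial_i i p) x))"
    using Suc by (auto simp: polyfun_partial sum_distrib_left algebra_simps)
  then show ?case by (auto simp: resolv_cmult)
qed simp

lemma Vn_zero: "Vn k n (\<lambda>_. 0) = (\<lambda>_. 0)"
  using Vn_cmult[of "\<lambda>_. 0" k n 0] by (simp add: polyfun.intros)

lemma Vn_homog_ne: "homog_poly m p \<Longrightarrow> m \<noteq> n \<Longrightarrow> Vn k n p = (\<lambda>_. 0)"
proof (induction n arbitrary: p m)
  case 0
  then show ?case by (auto simp: homog_at_0)
next
  case (Suc n)
  have "Vn k n (partial_i i p) = (\<lambda>_. 0)" for i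
  proof (cases m)
    case 0
    then show ?thesis using Suc.prems by (simp add: partial_homog_0 Vn_zero)
  next
    case (Suc m')
    then show ?thesis using Suc.IH[of m' "partial_i i p"] Suc.prems homog_partial by auto
  qed
  then show ?case by (auto simp: resolv_def)
qed

lemma reflop_Vn:
  assumes "k \<ge> 0"
  shows "reflop k (real (Suc n)) (Vn k (Suc n) p) x = (\<Sum>i\<in>UNIV. x $ i * Vn k n (partial_i i p) x)"
  using reflop_resolv[of "real (Suc n)" k] assms by simp

text \<open>The recursion provides only the combination of the T_j weighted with the coordinates.
  The separate relations come from \<open>dunkl_poincare\<close>, whose closedness condition is the
  induction hypothesis together with the symmetry of second derivatives.\<close>

lemma Vn_dunkl:
  assumes k: "k \<ge> 0"
  shows "polyfun p \<Longrightarrow> distinct_coords x \<Longrightarrow> dunkl k j (Vn k (Suc n) p) x = Vn k n (partial_i j p) x"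
proof (induction n arbitrary: p j x)
  case 0
  show ?case
  proof (rule dunkl_poincare[OF k, of 0 "\<lambda>i. Vn k 0 (partial_i i p)"])
    show "homog_poly 0 (Vn k 0 (partial_i i p))" for i
      using 0 by (intro Vn_homog polyfun_partial)
    show "polyfun (Vn k (Suc 0) p)" using 0 by (intro Vn_polyfun)
    show "reflop k (real (Suc 0)) (Vn k (Suc 0) p) x = (\<Sum>i\<in>UNIV. x $ i * Vn k 0 (partial_i i p) x)" for x
      by (rule reflop_Vn[OF k])
  qed (use 0 in simp_all)
next
  case (Suc n)
  show ?case
  proof (rule dunkl_poincare[OF k, of "Suc n" "\<lambda>i. Vn k (Suc n) (partial_i i p)"])
    show "homog_poly (Suc n) (Vn k (Suc n) (partial_i i p))" for i
      using Suc.prems by (intro Vn_homog polyfun_partial)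
    show "polyfun (Vn k (Suc (Suc n)) p)" using Suc.prems by (intro Vn_polyfun)
    show "reflop k (real (Suc (Suc n))) (Vn k (Suc (Suc n)) p) x = (\<Sum>i\<in>UNIV. x $ i * Vn k (Suc n) (partial_i i p) x)" for x
      by (rule reflop_Vn[OF k])
    fix i j and x :: "real^'a" assume x: "distinct_coords x"
    have "partial_i j (partial_i i p) = partial_i i (partial_i j p)"
      using partial_commute[OF Suc.prems(1)] by auto
    then show "dunkl k j (Vn k (Suc n) (partial_i i p)) x = dunkl k i (Vn k (Suc n) (partial_i j p)) x"
      using Suc.IH[OF polyfun_partial[OF Suc.prems(1)] x] by (simp del: Vn.simps)
  qed (use Suc.prems in auto)
qed

text \<open>The condition inside the definite description of \<open>Vk\<close>, named so that
  existence and uniqueness can be stated.\<close>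

definition intertwines :: "real \<Rightarrow> ((real^'n::finite \<Rightarrow> real) \<Rightarrow> real^'n \<Rightarrow> real) \<Rightarrow> bool" where
  "intertwines k V \<longleftrightarrow>
      (\<forall>p. \<not> polyfun p \<longrightarrow> V p = (\<lambda>_. 0)) \<and>
      (\<forall>p. polyfun p \<longrightarrow> polyfun (V p)) \<and>
      (\<forall>p q. polyfun p \<longrightarrow> polyfun q \<longrightarrow> V (\<lambda>x. p x + q x) = (\<lambda>x. V p x + V q x)) \<and>
      (\<forall>c p. polyfun p \<longrightarrow> V (\<lambda>x. c * p x) = (\<lambda>x. c * V p x)) \<and>
      (\<forall>m p. homog_poly m p \<longrightarrow> homog_poly m (V p)) \<and>
      V (\<lambda>_. 1) = (\<lambda>_. 1) \<and>
      (\<forall>i p x. polyfun p \<longrightarrow> distinct_coords x \<longrightarrow>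
          dunkl k i (V p) x = V (partial_i i p) x)"

lemma intertwinesD:
  assumes "intertwines k V"
  shows "\<And>p. \<not> polyfun p \<Longrightarrow> V p = (\<lambda>_. 0)"
    and "\<And>p q. polyfun p \<Longrightarrow> polyfun q \<Longrightarrow> V (\<lambda>x. p x + q x) = (\<lambda>x. V p x + V q x)"
    and "\<And>c p. polyfun p \<Longrightarrow> V (\<lambda>x. c * p x) = (\<lambda>x. c * V p x)"
    and "\<And>m p. homog_poly m p \<Longrightarrow> homog_poly m (V p)"
    and "V (\<lambda>_. 1) = (\<lambda>_. 1)"
    and "\<And>i p x. polyfun p \<Longrightarrow> distinct_coords x \<Longrightarrow> dunkl k i (V p) x = V (partial_i i p) x"
  using assms unfolding intertwines_def by simp_all

text \<open>By Euler's formula, any intertwiner obeys the recursion of \<open>Vn\<close> at points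
  with distinct coordinates. Injectivity of the reflection operator on orbits, and then continuity,
  determine it in each degree.\<close>

lemma intertwines_homog:
  assumes k: "k \<ge> 0" and V: "intertwines k V"
  shows "homog_poly m p \<Longrightarrow> V p = Vn k m p"
proof (induction m arbitrary: p)
  case 0
  define c where "c = p 0"
  have p: "p = (\<lambda>_. c)" unfolding c_def by (rule homog_0_const[OF 0])
  have "V (\<lambda>x. c * 1) = (\<lambda>x. c * V (\<lambda>_. 1) x)"
    by (rule intertwinesD(3)[OF V pf_const])
  then show ?case by (simp add: p intertwinesD(5)[OF V])
next
  case (Suc m)
  have pp: "polyfun p" using Suc.prems homog_polyD by blast
  have h: "homog_poly (Suc m) (V p)" using intertwinesD(4)[OF V Suc.prems] .
  show ?case
  proof (rule polyfun_eq_distinct)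
    show "polyfun (V p)" using h homog_polyD by blast
    show "polyfun (Vn k (Suc m) p)" using pp by (rule Vn_polyfun)
    fix x :: "real^'a" assume x: "distinct_coords x"
    show "V p x = Vn k (Suc m) p x"
    proof (rule reflop_inj[of "real (Suc m)" k])
      fix s assume "s \<in> orbit x"
      then have s: "distinct_coords s" using x orbit_distinct by blast
      have "reflop k (real (Suc m)) (V p) s = (\<Sum>i\<in>UNIV. s $ i * dunkl k i (V p) s)"
        by (rule dunkl_euler[OF h s, symmetric])
      also have "\<dots> = (\<Sum>i\<in>UNIV. s $ i * V (partial_i i p) s)"
        using intertwinesD(6)[OF V pp s] by simp
      also have "\<dots> = (\<Sum>i\<in>UNIV. s $ i * Vn k m (partial_i i p) s)"
        using Suc.IH[OF homog_partial[OF Suc.prems]] by simp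
      also have "\<dots> = reflop k (real (Suc m)) (Vn k (Suc m) p) s"
        by (rule reflop_Vn[OF k, symmetric])
      finally show "reflop k (real (Suc m)) (V p) s = reflop k (real (Suc m)) (Vn k (Suc m) p) s" .
    qed (use k in auto)
  qed
qed

lemma intertwines_unique:
  assumes k: "k \<ge> 0" and V: "intertwines k V" "intertwines k V'"
  shows "V = V'"
proof
  fix p
  show "V p = V' p"
  proof (cases "polyfun p")
    case True
    then show ?thesis
    proof (induction p rule: polyfun_hom_induct)
      case zero
      have "homog_poly 0 (\<lambda>_ :: real^'a. 0)" by simp
      then show ?case using intertwines_homog[OF k V(1)] intertwines_homog[OF k V(2)] by simp
    next
      case (add m h q)
      have "V h = V' h" using intertwines_homog[OF k V(1) add(1)] intertwines_homog[OF k V(2) add(1)] by simp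
      moreover have "V (\<lambda>x. h x + q x) = (\<lambda>x. V h x + V q x)" "V' (\<lambda>x. h x + q x) = (\<lambda>x. V' h x + V' q x)"
        using intertwinesD(2)[OF V(1) homog_polyD[OF add(1)] add(2)] intertwinesD(2)[OF V(2) homog_polyD[OF add(1)] add(2)] by simp_all
      ultimately show ?case using add by simp
    qed
  next
    case False
    then show ?thesis using intertwinesD(1)[OF V(1)] intertwinesD(1)[OF V(2)] by simp
  qed
qed

text \<open>The candidate for existence: on a polynomial only finitely many terms are nonzero, and
  off polynomials the value 0 matches the normalization in \<open>Vk\<close>.\<close>

definition Vsum :: "real \<Rightarrow> (real^'n::finite \<Rightarrow> real) \<Rightarrow> real^'n \<Rightarrow> real" where
  "Vsum k p x = (if polyfun p then \<Sum>n. Vn k n p x else 0)"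

lemma Vn_eventually_zero: "polyfun p \<Longrightarrow> \<exists>d. \<forall>n\<ge>d. Vn k n p = (\<lambda>_. 0)"
proof (induction p rule: polyfun_hom_induct)
  case zero
  then show ?case by (simp add: Vn_zero)
next
  case (add m h q)
  then obtain d where "\<forall>n\<ge>d. Vn k n q = (\<lambda>_. 0)" by blast
  then have "\<forall>n\<ge>max d (Suc m). Vn k n (\<lambda>x. h x + q x) = (\<lambda>_. 0)"
    using add by (auto simp: Vn_add homog_polyD Vn_homog_ne)
  then show ?case by blast
qed

lemma Vsum_finite:
  assumes "polyfun p" "\<forall>n\<ge>d. Vn k n p = (\<lambda>_. 0)"
  shows "Vsum k p = (\<lambda>x. \<Sum>n<d. Vn k n p x)"
proof
  fix x show "Vsum k p x = (\<Sum>n<d. Vn k n p x)"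
    unfolding Vsum_def using assms suminf_finite[of "{..<d}" "\<lambda>n. Vn k n p x"] by (auto simp: not_less)
qed

lemma intertwines_Vsum:
  fixes V :: "(real^'a::finite \<Rightarrow> real) \<Rightarrow> real^'a \<Rightarrow> real"
  assumes k: "k \<ge> 0" shows "intertwines k V \<longleftrightarrow> V = Vsum k"
proof -
  have hom: "Vsum k p = Vn k m p" if "homog_poly m p" for m and p :: "real^'a \<Rightarrow> real"
  proof -
    have "Vsum k p = (\<lambda>x. \<Sum>n<Suc m. Vn k n p x)"
      by (rule Vsum_finite) (use that in \<open>auto simp: homog_polyD Vn_homog_ne simp del: Vn.simps\<close>)
    moreover have "(\<Sum>n<Suc m. Vn k n p x) = Vn k m p x" for x
      using Vn_homog_ne[OF that, of _ k] by (simp add: sum.neutral del: Vn.simps)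
    ultimately show ?thesis by simp
  qed
  have "intertwines k (Vsum k :: (real^'a \<Rightarrow> real) \<Rightarrow> real^'a \<Rightarrow> real)"
    unfolding intertwines_def
  proof (intro conjI allI impI)
    fix p :: "real^'a \<Rightarrow> real" assume "\<not> polyfun p"
    then show "Vsum k p = (\<lambda>_. 0)" by (auto simp: Vsum_def)
  next
    fix p :: "real^'a \<Rightarrow> real" assume p: "polyfun p"
    from Vn_eventually_zero[OF p] obtain d where "\<forall>n\<ge>d. Vn k n p = (\<lambda>_. 0)" by blast
    from Vsum_finite[OF p this] show "polyfun (Vsum k p)"
      using Vn_polyfun[OF p] by (simp add: polyfun_sum)
  next
    fix p q :: "real^'a \<Rightarrow> real" assume p: "polyfun p" "polyfun q"
    obtain d where d: "\<forall>n\<ge>d. Vn k n p = (\<lambda>_. 0)" using Vn_eventually_zero[OF p(1)] by blast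
    obtain e where e: "\<forall>n\<ge>e. Vn k n q = (\<lambda>_. 0)" using Vn_eventually_zero[OF p(2)] by blast
    show "Vsum k (\<lambda>x. p x + q x) = (\<lambda>x. Vsum k p x + Vsum k q x)"
      using Vsum_finite[of p "max d e" k] Vsum_finite[of q "max d e" k] Vsum_finite[of "\<lambda>x. p x + q x" "max d e" k] p d e
      by (simp add: Vn_add polyfun.intros sum.distrib)
  next
    fix c and p :: "real^'a \<Rightarrow> real" assume p: "polyfun p"
    obtain d where d: "\<forall>n\<ge>d. Vn k n p = (\<lambda>_. 0)" using Vn_eventually_zero[OF p(1)] by blast
    show "Vsum k (\<lambda>x. c * p x) = (\<lambda>x. c * Vsum k p x)"
      using Vsum_finite[of p d k] Vsum_finite[of "\<lambda>x. c * p x" d k] p d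
      by (simp add: Vn_cmult polyfun_cmult sum_distrib_left)
  next
    fix m and p :: "real^'a \<Rightarrow> real" assume "homog_poly m p"
    then show "homog_poly m (Vsum k p)" by (simp add: hom Vn_homog homog_polyD)
  next
    have "homog_poly 0 (\<lambda>_ :: real^'a. 1)" by (simp add: homog_poly_def polyfun.intros)
    from hom[OF this] show "Vsum k (\<lambda>_ :: real^'a. 1) = (\<lambda>_. 1)" by simp
  next
    fix i and p :: "real^'a \<Rightarrow> real" and x :: "real^'a" assume p: "polyfun p" and x: "distinct_coords x"
    obtain d where d: "\<forall>n\<ge>d. Vn k n p = (\<lambda>_. 0)" using Vn_eventually_zero[OF p(1)] by blast
    obtain e where e: "\<forall>n\<ge>e. Vn k n (partial_i i p) = (\<lambda>_. 0)" using Vn_eventually_zero[OF polyfun_partial[OF p(1)]] by blast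
    let ?d = "max d e"
    \<comment> \<open>One more term than for the derivative: T_i lowers the degree by one and kills
      the constant component.\<close>
    have "Vsum k p = (\<lambda>x. \<Sum>n<Suc ?d. Vn k n p x)"
      by (rule Vsum_finite) (use p d in auto)
    then have "dunkl k i (Vsum k p) x = (\<Sum>n<Suc ?d. dunkl k i (Vn k n p) x)"
      by (simp add: dunkl_sum Vn_polyfun p del: sum.lessThan_Suc)
    also have "\<dots> = (\<Sum>n<?d. Vn k n (partial_i i p) x)"
      by (subst sum.lessThan_Suc_shift) (simp add: Vn_dunkl[OF k p x] del: Vn.simps(2))
    also have "\<dots> = Vsum k (partial_i i p) x"
      by (subst Vsum_finite[of _ ?d]) (use polyfun_partial[OF p] e in auto)
    finally show "dunkl k i (Vsum k p) x = Vsum k (partial_i i p) x" .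
  qed
  then show ?thesis using intertwines_unique[OF k] by blast
qed

lemma Vk_homog:
  assumes k: "k \<ge> 0" and p: "homog_poly m p"
  shows "Vk k p = Vn k m p"
proof -
  have "Vk k = (THE V. intertwines k V)" unfolding Vk_def intertwines_def by simp
  then have "intertwines k (Vk k)" by (simp add: intertwines_Vsum[OF k])
  from intertwines_homog[OF k this p] show ?thesis .
qed

subsection \<open>The Dunkl kernel\<close>

definition dke :: "real \<Rightarrow> nat \<Rightarrow> real^'n::finite \<Rightarrow> real^'n \<Rightarrow> real" where
  "dke k n x y = Vn k n (\<lambda>w. (w \<bullet> y) ^ n / fact n) x"

lemma inner_pow_homog: "homog_poly n (\<lambda>w. (w \<bullet> y) ^ n / fact n :: real)"
proof -
  have "polyfun (\<lambda>w. inverse (fact n) * (w \<bullet> y) ^ n :: real)"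
    by (intro polyfun_cmult polyfun_power polyfun_inner)
  then show ?thesis by (simp add: homog_poly_def power_mult_distrib field_simps)
qed

lemma partial_inner_pow:
  fixes y :: "real^'n::finite"
  shows "partial_i i (\<lambda>w. (w \<bullet> y) ^ Suc n / fact (Suc n)) = (\<lambda>w. y $ i * ((w \<bullet> y) ^ n / fact n))"
proof
  fix w :: "real^'n"
  have "((\<lambda>s. ((w + s *\<^sub>R axis i 1) \<bullet> y) ^ Suc n / fact (Suc n)) has_real_derivative
      (real (Suc n) * (w \<bullet> y) ^ n * (axis i 1 \<bullet> y)) / fact (Suc n)) (at 0)"
    by (auto intro!: derivative_eq_intros simp: inner_add_left simp del: power_Suc of_nat_Suc fact_Suc)
  then have "partial_i i (\<lambda>w. (w \<bullet> y) ^ Suc n / fact (Suc n)) w = (real (Suc n) * (w \<bullet> y) ^ n * (axis i 1 \<bullet> y)) / fact (Suc n)"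
    unfolding partial_i_def by (rule DERIV_imp_deriv)
  also have "\<dots> = y $ i * ((w \<bullet> y) ^ n / fact n)"
    by (simp add: cart_eq_inner_axis inner_commute field_simps del: of_nat_Suc)
  finally show "partial_i i (\<lambda>w. (w \<bullet> y) ^ Suc n / fact (Suc n)) w = y $ i * ((w \<bullet> y) ^ n / fact n)" .
qed

lemma dke_0 [simp]: "dke k 0 x y = 1"
  by (simp add: dke_def)

lemma dke_polyfun: "polyfun (\<lambda>x. dke k n x y)"
  unfolding dke_def by (intro Vn_polyfun homog_polyD[OF inner_pow_homog])

lemma Vn_partial_inner_pow:
  "Vn k n (partial_i i (\<lambda>w. (w \<bullet> y) ^ Suc n / fact (Suc n))) x = y $ i * dke k n x y"
  unfolding partial_inner_pow dke_def
  by (subst Vn_cmult[OF homog_polyD[OF inner_pow_homog]]) simp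

text \<open>As the reflection operator is injective, this equation determines \<open>dke\<close>
  degree by degree. Invariance, symmetry and growth of the kernel are all read off from it by
  induction on n.\<close>

lemma dke_rec:
  assumes "k \<ge> 0"
  shows "reflop k (real (Suc n)) (\<lambda>x. dke k (Suc n) x y) x = (x \<bullet> y) * dke k n x y"
proof -
  have "reflop k (real (Suc n)) (\<lambda>x. dke k (Suc n) x y) x = (\<Sum>i\<in>UNIV. x $ i * (y $ i * dke k n x y))"
    unfolding dke_def[of k "Suc n"] reflop_Vn[OF assms] Vn_partial_inner_pow ..
  then show ?thesis by (simp add: inner_vec_def sum_distrib_right mult.assoc)
qed

lemma dke_dunkl_left:
  assumes "k \<ge> 0" "distinct_coords x"
  shows "dunkl k i (\<lambda>x. dke k (Suc n) x y) x = y $ i * dke k n x y"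
  unfolding dke_def[of k "Suc n"] Vn_dunkl[OF assms(1) homog_polyD[OF inner_pow_homog] assms(2)] Vn_partial_inner_pow ..

lemma permvec_swapvec:
  assumes "bij g" shows "permvec g (swapvec (g i) (g j) s) = swapvec i j (permvec g s)"
proof -
  have "sw (g i) (g j) (g l) = g (sw i j l)" for l
    using assms by (auto simp: sw_def bij_def inj_def)
  then show ?thesis by (simp add: vec_eq_iff swapvec_nth)
qed

lemma reflop_permvec:
  assumes g: "bij g"
  shows "reflop k c (\<lambda>x. u (permvec g x)) s = reflop k c u (permvec g s)"
proof -
  have "(\<Sum>i\<in>UNIV. \<Sum>j\<in>UNIV. u (permvec g s) - u (permvec g (swapvec i j s)))
    = (\<Sum>i\<in>UNIV. \<Sum>j\<in>UNIV. u (permvec g s) - u (permvec g (swapvec (g i) (g j) s)))"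
    by (subst sum.reindex_bij_betw[OF g, symmetric], rule sum.cong[OF refl], subst sum.reindex_bij_betw[OF g, symmetric]) simp
  then show ?thesis by (simp add: reflop_def permvec_swapvec[OF g])
qed

lemma dke_permvec:
  assumes k: "k \<ge> 0" and g: "bij g"
  shows "dke k n (permvec g x) (permvec g y) = dke k n x y"
proof (induction n arbitrary: x)
  case (Suc n)
  show ?case
  proof (rule reflop_inj[of "real (Suc n)" k x "\<lambda>x. dke k (Suc n) (permvec g x) (permvec g y)" "\<lambda>x. dke k (Suc n) x y"])
    fix s
    have "reflop k (real (Suc n)) (\<lambda>x. dke k (Suc n) (permvec g x) (permvec g y)) s
      = reflop k (real (Suc n)) (\<lambda>x. dke k (Suc n) x (permvec g y)) (permvec g s)"
      by (rule reflop_permvec[OF g])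
    also have "\<dots> = reflop k (real (Suc n)) (\<lambda>x. dke k (Suc n) x y) s"
      by (simp only: dke_rec[OF k] inner_permvec[OF g] Suc)
    finally show "reflop k (real (Suc n)) (\<lambda>x. dke k (Suc n) (permvec g x) (permvec g y)) s
      = reflop k (real (Suc n)) (\<lambda>x. dke k (Suc n) x y) s" .
  qed (use k in auto)
qed simp

text \<open>By invariance, a transposition of one argument can be moved to the other. The reflection
  operator may therefore be applied in either variable, and \<open>dke k (Suc n) x y\<close> and its
  mirror image solve the same equation.\<close>

lemma dke_commute:
  assumes k: "k \<ge> 0"
  shows "dke k n x y = dke k n y x"
proof (induction n arbitrary: x y)
  case (Suc n)
  show ?case
  proof (rule reflop_inj[of "real (Suc n)" k x "\<lambda>x. dke k (Suc n) x y" "\<lambda>x. dke k (Suc n) y x"])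
    fix s
    have "dke k (Suc n) y (swapvec i j s) = dke k (Suc n) (swapvec i j y) s" for i j
      using dke_permvec[OF k bij_sw[of i j], of "Suc n" y "swapvec i j s"]
      by (simp add: swapvec_permvec permvec_permvec)
    then have "reflop k (real (Suc n)) (\<lambda>x. dke k (Suc n) y x) s = reflop k (real (Suc n)) (\<lambda>y. dke k (Suc n) y s) y"
      by (simp add: reflop_def)
    also have "\<dots> = (s \<bullet> y) * dke k n s y" by (simp only: dke_rec[OF k] Suc[of y s] inner_commute)
    finally show "reflop k (real (Suc n)) (\<lambda>x. dke k (Suc n) x y) s = reflop k (real (Suc n)) (\<lambda>x. dke k (Suc n) y x) s"
      by (simp only: dke_rec[OF k])
  qed (use k in auto)
qed simp

lemma dke_polyfun_right: "k \<ge> 0 \<Longrightarrow> polyfun (\<lambda>y. dke k n x y)"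
  by (subst dke_commute) (auto intro: dke_polyfun)

lemma dke_dunkl:
  assumes "k \<ge> 0" "distinct_coords y"
  shows "dunkl k i (\<lambda>y. dke k (Suc n) x y) y = x $ i * dke k n x y"
  using dke_dunkl_left[OF assms, of i n x] by (simp add: dke_commute[OF assms(1), of _ x])

text \<open>The permutation orbit stays on a sphere, so Cauchy-Schwarz bounds the right side of
  \<open>dke_rec\<close> uniformly there; inverting the reflection operator then costs the factor 1
  / (n + 1), whatever \<open>k\<close> is.\<close>

lemma dke_bound:
  assumes k: "k \<ge> 0"
  shows "\<bar>dke k n x y\<bar> \<le> (norm x * norm y) ^ n / fact n"
proof (induction n arbitrary: x)
  case (Suc n)
  have "\<bar>dke k (Suc n) x y\<bar> \<le> (norm x * norm y) * ((norm x * norm y) ^ n / fact n) / real (Suc n)"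
  proof (rule reflop_bound[of "real (Suc n)" k x "\<lambda>x. dke k (Suc n) x y" _ x])
    fix s assume "s \<in> orbit x"
    then have s: "norm s = norm x" by (rule orbit_norm)
    have "\<bar>s \<bullet> y\<bar> * \<bar>dke k n s y\<bar> \<le> (norm s * norm y) * ((norm s * norm y) ^ n / fact n)"
      by (intro mult_mono Suc Cauchy_Schwarz_ineq2) auto
    then show "\<bar>reflop k (real (Suc n)) (\<lambda>x. dke k (Suc n) x y) s\<bar> \<le> (norm x * norm y) * ((norm x * norm y) ^ n / fact n)"
      by (simp only: dke_rec[OF k] abs_mult s)
  qed (use k in auto)
  then show ?case by (simp add: field_simps)
qed simp

lemma exp_sums_real: "(\<lambda>n. (a::real) ^ n / fact n) sums exp a"
  using exp_converges[of a] by (simp add: field_simps)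

lemma dke_sums:
  assumes "k \<ge> 0" shows "(\<lambda>n. dke k n x y) sums dunkl_kernel k x y"
proof -
  have "summable (\<lambda>n. dke k n x y)"
    by (rule summable_comparison_test'[of "\<lambda>n. (norm x * norm y) ^ n / fact n" 0])
       (use sums_summable[OF exp_sums_real] dke_bound[OF assms] in auto)
  moreover have "dunkl_kernel k x y = (\<Sum>n. dke k n x y)"
    unfolding dunkl_kernel_def dke_def by (simp add: Vk_homog[OF assms inner_pow_homog])
  ultimately show ?thesis by (simp add: summable_sums)
qed

lemma dke_partial_bound:
  assumes "k \<ge> 0" shows "\<bar>\<Sum>n<K. dke k n x y\<bar> \<le> exp (norm x * norm y)"
proof -
  have "\<bar>\<Sum>n<K. dke k n x y\<bar> \<le> (\<Sum>n<K. (norm x * norm y) ^ n / fact n)"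
    by (rule order_trans[OF sum_abs]) (intro sum_mono dke_bound assms)
  also have "\<dots> \<le> (\<Sum>n. (norm x * norm y) ^ n / fact n)"
    by (rule sum_le_suminf) (use sums_summable[OF exp_sums_real] in auto)
  also have "\<dots> = exp (norm x * norm y)" using exp_sums_real sums_unique by metis
  finally show ?thesis .
qed

lemma dunkl_kernel_bound:
  assumes "k \<ge> 0" shows "\<bar>dunkl_kernel k x y\<bar> \<le> exp (norm x * norm y)"
proof (rule LIMSEQ_le_const2)
  show "(\<lambda>K. \<bar>\<Sum>n<K. dke k n x y\<bar>) \<longlonglongrightarrow> \<bar>dunkl_kernel k x y\<bar>"
    using dke_sums[OF assms, of x y] unfolding sums_def by (rule tendsto_rabs)
qed (use dke_partial_bound[OF assms] in auto)

lemma dunkl_kernel_permvec: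
  assumes "k \<ge> 0" "bij g" shows "dunkl_kernel k (permvec g x) (permvec g y) = dunkl_kernel k x y"
  using dke_sums[OF assms(1), of x y] dke_sums[OF assms(1), of "permvec g x" "permvec g y"]
  by (simp add: dke_permvec[OF assms] sums_unique2)

lemma dunkl_kernel_measurable [measurable]:
  assumes "k \<ge> 0" shows "(\<lambda>y. dunkl_kernel k x y) \<in> borel_measurable borel"
proof (rule borel_measurable_LIMSEQ_real)
  show "(\<lambda>K. \<Sum>n<K. dke k n x y) \<longlonglongrightarrow> dunkl_kernel k x y" for y
    using dke_sums[OF assms, of x y] unfolding sums_def .
  show "(\<lambda>y. \<Sum>n<K. dke k n x y) \<in> borel_measurable borel" for K
    by (intro borel_measurable_continuous_onI polyfun_continuous polyfun_sum dke_polyfun_right assms) auto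
qed

subsection \<open>Isometries, scaling and Gaussian integrals\<close>

text \<open>Uniqueness of Haar measure in Fubini form: both \<open>\<lambda>\<close> and its image under an isometry are
  translation invariant, and they agree on the unit ball.\<close>

lemma nn_integral_isometry:
  fixes T S :: "'a::euclidean_space \<Rightarrow> 'a"
  assumes lin: "linear T" and nrm: "\<And>x. norm (T x) = norm x" and TS: "\<And>x. T (S x) = x"
    and f[measurable]: "f \<in> borel_measurable borel"
  shows "(\<integral>\<^sup>+x. f (T x) \<partial>lborel) = (\<integral>\<^sup>+x. f x \<partial>lborel)"
proof -
  define G :: "'a \<Rightarrow> ennreal" where "G = indicator (cball 0 1)"
  have [measurable]: "T \<in> borel_measurable borel"
    using lin by (intro borel_measurable_continuous_onI linear_continuous_on linear_conv_bounded_linear[THEN iffD1])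
  have [measurable]: "G \<in> borel_measurable borel" unfolding G_def by (intro borel_measurable_indicator) auto
  have tr: "(\<integral>\<^sup>+x. g (x + c) \<partial>lborel) = (\<integral>\<^sup>+x. g x \<partial>lborel)" if [measurable]: "g \<in> borel_measurable borel"
    for g :: "'a \<Rightarrow> ennreal" and c
    by (subst (2) lborel_distr_plus[of c, symmetric]) (simp add: nn_integral_distr add.commute)
  have Gneg: "G (- T x) = G x" for x by (simp add: G_def nrm indicator_def)
  let ?g = "\<integral>\<^sup>+x. G x \<partial>lborel"
  have "(\<integral>\<^sup>+x. f (T x) \<partial>lborel) * ?g = (\<integral>\<^sup>+x. \<integral>\<^sup>+y. f (T x) * G y \<partial>lborel \<partial>lborel)"
    by (simp add: nn_integral_cmult nn_integral_multc)
  also have "\<dots> = (\<integral>\<^sup>+x. \<integral>\<^sup>+y. f (T x) * G (y + (- T x)) \<partial>lborel \<partial>lborel)"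
    by (subst tr) auto
  also have "\<dots> = (\<integral>\<^sup>+y. \<integral>\<^sup>+x. f (T x) * G (y + (- T x)) \<partial>lborel \<partial>lborel)"
    by (rule lborel_pair.Fubini') measurable
  \<comment> \<open>Shifting x by \<open>S y\<close> turns T x into T x + y: the variable y leaves
    \<open>G\<close> and enters \<open>f\<close>, where it is the variable of integration.\<close>
  also have "\<dots> = (\<integral>\<^sup>+y. \<integral>\<^sup>+x. f (T (x + S y)) * G (y + (- T (x + S y))) \<partial>lborel \<partial>lborel)"
    by (rule nn_integral_cong, rule tr[symmetric]) measurable
  also have "\<dots> = (\<integral>\<^sup>+y. \<integral>\<^sup>+x. f (y + T x) * G x \<partial>lborel \<partial>lborel)"
    by (simp add: linear_add[OF lin] TS Gneg add.commute)
  also have "\<dots> = (\<integral>\<^sup>+x. \<integral>\<^sup>+y. f (y + T x) * G x \<partial>lborel \<partial>lborel)"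
    by (rule lborel_pair.Fubini') measurable
  also have "\<dots> = (\<integral>\<^sup>+x. (\<integral>\<^sup>+y. f y \<partial>lborel) * G x \<partial>lborel)"
    using tr[OF f] by (simp add: nn_integral_multc)
  also have "\<dots> = (\<integral>\<^sup>+y. f y \<partial>lborel) * ?g" by (simp add: nn_integral_cmult)
  finally have eq: "(\<integral>\<^sup>+x. f (T x) \<partial>lborel) * ?g = (\<integral>\<^sup>+y. f y \<partial>lborel) * ?g" .
  have g: "?g = emeasure lborel (cball (0::'a) 1)" unfolding G_def by simp
  have "?g \<noteq> top" unfolding g using emeasure_lborel_cball_finite[of "0::'a" 1] by simp
  moreover have "?g \<noteq> 0"
  proof -
    have "0 < measure lborel (ball (0::'a) 1)" by (rule content_ball_pos) simp
    then have "emeasure lborel (ball (0::'a) 1) \<noteq> 0" by (auto simp: measure_def)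
    moreover have "emeasure lborel (ball (0::'a) 1) \<le> ?g" unfolding g by (intro emeasure_mono ball_subset_cball) auto
    ultimately show ?thesis by auto
  qed
  ultimately show ?thesis using eq by (metis ennreal_mult_divide_eq)
qed

lemma lborel_isometry:
  fixes T S :: "'a::euclidean_space \<Rightarrow> 'a"
  assumes lin: "linear T" and nrm: "\<And>x. norm (T x) = norm x" and TS: "\<And>x. T (S x) = x"
  shows "distr lborel borel T = lborel"
proof (rule measure_eqI)
  have [measurable]: "T \<in> borel_measurable borel"
    using lin by (intro borel_measurable_continuous_onI linear_continuous_on linear_conv_bounded_linear[THEN iffD1])
  fix A assume "A \<in> sets (distr lborel borel T)"
  then have A[measurable]: "A \<in> sets borel" by simp
  have "emeasure (distr lborel borel T) A = (\<integral>\<^sup>+x. indicator A x \<partial>distr lborel borel T)" by simp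
  also have "\<dots> = (\<integral>\<^sup>+x. indicator A (T x) \<partial>lborel)" by (subst nn_integral_distr) auto
  also have "\<dots> = (\<integral>\<^sup>+x. indicator A x \<partial>lborel)" by (rule nn_integral_isometry[OF assms]) auto
  finally show "emeasure (distr lborel borel T) A = emeasure lborel A" by simp
qed simp

lemma
  fixes f :: "'a::euclidean_space \<Rightarrow> real" and T S :: "'a \<Rightarrow> 'a"
  assumes T: "linear T" "\<And>x. norm (T x) = norm x" "\<And>x. T (S x) = x" and [measurable]: "f \<in> borel_measurable borel"
  shows integral_isometry: "(\<integral>x. f (T x) \<partial>lborel) = (\<integral>x. f x \<partial>lborel)"
    and integrable_isometry: "integrable lborel (\<lambda>x. f (T x)) \<longleftrightarrow> integrable lborel f"
proof -
  have [measurable]: "T \<in> borel_measurable borel"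
    using T(1) by (intro borel_measurable_continuous_onI linear_continuous_on linear_conv_bounded_linear[THEN iffD1])
  show "(\<integral>x. f (T x) \<partial>lborel) = (\<integral>x. f x \<partial>lborel)"
    by (subst (2) lborel_isometry[OF T, symmetric]) (simp add: integral_distr)
  show "integrable lborel (\<lambda>x. f (T x)) \<longleftrightarrow> integrable lborel f"
    by (subst (2) lborel_isometry[OF T, symmetric]) (simp add: integrable_distr_eq)
qed

lemma linear_permvec: "linear (permvec g)"
  by (rule linearI) (simp_all add: permvec_add permvec_scaleR)

lemma permvec_inv: "bij g \<Longrightarrow> permvec g (permvec (inv g) x) = x"
  by (simp add: permvec_permvec inv_o_cancel[OF bij_is_inj])

lemma
  fixes f :: "real^'n \<Rightarrow> real"
  assumes "bij g" "f \<in> borel_measurable borel"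
  shows integral_permvec: "(\<integral>x. f (permvec g x) \<partial>lborel) = (\<integral>x. f x \<partial>lborel)"
    and integrable_permvec: "integrable lborel (\<lambda>x. f (permvec g x)) \<longleftrightarrow> integrable lborel f"
  using integral_isometry[of "permvec g" "permvec (inv g)" f] integrable_isometry[of "permvec g" "permvec (inv g)" f]
    assms by (simp_all add: linear_permvec norm_permvec permvec_inv)

lemma permvec_measurable [measurable]: "permvec g \<in> borel_measurable borel"
  by (intro borel_measurable_continuous_onI linear_continuous_on linear_conv_bounded_linear[THEN iffD1] linear_permvec)

lemma swapvec_measurable [measurable]: "swapvec i j \<in> borel_measurable borel"
proof -
  have "swapvec i j = permvec (sw i j)" by (auto simp: swapvec_permvec)
  then show ?thesis by simp
qed

lemma integral_lborel_scale:
  fixes f :: "'a::euclidean_space \<Rightarrow> real"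
  assumes "c > 0" and [measurable]: "f \<in> borel_measurable borel"
  shows "(\<integral>x. f x \<partial>lborel) = c ^ DIM('a) * (\<integral>x. f (c *\<^sub>R x) \<partial>lborel)"
  by (subst lborel_affine[of c 0])
     (use assms(1) in \<open>auto simp: integral_density integral_distr\<close>)

lemma gauss_1d: "c > 0 \<Longrightarrow> (\<integral>\<^sup>+x. ennreal (exp (- (c * x\<^sup>2) / 2)) \<partial>lborel) = ennreal (sqrt (2 * pi / c))"
proof -
  assume c: "c > 0"
  have s: "1 / sqrt c > 0" using c by simp
  have eq: "exp (- (c * x\<^sup>2) / 2) = sqrt (2 * pi / c) * normal_density 0 (1 / sqrt c) x" for x
    using c by (simp add: normal_density_def power_divide real_sqrt_mult real_sqrt_divide)
  have "has_bochner_integral lborel (\<lambda>x. sqrt (2 * pi / c) * normal_density 0 (1 / sqrt c) x) (sqrt (2 * pi / c) * 1)"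
    using s by (intro has_bochner_integral_mult_right) (simp add: has_bochner_integral_iff)
  then have "has_bochner_integral lborel (\<lambda>x. exp (- (c * x\<^sup>2) / 2)) (sqrt (2 * pi / c))"
    by (simp only: eq mult_1_right)
  then show ?thesis by (intro nn_integral_eq_integral[THEN trans]) (auto simp: has_bochner_integral_iff)
qed

lemma prod_Basis_cart:
  fixes f :: "real^'n \<Rightarrow> 'b::comm_monoid_mult"
  shows "(\<Prod>b\<in>Basis. f b) = (\<Prod>i\<in>UNIV. f (axis i 1))"
proof -
  have B: "Basis = range (\<lambda>i. axis i (1::real) :: real^'n)" by (auto simp: Basis_vec_def)
  have "inj (\<lambda>i. axis i (1::real) :: real^'n)" by (auto simp: inj_def axis_eq_axis)
  then show ?thesis unfolding B by (subst prod.reindex) auto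
qed

lemma gauss_prod:
  fixes c :: "'n::finite \<Rightarrow> real"
  assumes c: "\<And>i. c i > 0"
  shows "has_bochner_integral lborel (\<lambda>u::real^'n. exp (- (\<Sum>i\<in>UNIV. c i * (u $ i)\<^sup>2) / 2)) (\<Prod>i\<in>UNIV. sqrt (2 * pi / c i))"
proof (rule has_bochner_integral_nn_integral)
  have g1: "(\<integral>\<^sup>+x. ennreal (exp (- (c i * x\<^sup>2 / 2))) \<partial>lborel) = ennreal (sqrt (2 * pi / c i))" for i
    using gauss_1d[OF c, of i] by simp
  define idx :: "real^'n \<Rightarrow> 'n" where "idx b = (THE i. b = axis i 1)" for b
  have idx: "idx (axis i 1) = i" for i unfolding idx_def by (auto simp: axis_eq_axis)
  have "(\<integral>\<^sup>+u. (\<Prod>b\<in>Basis. ennreal (exp (- (c (idx b) * (u \<bullet> b)\<^sup>2) / 2))) \<partial>(lborel :: (real^'n) measure))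
     = (\<Prod>b\<in>Basis. \<integral>\<^sup>+x. ennreal (exp (- (c (idx b) * x\<^sup>2) / 2)) \<partial>lborel)"
    by (rule nn_integral_lborel_prod) auto
  moreover have "(\<Prod>b\<in>Basis. ennreal (exp (- (c (idx b) * (u \<bullet> b)\<^sup>2) / 2))) = ennreal (exp (- (\<Sum>i\<in>UNIV. c i * (u $ i)\<^sup>2) / 2))" for u :: "real^'n"
    by (simp add: prod_Basis_cart idx prod_ennreal exp_sum[symmetric] inner_axis sum_divide_distrib sum_negf)
  ultimately show "(\<integral>\<^sup>+u. ennreal (exp (- (\<Sum>i\<in>UNIV. c i * (u $ i)\<^sup>2) / 2)) \<partial>(lborel :: (real^'n) measure)) = ennreal (\<Prod>i\<in>UNIV. sqrt (2 * pi / c i))"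
    by (simp add: g1 c prod_Basis_cart idx prod_ennreal less_imp_le)
qed (auto intro!: prod_nonneg simp: c less_imp_le)

lemma norm_sq_cart: "(norm (y :: real^'n))\<^sup>2 = (\<Sum>i\<in>UNIV. (y $ i)\<^sup>2)"
  unfolding power2_norm_eq_inner inner_vec_def by (simp add: power2_eq_square)

lemma integrable_gauss:
  assumes "c > 0" shows "integrable lborel (\<lambda>y::real^'n. exp (- (c * (norm y)\<^sup>2)))"
  using gauss_prod[of "\<lambda>_::'n. 2 * c"] assms
  by (simp add: has_bochner_integral_iff norm_sq_cart sum_distrib_left[symmetric])

subsection \<open>Exponentially bounded functions\<close>

text \<open>At most exponential growth: closed under sums, products and nonnegative real powers of
  the absolute value, integrable against a Gaussian, and wide enough for polynomials, powers of the
  Vandermonde product and the kernel.\<close>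

definition expbd :: "('a::real_normed_vector \<Rightarrow> real) \<Rightarrow> bool" where
  "expbd f \<longleftrightarrow> (\<exists>C\<ge>0. \<exists>a\<ge>0. \<forall>y. \<bar>f y\<bar> \<le> C * exp (a * norm y))"

lemma expbdI: "C \<ge> 0 \<Longrightarrow> a \<ge> 0 \<Longrightarrow> (\<And>y. \<bar>f y\<bar> \<le> C * exp (a * norm y)) \<Longrightarrow> expbd f"
  unfolding expbd_def by blast

lemma expbd_const [simp]: "expbd (\<lambda>_. c)"
  by (rule expbdI[of "\<bar>c\<bar>" 0]) auto

lemma expbd_mono: "expbd g \<Longrightarrow> (\<And>y. \<bar>f y\<bar> \<le> \<bar>g y\<bar>) \<Longrightarrow> expbd f"
  unfolding expbd_def by (meson order_trans)

lemma expbd_add: "expbd f \<Longrightarrow> expbd g \<Longrightarrow> expbd (\<lambda>x. f x + g x)"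
proof -
  assume "expbd f" "expbd g"
  then obtain C a D b where C: "C \<ge> 0" "a \<ge> 0" "\<And>y. \<bar>f y\<bar> \<le> C * exp (a * norm y)"
    and D: "D \<ge> 0" "b \<ge> 0" "\<And>y. \<bar>g y\<bar> \<le> D * exp (b * norm y)" unfolding expbd_def by blast
  show ?thesis
  proof (rule expbdI[of "C + D" "a + b"])
    fix y
    have "\<bar>f y + g y\<bar> \<le> C * exp (a * norm y) + D * exp (b * norm y)"
      using C(3)[of y] D(3)[of y] by linarith
    also have "\<dots> \<le> C * exp ((a + b) * norm y) + D * exp ((a + b) * norm y)"
      using C D by (intro add_mono mult_left_mono) (auto intro!: mult_right_mono)
    finally show "\<bar>f y + g y\<bar> \<le> (C + D) * exp ((a + b) * norm y)" by (simp add: algebra_simps)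
  qed (use C D in auto)
qed

lemma expbd_mult: "expbd f \<Longrightarrow> expbd g \<Longrightarrow> expbd (\<lambda>x. f x * g x)"
proof -
  assume "expbd f" "expbd g"
  then obtain C a D b where C: "C \<ge> 0" "a \<ge> 0" "\<And>y. \<bar>f y\<bar> \<le> C * exp (a * norm y)"
    and D: "D \<ge> 0" "b \<ge> 0" "\<And>y. \<bar>g y\<bar> \<le> D * exp (b * norm y)" unfolding expbd_def by blast
  show ?thesis
  proof (rule expbdI[of "C * D" "a + b"])
    fix y
    have "\<bar>f y * g y\<bar> \<le> (C * exp (a * norm y)) * (D * exp (b * norm y))"
      unfolding abs_mult using C D by (intro mult_mono) auto
    also have "\<dots> = C * D * exp ((a + b) * norm y)" by (simp add: exp_add distrib_right)
    finally show "\<bar>f y * g y\<bar> \<le> C * D * exp ((a + b) * norm y)" .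
  qed (use C D in auto)
qed

lemma expbd_prod: "finite A \<Longrightarrow> (\<And>i. i \<in> A \<Longrightarrow> expbd (f i)) \<Longrightarrow> expbd (\<lambda>x. \<Prod>i\<in>A. f i x)"
  by (induction A rule: finite_induct) (auto intro: expbd_mult)

lemma expbd_exp: "a \<ge> 0 \<Longrightarrow> expbd (\<lambda>x. exp (a * norm x))"
  by (rule expbdI[of 1 a]) auto

lemma expbd_powr:
  assumes "expbd f" "b \<ge> 0" shows "expbd (\<lambda>x. \<bar>f x\<bar> powr b)"
proof -
  obtain C a where C: "C \<ge> 0" "a \<ge> 0" "\<And>y. \<bar>f y\<bar> \<le> C * exp (a * norm y)"
    using assms unfolding expbd_def by blast
  show ?thesis
  proof (rule expbdI[of "C powr b" "a * b"])
    fix y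
    have "\<bar>f y\<bar> powr b \<le> (C * exp (a * norm y)) powr b" using C assms by (intro powr_mono2) auto
    also have "\<dots> = C powr b * exp (a * b * norm y)"
      using C by (simp add: powr_mult exp_powr_real mult_ac)
    finally show "\<bar>\<bar>f y\<bar> powr b\<bar> \<le> C powr b * exp (a * b * norm y)" by simp
  qed (use C assms in auto)
qed

lemma expbd_coord: "expbd (\<lambda>y::real^'n. y $ i)"
proof (rule expbdI[of 1 1])
  fix y :: "real^'n"
  have "\<bar>y $ i\<bar> \<le> norm y" by (rule component_le_norm_cart)
  also have "\<dots> \<le> exp (norm y)" using exp_ge_add_one_self[of "norm y"] by linarith
  finally show "\<bar>y $ i\<bar> \<le> 1 * exp (1 * norm y)" by simp
qed auto

lemma expbd_polyfun: "polyfun p \<Longrightarrow> expbd p"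
  by (induction p rule: polyfun.induct) (auto intro: expbd_add expbd_mult expbd_coord)

lemma expbd_gauss:
  fixes f :: "'a::real_normed_vector \<Rightarrow> real"
  assumes "expbd f"
  obtains C where "C \<ge> 0" "\<And>y. \<bar>f y\<bar> * exp (- (norm y)\<^sup>2 / 2) \<le> C * exp (- (norm y)\<^sup>2 / 4)"
proof -
  obtain C a where C: "C \<ge> 0" "a \<ge> 0" "\<And>y. \<bar>f y\<bar> \<le> C * exp (a * norm y)"
    using assms unfolding expbd_def by blast
  show ?thesis
  proof (rule that[of "C * exp (a\<^sup>2)"])
    fix y :: 'a
    \<comment> \<open>From the square of a - |y| / 2: half of the Gaussian exponent absorbs the
      exponential growth.\<close>
    have *: "a * norm y + (- (norm y)\<^sup>2 / 2) \<le> a\<^sup>2 + (- (norm y)\<^sup>2 / 4)"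
      using zero_le_power2[of "a - norm y / 2"] by (simp add: power2_eq_square algebra_simps)
    have "\<bar>f y\<bar> * exp (- (norm y)\<^sup>2 / 2) \<le> (C * exp (a * norm y)) * exp (- (norm y)\<^sup>2 / 2)"
      using C by (intro mult_right_mono) auto
    also have "\<dots> = C * exp (a * norm y + (- (norm y)\<^sup>2 / 2))" by (simp only: exp_add mult.assoc)
    also have "\<dots> \<le> C * exp (a\<^sup>2 + (- (norm y)\<^sup>2 / 4))" using C * by (intro mult_left_mono) auto
    finally show "\<bar>f y\<bar> * exp (- (norm y)\<^sup>2 / 2) \<le> C * exp (a\<^sup>2) * exp (- (norm y)\<^sup>2 / 4)"
      by (simp only: exp_add mult.assoc)
  qed (use C in auto)
qed

lemma integrable_expbd_gauss:
  fixes f :: "real^'n \<Rightarrow> real"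
  assumes f: "expbd f" and [measurable]: "f \<in> borel_measurable borel"
  shows "integrable lborel (\<lambda>y. f y * exp (- (norm y)\<^sup>2 / 2))"
proof -
  obtain C where C: "C \<ge> 0" "\<And>y. \<bar>f y\<bar> * exp (- (norm y)\<^sup>2 / 2) \<le> C * exp (- (norm y)\<^sup>2 / 4)"
    using expbd_gauss[OF f] by blast
  have "integrable lborel (\<lambda>y::real^'n. C * exp (- (norm y)\<^sup>2 / 4))"
    using integrable_gauss[of "1/4", where 'n='n] by simp
  then show ?thesis
    by (rule Bochner_Integration.integrable_bound) (use C in \<open>auto intro!: AE_I2 simp: abs_mult\<close>)
qed

subsection \<open>Integration by parts\<close>

text \<open>Translation invariance makes the integral of every difference quotient vanish, and
  dominated convergence passes to the derivative. The mean value theorem evaluates g' at an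
  intermediate point, so D has to dominate g' along a whole segment around y.\<close>

lemma integral_partial_zero:
  fixes g g' D :: "real^'n \<Rightarrow> real"
  assumes der: "\<And>y s. ((\<lambda>s. g (y + s *\<^sub>R axis i 1)) has_real_derivative g' (y + s *\<^sub>R axis i 1)) (at s)"
    and g: "integrable lborel g" and D: "integrable lborel D"
    and bd: "\<And>y s. \<bar>s\<bar> \<le> 1 \<Longrightarrow> \<bar>g' (y + s *\<^sub>R axis i 1)\<bar> \<le> D y"
    and g'm[measurable]: "g' \<in> borel_measurable borel"
  shows "(\<integral>y. g' y \<partial>lborel) = 0"
proof -
  define e :: "real^'n" where "e = axis i 1"
  have gm[measurable]: "g \<in> borel_measurable borel" using g by auto
  define q where "q n y = (g (y + (1 / real (Suc n)) *\<^sub>R e) - g y) / (1 / real (Suc n))" for n y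
  have int0: "integrable lborel (\<lambda>y. g (y + v))" "(\<integral>y. g (y + v) \<partial>lborel) = (\<integral>y. g y \<partial>lborel)" for v
  proof -
    show "(\<integral>y. g (y + v) \<partial>lborel) = (\<integral>y. g y \<partial>lborel)"
      by (subst (2) lborel_distr_plus[of v, symmetric]) (simp add: integral_distr add.commute)
    have "integrable (distr lborel borel ((+) v)) g" using g by (simp add: lborel_distr_plus)
    then show "integrable lborel (\<lambda>y. g (y + v))" by (simp add: integrable_distr_eq add.commute)
  qed
  have q0: "(\<integral>y. q n y \<partial>lborel) = 0" for n
    unfolding q_def using int0 g by simp
  have "(\<lambda>n. \<integral>y. q n y \<partial>lborel) \<longlonglongrightarrow> (\<integral>y. g' y \<partial>lborel)"
  proof (rule integral_dominated_convergence[where w=D])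
    show "q n \<in> borel_measurable lborel" for n unfolding q_def by measurable
    show "AE y in lborel. (\<lambda>n. q n y) \<longlonglongrightarrow> g' y"
    proof (rule AE_I2)
      fix y
      have "((\<lambda>h. (g (y + (0 + h) *\<^sub>R e) - g (y + 0 *\<^sub>R e)) / h) \<longlongrightarrow> g' (y + 0 *\<^sub>R e)) (at 0)"
        using der[of y 0] unfolding DERIV_def e_def .
      then have "((\<lambda>h. (g (y + h *\<^sub>R e) - g y) / h) \<longlongrightarrow> g' y) (at 0)" by simp
      moreover have "filterlim (\<lambda>n. 1 / real (Suc n)) (at 0) sequentially"
        unfolding filterlim_at using LIMSEQ_inverse_real_of_nat by (auto simp: inverse_eq_divide)
      ultimately have "((\<lambda>n. (g (y + (1 / real (Suc n)) *\<^sub>R e) - g y) / (1 / real (Suc n))) \<longlongrightarrow> g' y) sequentially"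
        by (rule filterlim_compose)
      then show "(\<lambda>n. q n y) \<longlonglongrightarrow> g' y" unfolding q_def .
    qed
    show "AE y in lborel. norm (q n y) \<le> D y" for n
    proof (rule AE_I2)
      fix y
      let ?h = "1 / real (Suc n)"
      have h: "0 < ?h" "?h \<le> 1" by (auto simp: field_simps)
      obtain s where s: "0 < s" "s < ?h" "g (y + ?h *\<^sub>R e) - g (y + 0 *\<^sub>R e) = (?h - 0) * g' (y + s *\<^sub>R e)"
        using MVT2[of 0 ?h "\<lambda>s. g (y + s *\<^sub>R e)" "\<lambda>s. g' (y + s *\<^sub>R e)"] h(1) der[of y, folded e_def] by blast
      then have "q n y = g' (y + s *\<^sub>R e)" unfolding q_def using h by (simp del: of_nat_Suc)
      then show "norm (q n y) \<le> D y" using bd[of s y, folded e_def] s h by simp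
    qed
  qed (use D in auto)
  then show ?thesis unfolding q0 by (simp add: LIMSEQ_const_iff)
qed

lemma null_diag: "i \<noteq> j \<Longrightarrow> AE y :: real^'n in lborel. y $ i \<noteq> y $ j"
proof -
  assume ij: "i \<noteq> j"
  let ?S = "{y :: real^'n. (axis i 1 - axis j 1) \<bullet> y = 0}"
  have "axis i 1 - axis j 1 \<noteq> (0 :: real^'n)" using ij by (auto simp: vec_eq_iff axis_def intro!: exI[of _ i])
  then have "negligible ?S" by (intro negligible_hyperplane) auto
  then have "?S \<in> null_sets lebesgue" by (simp add: negligible_iff_null_sets)
  moreover have "?S \<in> sets lborel" by simp
  ultimately have "?S \<in> null_sets lborel" by (simp add: null_sets_completion_iff)
  moreover have "?S = {y. y $ i = y $ j}" by (auto simp: inner_diff_left inner_axis')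
  ultimately show ?thesis by (intro AE_I'[of "{y. y $ i = y $ j}"]) auto
qed

lemma AE_distinct: "AE y :: real^'n in lborel. distinct_coords y"
  unfolding distinct_coords_def
  by (intro AE_finite_allI[OF finite] AE_all_countable[THEN iffD2] allI) (use null_diag in auto)

subsection \<open>The Vandermonde weight\<close>

lemma hN_altdef: "hN y = (\<Prod>p\<in>{(i,j). i < j}. y $ snd p - y $ fst p)"
  unfolding hN_def by (rule prod.cong) auto

lemma hN_polyfun: "polyfun (hN :: (real,'n::{finite,linorder}) vec \<Rightarrow> real)"
proof -
  have "polyfun (\<lambda>y. \<Prod>p\<in>A. y $ snd p - y $ fst p)" if "finite A" for A :: "('n \<times> 'n) set"
    using that by (induction A rule: finite_induct) (auto intro!: pf_mult polyfun_diff pf_coord pf_const)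
  then show ?thesis by (simp add: hN_altdef[abs_def])
qed

lemma hN_nonzero: "distinct_coords y \<Longrightarrow> hN y \<noteq> 0"
  by (auto simp: hN_altdef distinct_coords_def)

text \<open>The square is a product over all ordered pairs of distinct indices, which a bijection
  merely reorders; absolute values discard the sign.\<close>

lemma hN_permvec:
  fixes y :: "(real,'n::{finite,linorder}) vec"
  assumes g: "bij g" shows "\<bar>hN (permvec g y)\<bar> = \<bar>hN y\<bar>"
proof -
  have Q: "\<bar>hN y\<bar>\<^sup>2 = (\<Prod>p\<in>{(i,j). i \<noteq> j}. \<bar>y $ snd p - y $ fst p\<bar>)" for y :: "(real,'n) vec"
  proof -
    have s: "{(i::'n,j). i \<noteq> j} = {(i,j). i < j} \<union> {(i,j). j < i}" by auto
    have "(\<Prod>p\<in>{(i::'n,j). j < i}. \<bar>y $ snd p - y $ fst p\<bar>) = (\<Prod>p\<in>{(i,j). i < j}. \<bar>y $ snd p - y $ fst p\<bar>)"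
      by (rule prod.reindex_bij_witness[of _ prod.swap prod.swap]) (auto simp: abs_minus_commute)
    then show ?thesis
      unfolding s by (subst prod.union_disjoint) (auto simp: hN_altdef abs_prod power2_eq_square)
  qed
  have "(\<Prod>p\<in>{(i,j). i \<noteq> j}. \<bar>permvec g y $ snd p - permvec g y $ fst p\<bar>) = (\<Prod>p\<in>{(i,j). i \<noteq> j}. \<bar>y $ snd p - y $ fst p\<bar>)"
    by (rule prod.reindex_bij_witness[of _ "map_prod (inv g) (inv g)" "map_prod g g"])
       (use g in \<open>auto simp: bij_def inj_eq surj_f_inv_f inj_eq[OF bij_is_inj[OF bij_imp_bij_inv[OF g]]]\<close>)
  then have "\<bar>hN (permvec g y)\<bar>\<^sup>2 = \<bar>hN y\<bar>\<^sup>2" by (simp only: Q)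
  then show ?thesis by (simp add: abs_eq_iff power2_eq_iff)
qed

lemma hN_partial:
  fixes y :: "(real,'n::{finite,linorder}) vec"
  assumes y: "distinct_coords y"
  shows "partial_i i hN y = hN y * (\<Sum>j\<in>UNIV - {i}. 1 / (y $ i - y $ j))"
proof -
  define P where "P = {(a::'n,b). a < b}"
  define d where "d p = ((if snd p = i then 1 else 0) - (if fst p = i then 1 else 0) :: real)" for p :: "'n \<times> 'n"
  have nz: "y $ snd p - y $ fst p \<noteq> 0" if "p \<in> P" for p
    using that y by (auto simp: P_def distinct_coords_def)
  have "((\<lambda>s. \<Prod>p\<in>P. (y + s *\<^sub>R axis i 1) $ snd p - (y + s *\<^sub>R axis i 1) $ fst p) has_real_derivative
     (\<Prod>p\<in>P. (y + 0 *\<^sub>R axis i 1) $ snd p - (y + 0 *\<^sub>R axis i 1) $ fst p) * (\<Sum>p\<in>P. d p / ((y + 0 *\<^sub>R axis i 1) $ snd p - (y + 0 *\<^sub>R axis i 1) $ fst p))) (at 0)"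
  proof (rule has_field_derivative_prod')
    fix p assume "p \<in> P"
    show "((\<lambda>s. (y + s *\<^sub>R axis i 1) $ snd p - (y + s *\<^sub>R axis i 1) $ fst p) has_real_derivative d p) (at 0)"
      by (auto intro!: derivative_eq_intros simp: d_def axis_def)
  qed (use nz in auto)
  then have "partial_i i hN y = hN y * (\<Sum>p\<in>P. d p / (y $ snd p - y $ fst p))"
    unfolding partial_i_def hN_altdef P_def by (intro DERIV_imp_deriv) simp
  also have "(\<Sum>p\<in>P. d p / (y $ snd p - y $ fst p))
    = (\<Sum>p\<in>P. (if snd p = i then 1 else 0) / (y $ snd p - y $ fst p)) + (\<Sum>p\<in>P. (if fst p = i then 1 else 0) / (y $ fst p - y $ snd p))"
    unfolding sum.distrib[symmetric] d_def
    by (rule sum.cong) (auto simp: diff_divide_distrib minus_divide_right)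
  also have "(\<Sum>p\<in>P. (if snd p = i then 1 else 0) / (y $ snd p - y $ fst p)) = (\<Sum>a\<in>{a. a < i}. 1 / (y $ i - y $ a))"
  proof -
    have "(\<Sum>p\<in>P. (if snd p = i then 1 else 0) / (y $ snd p - y $ fst p)) = (\<Sum>p\<in>(\<lambda>a. (a, i)) ` {a. a < i}. (if snd p = i then 1 else 0) / (y $ snd p - y $ fst p))"
      by (rule sum.mono_neutral_right) (auto simp: P_def)
    then show ?thesis by (subst (asm) sum.reindex) (auto simp: inj_on_def)
  qed
  also have "(\<Sum>p\<in>P. (if fst p = i then 1 else 0) / (y $ fst p - y $ snd p)) = (\<Sum>a\<in>{a. i < a}. 1 / (y $ i - y $ a))"
  proof -
    have "(\<Sum>p\<in>P. (if fst p = i then 1 else 0) / (y $ fst p - y $ snd p)) = (\<Sum>p\<in>(\<lambda>a. (i, a)) ` {a. i < a}. (if fst p = i then 1 else 0) / (y $ fst p - y $ snd p))"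
      by (rule sum.mono_neutral_right) (auto simp: P_def)
    then show ?thesis by (subst (asm) sum.reindex) (auto simp: inj_on_def)
  qed
  also have "(\<Sum>a\<in>{a. a < i}. 1 / (y $ i - y $ a)) + (\<Sum>a\<in>{a. i < a}. 1 / (y $ i - y $ a)) = (\<Sum>j\<in>UNIV - {i}. 1 / (y $ i - y $ j))"
    by (subst sum.union_disjoint[symmetric]) (auto intro!: sum.cong)
  finally show ?thesis .
qed

text \<open>One factor of the Vandermonde product is split off to absorb the singular 1 / (y_i -
  y_j) in the integration by parts, leaving an exponentially bounded cofactor.\<close>

lemma hN_factor:
  fixes i j :: "'n::{finite,linorder}"
  assumes ij: "i \<noteq> j"
  obtains r :: "(real,'n) vec \<Rightarrow> real" where "expbd r" "\<And>y. \<bar>hN y\<bar> = \<bar>y $ i - y $ j\<bar> * \<bar>r y\<bar>"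
proof -
  define q where "q = (if i < j then (i, j) else (j, i))"
  have q: "q \<in> {(a,b). a < b}" using ij by (auto simp: q_def)
  define r :: "(real,'n) vec \<Rightarrow> real" where "r y = (\<Prod>p\<in>{(a,b). a < b} - {q}. y $ snd p - y $ fst p)" for y
  show ?thesis
  proof
    show "expbd r" unfolding r_def
      by (intro expbd_prod expbd_polyfun polyfun_diff polyfun.intros) auto
    fix y :: "(real,'n) vec"
    have "hN y = (y $ snd q - y $ fst q) * r y"
      unfolding hN_altdef r_def by (rule prod.remove) (use q in auto)
    moreover have "\<bar>y $ snd q - y $ fst q\<bar> = \<bar>y $ i - y $ j\<bar>" by (auto simp: q_def)
    ultimately show "\<bar>hN y\<bar> = \<bar>y $ i - y $ j\<bar> * \<bar>r y\<bar>" by (simp add: abs_mult)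
  qed
qed

lemma hN_measurable [measurable]: "(hN :: (real,'n::{finite,linorder}) vec \<Rightarrow> real) \<in> borel_measurable borel"
  by (intro borel_measurable_continuous_onI polyfun_continuous hN_polyfun)

lemma polyfun_measurable: "polyfun p \<Longrightarrow> p \<in> borel_measurable borel"
  by (intro borel_measurable_continuous_onI polyfun_continuous)

section \<open>The weight of the Gaussian ensemble and its derivative\<close>

definition wt :: "real \<Rightarrow> (real,'n::{finite,linorder}) vec \<Rightarrow> real" where
  "wt k y = \<bar>hN y\<bar> powr (2 * k) * exp (- (norm y)\<^sup>2 / 2)"

lemma wt_nonneg [simp]: "wt k y \<ge> 0"
  by (simp add: wt_def)

lemma wt_permvec: "bij g \<Longrightarrow> wt k (permvec g y) = wt k y"
  by (simp add: wt_def hN_permvec norm_permvec)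

lemma wt_measurable [measurable]: "wt k \<in> borel_measurable borel"
  unfolding wt_def[abs_def] by measurable

lemma wt_integrable:
  assumes "k \<ge> 0" "expbd f" and [measurable]: "f \<in> borel_measurable borel"
  shows "integrable lborel (\<lambda>y. f y * wt k y)"
proof -
  have "integrable lborel (\<lambda>y. (f y * \<bar>hN y\<bar> powr (2 * k)) * exp (- (norm y)\<^sup>2 / 2))"
    by (intro integrable_expbd_gauss expbd_mult expbd_powr expbd_polyfun[OF hN_polyfun]) (use assms in auto)
  then show ?thesis by (simp add: wt_def mult.assoc)
qed

lemma wt_integrable_poly: "k \<ge> 0 \<Longrightarrow> polyfun p \<Longrightarrow> integrable lborel (\<lambda>y. p y * wt k y)"
  by (intro wt_integrable expbd_polyfun polyfun_measurable)

text \<open>For \<open>a > 1\<close> the function is differentiable also at 0, with derivative 0.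
  Taken with \<open>a = 2 * k\<close>, this makes the weight differentiable across its zero set and
  is a source of the later condition \<open>k \<ge> 1\<close>, harmless in the limit.\<close>

lemma DERIV_abs_powr:
  assumes a: "a > 1"
  shows "((\<lambda>u::real. \<bar>u\<bar> powr a) has_real_derivative a * \<bar>u\<bar> powr (a - 1) * sgn u) (at u)"
proof -
  consider "u > 0" | "u < 0" | "u = 0" by linarith
  then show ?thesis
  proof cases
    case 1
    have "((\<lambda>u. u powr a) has_real_derivative a * u powr (a - 1)) (at u)"
      using 1 by (rule has_real_derivative_powr)
    moreover have "\<forall>\<^sub>F v in nhds u. v powr a = \<bar>v\<bar> powr a"
      using eventually_nhds_in_open[of "{0<..}" u] 1 by (auto elim!: eventually_mono)
    ultimately show ?thesis using 1 by (subst (asm) DERIV_cong_ev[OF refl]) auto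
  next
    case 2
    have "((\<lambda>u. (- u) powr a) has_real_derivative (a * (- u) powr (a - 1)) * (- 1)) (at u)"
      using 2 by (intro DERIV_chain2[where g=uminus, OF has_real_derivative_powr]) (auto intro!: derivative_eq_intros)
    moreover have "\<forall>\<^sub>F v in nhds u. (- v) powr a = \<bar>v\<bar> powr a"
      using eventually_nhds_in_open[of "{..<0}" u] 2 by (auto elim!: eventually_mono)
    ultimately show ?thesis using 2 by (subst (asm) DERIV_cong_ev[OF refl]) auto
  next
    case 3
    have "((\<lambda>h::real. \<bar>h\<bar> powr (a - 1)) \<longlongrightarrow> 0) (at 0)"
      by (rule tendsto_zero_powrI[where b="a - 1"]) (use a in \<open>auto intro!: tendsto_rabs_zero tendsto_ident_at\<close>)
    then have "((\<lambda>h::real. \<bar>(\<bar>h\<bar> powr a) / h\<bar>) \<longlongrightarrow> 0) (at 0)"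
    proof (rule Lim_transform_eventually)
      have "\<forall>\<^sub>F h in at (0::real). h \<noteq> 0" by (simp add: eventually_at_filter)
      then show "\<forall>\<^sub>F h in at (0::real). \<bar>h\<bar> powr (a - 1) = \<bar>(\<bar>h\<bar> powr a) / h\<bar>"
        by eventually_elim (simp add: powr_diff)
    qed
    then have "((\<lambda>h::real. (\<bar>h\<bar> powr a) / h) \<longlongrightarrow> 0) (at 0)" by (rule tendsto_rabs_zero_cancel)
    then show ?thesis using 3 by (simp add: DERIV_def)
  qed
qed

definition wt' :: "real \<Rightarrow> 'n::{finite,linorder} \<Rightarrow> (real,'n::{finite,linorder}) vec \<Rightarrow> real" where
  "wt' k i y = (2 * k * \<bar>hN y\<bar> powr (2 * k - 1) * sgn (hN y) * partial_i i hN y - \<bar>hN y\<bar> powr (2 * k) * y $ i) * exp (- (norm y)\<^sup>2 / 2)"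

lemma wt_deriv:
  assumes k: "k \<ge> 1"
  shows "((\<lambda>s. wt k (y + s *\<^sub>R axis i 1)) has_real_derivative wt' k i (y + s *\<^sub>R axis i 1)) (at s)"
proof -
  have n: "(norm (y + s *\<^sub>R axis i 1))\<^sup>2 = (norm y)\<^sup>2 + 2 * s * y $ i + s\<^sup>2" for s
    unfolding power2_norm_eq_inner
    by (simp add: inner_add_left inner_add_right inner_axis inner_axis' power2_eq_square algebra_simps)
  have "((\<lambda>s. - (norm (y + s *\<^sub>R axis i 1))\<^sup>2 / 2) has_real_derivative - (y + s *\<^sub>R axis i 1) $ i) (at s)"
    unfolding n by (auto intro!: derivative_eq_intros simp: axis_def)
  then have e: "((\<lambda>s. exp (- (norm (y + s *\<^sub>R axis i 1))\<^sup>2 / 2)) has_real_derivative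
     exp (- (norm (y + s *\<^sub>R axis i 1))\<^sup>2 / 2) * - (y + s *\<^sub>R axis i 1) $ i) (at s)"
    by (rule DERIV_fun_exp)
  have h: "((\<lambda>s. \<bar>hN (y + s *\<^sub>R axis i 1)\<bar> powr (2 * k)) has_real_derivative
      (2 * k * \<bar>hN (y + s *\<^sub>R axis i 1)\<bar> powr (2 * k - 1) * sgn (hN (y + s *\<^sub>R axis i 1))) * partial_i i hN (y + s *\<^sub>R axis i 1)) (at s)"
    by (rule DERIV_chain2[OF DERIV_abs_powr polyfun_partial_deriv[OF hN_polyfun]]) (use k in auto)
  show ?thesis
    unfolding wt_def wt'_def by (rule DERIV_cong[OF DERIV_mult[OF h e]]) (simp add: algebra_simps)
qed

lemma wt'_distinct:
  assumes y: "distinct_coords y"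
  shows "wt' k i y = (\<Sum>j\<in>UNIV - {i}. 2 * k * (wt k y / (y $ i - y $ j))) - y $ i * wt k y"
proof -
  have "\<bar>hN y\<bar> powr (2 * k - 1) * sgn (hN y) * hN y = \<bar>hN y\<bar> powr (2 * k)"
  proof -
    have "sgn (hN y) * hN y = \<bar>hN y\<bar>" by (simp add: sgn_if)
    then have "\<bar>hN y\<bar> powr (2 * k - 1) * sgn (hN y) * hN y = \<bar>hN y\<bar> powr (2 * k - 1) * \<bar>hN y\<bar> powr 1"
      by (simp add: mult.assoc)
    also have "\<dots> = \<bar>hN y\<bar> powr (2 * k)" by (simp only: powr_add[symmetric]) simp
    finally show ?thesis .
  qed
  then have "2 * k * \<bar>hN y\<bar> powr (2 * k - 1) * sgn (hN y) * partial_i i hN y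
      = 2 * k * \<bar>hN y\<bar> powr (2 * k) * (\<Sum>j\<in>UNIV - {i}. 1 / (y $ i - y $ j))"
    unfolding hN_partial[OF y] by (simp add: algebra_simps)
  then have "wt' k i y = (2 * k * \<bar>hN y\<bar> powr (2 * k) * (\<Sum>j\<in>UNIV - {i}. 1 / (y $ i - y $ j))) * exp (- (norm y)\<^sup>2 / 2) - \<bar>hN y\<bar> powr (2 * k) * y $ i * exp (- (norm y)\<^sup>2 / 2)"
    unfolding wt'_def by (simp only: left_diff_distrib)
  then show ?thesis
    by (simp add: wt_def sum_distrib_left sum_distrib_right mult_ac)
qed

text \<open>The adjoint of T_i for the weight is y_i - T_i. In the derivative of p q w, the weight
  contributes 2 k / (y_i - y_j), and the difference parts of T_i p and T_i q remove all of it except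
  the terms \<open>F j\<close>. The polynomials \<open>p1\<close> and \<open>q1\<close> stand for
  T_i p and T_i q, because the quotients in \<open>dunkl\<close> are meaningful only off the
  diagonals.\<close>

lemma dunkl_ibp:
  fixes p q p1 q1 :: "(real,'n::{finite,linorder}) vec \<Rightarrow> real"
  assumes k: "k \<ge> 1" and pf: "polyfun p" "polyfun q" "polyfun p1" "polyfun q1"
    and dp: "\<And>y. distinct_coords y \<Longrightarrow> dunkl k i p y = p1 y"
    and dq: "\<And>y. distinct_coords y \<Longrightarrow> dunkl k i q y = q1 y"
  shows "(\<integral>y. (y $ i * p y * q y) * wt k y \<partial>lborel)
    = (\<integral>y. (p1 y * q y) * wt k y \<partial>lborel) + (\<integral>y. (p y * q1 y) * wt k y \<partial>lborel)"
proof -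
  let ?D = "\<lambda>y :: (real,'n) vec. 2 * k * \<bar>hN y\<bar> powr (2 * k - 1) * sgn (hN y) * partial_i i hN y"
  let ?H = "\<lambda>y :: (real,'n) vec. \<bar>hN y\<bar> powr (2 * k)"
  let ?a = "\<lambda>y. (p1 y * q y) * wt k y" and ?b = "\<lambda>y. (p y * q1 y) * wt k y" and ?c = "\<lambda>y. (y $ i * p y * q y) * wt k y"
  let ?s = "\<lambda>j y. p (swapvec i j y) * q y + p y * q (swapvec i j y)"
  let ?y = "\<lambda>y s. y + s *\<^sub>R axis i 1 :: (real,'n) vec"
  define r where "r y = p y * q y" for y
  have r: "polyfun r" unfolding r_def by (intro polyfun.intros pf)
  \<comment> \<open>Swapping the coordinates i and j preserves the numerator and the weight but
    reverses the sign of the denominator, so this leftover term integrates to 0.\<close>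
  define F where "F j y = ?s j y * (wt k y / (y $ i - y $ j))" for j y
  have [measurable]: "p \<in> borel_measurable borel" "q \<in> borel_measurable borel" using pf by (auto intro: polyfun_measurable)
  have Fm[measurable]: "F j \<in> borel_measurable borel" for j unfolding F_def by measurable
  have Fint: "integrable lborel (F j)" if ij: "i \<noteq> j" for j
  proof -
    obtain rr where rr: "expbd rr" "\<And>y :: (real,'n) vec. \<bar>hN y\<bar> = \<bar>y $ i - y $ j\<bar> * \<bar>rr y\<bar>" using hN_factor[OF ij] by blast
    define G where "G y = ?s j y * (?H y / (y $ i - y $ j))" for y
    have "\<bar>?H y / (y $ i - y $ j)\<bar> \<le> \<bar>\<bar>hN y\<bar> powr (2 * k - 1) * rr y\<bar>" for y
    proof (cases "y $ i = y $ j")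
      case False
      then have d: "\<bar>y $ i - y $ j\<bar> > 0" by simp
      have "?H y = \<bar>hN y\<bar> powr (2 * k - 1) * \<bar>hN y\<bar> powr 1" by (simp only: powr_add[symmetric]) simp
      then have "?H y = \<bar>hN y\<bar> powr (2 * k - 1) * (\<bar>y $ i - y $ j\<bar> * \<bar>rr y\<bar>)" by (simp add: rr(2))
      then show ?thesis using d by (simp add: abs_mult)
    qed simp
    then have "expbd (\<lambda>y. ?H y / (y $ i - y $ j))"
      by (rule expbd_mono[rotated], intro expbd_mult expbd_powr expbd_polyfun[OF hN_polyfun]) (use k rr(1) in auto)
    then have "expbd G" unfolding G_def
      by (intro expbd_mult expbd_add expbd_polyfun[OF pf(1)] expbd_polyfun[OF pf(2)] expbd_polyfun[OF polyfun_swapvec[OF pf(1)]] expbd_polyfun[OF polyfun_swapvec[OF pf(2)]])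
    moreover have "G \<in> borel_measurable borel" unfolding G_def[abs_def] by measurable
    ultimately have "integrable lborel (\<lambda>y. G y * exp (- (norm y)\<^sup>2 / 2))"
      by (rule integrable_expbd_gauss)
    moreover have "F j y = G y * exp (- (norm y)\<^sup>2 / 2)" for y by (simp add: G_def F_def wt_def)
    ultimately show ?thesis by (metis (no_types, lifting) ext)
  qed
  have F0: "(\<integral>y. F j y \<partial>lborel) = 0" if ij: "i \<noteq> j" for j
  proof -
    have "F j (permvec (sw i j) y) = - F j y" for y
    proof -
      have "swapvec i j y $ i - swapvec i j y $ j = - (y $ i - y $ j)" using ij by (simp add: swapvec_nth sw_def)
      then have d: "permvec (sw i j) y $ i - permvec (sw i j) y $ j = - (y $ i - y $ j)" by (simp add: swapvec_permvec)
      have w: "wt k (permvec (sw i j) y) = wt k y" by (rule wt_permvec[OF bij_sw])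
      have ss: "swapvec i j (permvec (sw i j) y) = y" by (simp add: swapvec_permvec permvec_permvec)
      have sp: "permvec (sw i j) y = swapvec i j y" by (simp add: swapvec_permvec)
      show ?thesis unfolding F_def d w ss unfolding sp by (simp only: minus_divide_right[symmetric]) (simp add: algebra_simps)
    qed
    then have "(\<integral>y. F j y \<partial>lborel) = (\<integral>y. - F j y \<partial>lborel)"
      using integral_permvec[OF bij_sw[of i j] Fm[of j]] by simp
    then show ?thesis by simp
  qed
  define g' where "g' y = partial_i i r y * wt k y + r y * wt' k i y" for y
  define A where "A y = partial_i i r y * ?H y + r y * (?D y - ?H y * y $ i)" for y
  have gA: "g' y = A y * exp (- (norm y)\<^sup>2 / 2)" for y
    by (simp add: g'_def A_def wt_def wt'_def algebra_simps)
  have pm[measurable]: "partial_i i hN \<in> borel_measurable (borel :: ((real,'n) vec) measure)" "partial_i i r \<in> borel_measurable borel" "r \<in> borel_measurable borel"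
    by (auto intro!: polyfun_measurable polyfun_partial hN_polyfun r)
  have "expbd (\<lambda>y :: (real,'n) vec. ?D y)"
    by (intro expbd_mult expbd_const expbd_powr expbd_polyfun hN_polyfun polyfun_partial
         expbd_mono[OF expbd_const[of 1], of "\<lambda>y. sgn (hN y)"]) (use k in \<open>auto simp: sgn_if\<close>)
  moreover have "expbd (\<lambda>y :: (real,'n) vec. (-1) * (?H y * y $ i))"
    by (intro expbd_mult expbd_const expbd_powr expbd_polyfun hN_polyfun polyfun.intros) (use k in auto)
  ultimately have "expbd (\<lambda>y :: (real,'n) vec. ?D y + (-1) * (?H y * y $ i))"
    by (rule expbd_add)
  then have "expbd (\<lambda>y :: (real,'n) vec. ?D y - (?H y * y $ i))"
    by simp
  then have A: "expbd A" unfolding A_def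
    by (intro expbd_mult expbd_add expbd_powr expbd_polyfun[OF hN_polyfun] expbd_polyfun[OF polyfun_partial[OF r]] expbd_polyfun[OF r]) (use k in auto)
  obtain C where C: "C \<ge> 0" "\<And>y. \<bar>A y\<bar> * exp (- (norm y)\<^sup>2 / 2) \<le> C * exp (- (norm y)\<^sup>2 / 4)"
    using expbd_gauss[OF A] by blast
  have "(\<integral>y. g' y \<partial>lborel) = 0"
  \<comment> \<open>For \<open>?y\<close> at distance at most 1 from y, |y|^2 <= 2 |?y|^2 + 2, so
    exp (-|?y|^2 / 4) <= exp (1/4) exp (-|y|^2 / 8).\<close>
  proof (rule integral_partial_zero[where i=i and g="\<lambda>y. r y * wt k y" and D="\<lambda>y. C * exp (1/4) * exp (- ((1/8) * (norm y)\<^sup>2))"])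
    show "((\<lambda>s. r (?y y s) * wt k (?y y s)) has_real_derivative g' (?y y s)) (at s)" for y s
      unfolding g'_def by (rule DERIV_cong[OF DERIV_mult[OF polyfun_partial_deriv[OF r] wt_deriv[OF k]]]) simp
    show "integrable lborel (\<lambda>y. r y * wt k y)" using k r by (intro wt_integrable_poly) auto
    show "integrable lborel (\<lambda>y::(real,'n) vec. C * exp (1/4) * exp (- ((1/8) * (norm y)\<^sup>2)))"
      by (intro integrable_mult_right integrable_gauss) auto
    show "g' \<in> borel_measurable borel" unfolding gA[abs_def] A_def by measurable
    fix y :: "(real,'n) vec" and s :: real assume s: "\<bar>s\<bar> \<le> 1"
    let ?y = "y + s *\<^sub>R axis i 1"
    have "norm y = norm (?y - s *\<^sub>R axis i 1)" by simp
    also have "\<dots> \<le> norm ?y + norm (s *\<^sub>R axis i 1 :: (real,'n) vec)" by (rule norm_triangle_ineq4)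
    also have "norm (s *\<^sub>R axis i 1 :: (real,'n) vec) \<le> 1" using s by simp
    finally have "norm y \<le> norm ?y + 1" by simp
    then have "(norm y)\<^sup>2 \<le> (norm ?y + 1)\<^sup>2" by (intro power_mono) auto
    also have "\<dots> \<le> 2 * (norm ?y)\<^sup>2 + 2"
      using zero_le_power2[of "norm ?y - 1"] by (simp add: power2_eq_square algebra_simps)
    finally have nn: "- (norm ?y)\<^sup>2 / 4 \<le> 1/4 + - ((1/8) * (norm y)\<^sup>2)" by simp
    have "\<bar>g' ?y\<bar> \<le> C * exp (- (norm ?y)\<^sup>2 / 4)" unfolding gA abs_mult using C(2)[of ?y] by simp
    also have "\<dots> \<le> C * exp (1/4 + - ((1/8) * (norm y)\<^sup>2))" using C(1) nn by (intro mult_left_mono) auto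
    finally show "\<bar>g' ?y\<bar> \<le> C * exp (1/4) * exp (- ((1/8) * (norm y)\<^sup>2))" by (simp only: exp_add mult.assoc)
  qed
  moreover have "(\<integral>y. g' y \<partial>lborel) = (\<integral>y. ?a y + ?b y - ?c y + (\<Sum>j\<in>UNIV - {i}. k * F j y) \<partial>lborel)"
  proof (rule integral_cong_AE)
    show "g' \<in> borel_measurable lborel" unfolding gA[abs_def] A_def by measurable
    have [measurable]: "p1 \<in> borel_measurable borel" "q1 \<in> borel_measurable borel" using pf by (auto intro: polyfun_measurable)
    show "(\<lambda>y. ?a y + ?b y - ?c y + (\<Sum>j\<in>UNIV - {i}. k * F j y)) \<in> borel_measurable lborel"
      by measurable
    show "AE y in lborel. g' y = ?a y + ?b y - ?c y + (\<Sum>j\<in>UNIV - {i}. k * F j y)"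
      using AE_distinct
    proof eventually_elim
      fix y :: "(real,'n) vec" assume y: "distinct_coords y"
      define w where "w j = wt k y / (y $ i - y $ j)" for j
      have P: "partial_i i p y * wt k y = p1 y * wt k y - (\<Sum>j\<in>UNIV - {i}. k * (p y - p (swapvec i j y)) * w j)"
        using dp[OF y] by (simp add: dunkl_def w_def algebra_simps diff_divide_distrib sum_distrib_left sum_distrib_right flip: dp[OF y])
      have Q: "partial_i i q y * wt k y = q1 y * wt k y - (\<Sum>j\<in>UNIV - {i}. k * (q y - q (swapvec i j y)) * w j)"
        using dq[OF y] by (simp add: dunkl_def w_def algebra_simps diff_divide_distrib sum_distrib_left sum_distrib_right flip: dq[OF y])
      have "g' y = (partial_i i p y * wt k y) * q y + p y * (partial_i i q y * wt k y) + p y * q y * wt' k i y"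
        by (simp add: g'_def r_def[abs_def] partial_mult pf algebra_simps)
      also have "wt' k i y = (\<Sum>j\<in>UNIV - {i}. 2 * k * w j) - y $ i * wt k y"
        unfolding wt'_distinct[OF y] w_def ..
      also have "(partial_i i p y * wt k y) * q y + p y * (partial_i i q y * wt k y) + p y * q y * ((\<Sum>j\<in>UNIV - {i}. 2 * k * w j) - y $ i * wt k y)
        = ?a y + ?b y - ?c y
          + ((\<Sum>j\<in>UNIV - {i}. p y * q y * (2 * k * w j)) - (\<Sum>j\<in>UNIV - {i}. k * (p y - p (swapvec i j y)) * w j * q y) - (\<Sum>j\<in>UNIV - {i}. p y * (k * (q y - q (swapvec i j y)) * w j)))"
        unfolding P Q by (simp add: algebra_simps sum_distrib_left sum_distrib_right)
      also have "(\<Sum>j\<in>UNIV - {i}. p y * q y * (2 * k * w j)) - (\<Sum>j\<in>UNIV - {i}. k * (p y - p (swapvec i j y)) * w j * q y) - (\<Sum>j\<in>UNIV - {i}. p y * (k * (q y - q (swapvec i j y)) * w j))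
        = (\<Sum>j\<in>UNIV - {i}. k * F j y)"
        unfolding sum_subtractf[symmetric] by (rule sum.cong) (auto simp: F_def w_def[symmetric] algebra_simps)
      finally show "g' y = ?a y + ?b y - ?c y + (\<Sum>j\<in>UNIV - {i}. k * F j y)" .
    qed
  qed
  moreover have "(\<integral>y. ?a y + ?b y - ?c y + (\<Sum>j\<in>UNIV - {i}. k * F j y) \<partial>lborel)
    = (\<integral>y. ?a y \<partial>lborel) + (\<integral>y. ?b y \<partial>lborel) - (\<integral>y. ?c y \<partial>lborel) + (\<Sum>j\<in>UNIV - {i}. k * (\<integral>y. F j y \<partial>lborel))"
  proof -
    have I: "integrable lborel (\<lambda>y. ?a y)" "integrable lborel (\<lambda>y. ?b y)" "integrable lborel (\<lambda>y. ?c y)"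
      using k pf by (intro wt_integrable_poly polyfun.intros; simp)+
    have J: "integrable lborel (\<lambda>y. \<Sum>j\<in>UNIV - {i}. k * F j y)" using Fint by (intro Bochner_Integration.integrable_sum integrable_mult_right) auto
    have "(\<integral>y. (\<Sum>j\<in>UNIV - {i}. k * F j y) \<partial>lborel) = (\<Sum>j\<in>UNIV - {i}. k * (\<integral>y. F j y \<partial>lborel))"
      using Fint by (subst Bochner_Integration.integral_sum) auto
    then show ?thesis using I J by simp
  qed
  ultimately show ?thesis using F0 by simp
qed

subsection \<open>Moments of the Dunkl kernel\<close>

text \<open>Summed formally over n and m, this is the integral of E(x,y) E(x',y) w(y).\<close>

definition dkpair :: "real \<Rightarrow> nat \<Rightarrow> nat \<Rightarrow> (real,'n::{finite,linorder}) vec \<Rightarrow> (real,'n) vec \<Rightarrow> real" where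
  "dkpair k n m x x' = (\<integral>y. (dke k n x y * dke k m x' y) * wt k y \<partial>lborel)"

definition mehta :: "'n::{finite,linorder} itself \<Rightarrow> real \<Rightarrow> real" where
  "mehta _ k = (\<integral>y. wt k (y :: (real,'n) vec) \<partial>lborel)"

lemma mehta_nonneg: "mehta TYPE('n::{finite,linorder}) k \<ge> 0"
  unfolding mehta_def by (intro integral_nonneg_AE) auto

lemma dkpair_commute: "dkpair k n m x x' = dkpair k m n x' x"
  by (simp add: dkpair_def mult.commute)

lemma dkpair_0: "dkpair k 0 0 (x :: (real,'n::{finite,linorder}) vec) x' = mehta TYPE('n) k"
  by (simp add: dkpair_def mehta_def)

lemma dkpair_integrable:
  assumes "k \<ge> 1" shows "integrable lborel (\<lambda>y. (dke k n x y * dke k m x' y) * wt k y)"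
  by (intro wt_integrable_poly polyfun.intros dke_polyfun_right) (use assms in auto)

text \<open>A Dunkl operator lowers the degree by one and kills constants; the value 0 at index 0
  lets one formula cover degree 0.\<close>

definition dkshift :: "(nat \<Rightarrow> real) \<Rightarrow> nat \<Rightarrow> real" where
  "dkshift u n = (case n of 0 \<Rightarrow> 0 | Suc m \<Rightarrow> u m)"

lemma dkshift_simps [simp]: "dkshift u 0 = 0" "dkshift u (Suc n) = u n"
  by (simp_all add: dkshift_def)

lemma dke_dunkl_shift:
  assumes "k \<ge> 0" "distinct_coords y"
  shows "dunkl k i (\<lambda>y. dke k n x y) y = x $ i * dkshift (\<lambda>n. dke k n x y) n"
proof (cases n)
  case 0
  then show ?thesis by simp
next
  case (Suc m)
  then show ?thesis using dke_dunkl[OF assms, of i m x] by simp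
qed

lemma dkshift_polyfun: "k \<ge> 0 \<Longrightarrow> polyfun (\<lambda>y. x $ i * dkshift (\<lambda>n. dke k n x y) n)"
  by (cases n) (auto intro!: polyfun_cmult dke_polyfun_right pf_const)

text \<open>Under the integral the reflection operator produces the sum of x_i y_i. Integrating by
  parts moves each y_i to a Dunkl operator on one of the two kernels, which returns x_i or x'_i and
  lowers a degree.\<close>

lemma dkpair_rec:
  fixes x x' :: "(real,'n::{finite,linorder}) vec"
  assumes k: "k \<ge> 1"
  shows "reflop k (real (Suc n)) (\<lambda>x. dkpair k (Suc n) m x x') x
    = (norm x)\<^sup>2 * dkshift (\<lambda>n. dkpair k n m x x') n + (x \<bullet> x') * dkshift (\<lambda>m. dkpair k n m x x') m"
proof -
  let ?a = "\<lambda>y. dke k (Suc n) x y * dke k m x' y * wt k y" and ?b = "\<lambda>i j y. dke k (Suc n) (swapvec i j x) y * dke k m x' y * wt k y"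
  let ?c = "\<lambda>i y. (y $ i * dke k n x y * dke k m x' y) * wt k y"
  let ?p = "dkshift (\<lambda>n. dkpair k n m x x') n" and ?q = "dkshift (\<lambda>m. dkpair k n m x x') m"
  have k0: "k \<ge> 0" using k by simp
  note I = dkpair_integrable[OF k]
  have D: "integrable lborel (\<lambda>y. ?a y - ?b i j y)" for i j
    by (intro Bochner_Integration.integrable_diff I)
  have "reflop k (real (Suc n)) (\<lambda>x. dkpair k (Suc n) m x x') x
    = real (Suc n) * (\<integral>y. ?a y \<partial>lborel)
      + k / 2 * (\<Sum>i\<in>UNIV. \<Sum>j\<in>UNIV. (\<integral>y. ?a y - ?b i j y \<partial>lborel))"
    unfolding reflop_def dkpair_def by (subst Bochner_Integration.integral_diff[OF I I]) (rule refl)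
  also have "\<dots> = (\<integral>y. real (Suc n) * (?a y)
     + k / 2 * (\<Sum>i\<in>UNIV. \<Sum>j\<in>UNIV. ?a y - ?b i j y) \<partial>lborel)"
  proof -
    have "(\<integral>y. (\<Sum>i\<in>UNIV. \<Sum>j\<in>UNIV. ?a y - ?b i j y) \<partial>lborel)
      = (\<Sum>i\<in>UNIV. \<Sum>j\<in>UNIV. (\<integral>y. ?a y - ?b i j y \<partial>lborel))"
      by (subst Bochner_Integration.integral_sum, intro Bochner_Integration.integrable_sum D,
          subst Bochner_Integration.integral_sum, intro D, rule refl)
    moreover have "integrable lborel (\<lambda>y. \<Sum>i\<in>UNIV. \<Sum>j\<in>UNIV. ?a y - ?b i j y)"
      by (intro Bochner_Integration.integrable_sum D)
    ultimately show ?thesis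
      by (subst Bochner_Integration.integral_add) (auto intro!: integrable_mult_right I simp del: of_nat_Suc)
  qed
  also have "\<dots> = (\<integral>y. (\<Sum>i\<in>UNIV. x $ i * (?c i y)) \<partial>lborel)"
  proof (rule Bochner_Integration.integral_cong[OF refl])
    fix y :: "(real,'n) vec"
    have "real (Suc n) * (?a y)
     + k / 2 * (\<Sum>i\<in>UNIV. \<Sum>j\<in>UNIV. ?a y - ?b i j y)
     = reflop k (real (Suc n)) (\<lambda>x. dke k (Suc n) x y) x * (dke k m x' y * wt k y)"
      unfolding reflop_def by (simp add: distrib_right sum_distrib_right left_diff_distrib mult.assoc del: of_nat_Suc)
    also have "\<dots> = (\<Sum>i\<in>UNIV. x $ i * (?c i y))"
      unfolding dke_rec[OF k0] by (simp add: inner_vec_def sum_distrib_right mult.assoc)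
    finally show "real (Suc n) * (?a y)
     + k / 2 * (\<Sum>i\<in>UNIV. \<Sum>j\<in>UNIV. ?a y - ?b i j y)
     = (\<Sum>i\<in>UNIV. x $ i * (?c i y))" .
  qed
  also have "\<dots> = (\<Sum>i\<in>UNIV. x $ i * (\<integral>y. ?c i y \<partial>lborel))"
    by (subst Bochner_Integration.integral_sum)
       (auto intro!: integrable_mult_right wt_integrable_poly pf_mult pf_coord dke_polyfun_right k0)
  also have "\<dots> = (\<Sum>i\<in>UNIV. x $ i * (x $ i * ?p + x' $ i * ?q))"
  proof (rule sum.cong[OF refl])
    fix i
    have "(\<integral>y. ?c i y \<partial>lborel)
      = (\<integral>y. (x $ i * dkshift (\<lambda>n. dke k n x y) n * dke k m x' y) * wt k y \<partial>lborel)
      + (\<integral>y. (dke k n x y * (x' $ i * dkshift (\<lambda>m. dke k m x' y) m)) * wt k y \<partial>lborel)"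
      by (rule dunkl_ibp[OF k]) (auto intro!: dke_polyfun_right dkshift_polyfun dke_dunkl_shift k0)
    also have "(\<integral>y. (x $ i * dkshift (\<lambda>n. dke k n x y) n * dke k m x' y) * wt k y \<partial>lborel) = x $ i * ?p"
      by (cases n) (simp_all add: dkpair_def mult.assoc)
    also have "(\<integral>y. (dke k n x y * (x' $ i * dkshift (\<lambda>m. dke k m x' y) m)) * wt k y \<partial>lborel) = x' $ i * ?q"
      by (cases m) (simp_all add: dkpair_def mult.assoc mult.left_commute[of _ "x' $ i"])
    finally show "x $ i * (\<integral>y. ?c i y \<partial>lborel)
      = x $ i * (x $ i * ?p + x' $ i * ?q)" by simp
  qed
  also have "\<dots> = (norm x)\<^sup>2 * ?p + (x \<bullet> x') * ?q"
    by (simp add: power2_norm_eq_inner inner_vec_def distrib_left sum.distrib sum_distrib_right mult.assoc)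
  finally show ?thesis .
qed

text \<open>The coefficient of \<open>s\<^sup>n u\<^sup>m\<close> in \<open>exp (r\<^sup>2 (s + u)\<^sup>2 / 2)\<close>.\<close>

definition gcoef :: "real \<Rightarrow> nat \<Rightarrow> nat \<Rightarrow> real" where
  "gcoef r n m = (if even (n + m) then r ^ (n + m) * real ((n + m) choose n) / (2 ^ ((n + m) div 2) * fact ((n + m) div 2)) else 0)"

lemma gcoef_nonneg: "r \<ge> 0 \<Longrightarrow> gcoef r n m \<ge> 0"
  by (simp add: gcoef_def)

lemma gcoef_commute: "gcoef r n m = gcoef r m n"
  using binomial_symmetric[of n "n + m"] by (simp add: gcoef_def add.commute)

text \<open>Coefficient form of dG/ds = r^2 (s + u) G for G = exp (r^2 (s + u)^2 / 2);
  combinatorially, Pascal's rule. It is \<open>dkpair_rec\<close> with the reflection operator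
  replaced by the factor n + 1 and both inner products by r^2.\<close>

lemma gcoef_rec:
  "(r\<^sup>2 * dkshift (\<lambda>n. gcoef r n m) n + r\<^sup>2 * dkshift (\<lambda>m. gcoef r n m) m) / real (Suc n) = gcoef r (Suc n) m"
proof (cases "even (Suc n + m)")
  case False
  then show ?thesis by (cases n; cases m) (auto simp: gcoef_def)
next
  case True
  then obtain l' where "Suc n + m = 2 * l'" by blast
  moreover from this obtain l where "l' = Suc l" by (cases l') auto
  ultimately have l: "Suc n + m = 2 * Suc l" by simp
  define K where "K = r ^ (2 * l) / (2 ^ l * fact l)"
  have a: "dkshift (\<lambda>n. gcoef r n m) n + dkshift (\<lambda>m. gcoef r n m) m = K * real (Suc (2 * l) choose n)"
  proof (cases n)
    case 0
    then obtain m' where m': "m = Suc m'" "m' = 2 * l" using l by (cases m) auto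
    then show ?thesis using 0 by (simp add: gcoef_def K_def)
  next
    case (Suc n')
    have 1: "gcoef r n' m = K * real (2 * l choose n')"
    proof -
      have "n' + m = 2 * l" using l Suc by simp
      then show ?thesis unfolding gcoef_def K_def by simp
    qed
    have 2: "dkshift (\<lambda>m. gcoef r n m) m = K * real (2 * l choose n)"
    proof (cases m)
      case 0
      then have "n = Suc (2 * l)" using l by simp
      then show ?thesis using 0 by simp
    next
      case (Suc m')
      then have "n + m' = 2 * l" using l by simp
      then have "gcoef r n m' = K * real (2 * l choose n)" unfolding gcoef_def K_def by simp
      then show ?thesis using Suc by simp
    qed
    show ?thesis using Suc 1 2 by (simp add: algebra_simps)
  qed
  have "real (Suc n) * real (2 * Suc l choose Suc n) = real (2 * Suc l) * real (Suc (2 * l) choose n)"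
    using Suc_times_binomial[of n "Suc (2 * l)"] by (metis mult_Suc_right of_nat_mult add_2_eq_Suc)
  then have b: "real (2 * Suc l choose Suc n) = real (2 * Suc l) * real (Suc (2 * l) choose n) / real (Suc n)"
    by (simp add: field_simps del: of_nat_Suc binomial_Suc_Suc)
  have "gcoef r (Suc n) m = r ^ (2 * Suc l) * real (2 * Suc l choose Suc n) / (2 ^ Suc l * fact (Suc l))"
    unfolding gcoef_def l by simp
  also have "\<dots> = r\<^sup>2 * (K * real (Suc (2 * l) choose n)) / real (Suc n)"
    unfolding b K_def by (simp add: power2_eq_square divide_simps del: binomial_Suc_Suc)
  finally show ?thesis unfolding a[symmetric] by (simp add: algebra_simps)
qed

text \<open>The maximum principle turns \<open>dkpair_rec\<close> into the recursion of
  \<open>gcoef\<close>, as |x . x'| <= r^2. The recursion needs a positive first degree, so n = 0 is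
  reached by symmetry. Fixing both norms keeps whole orbits within the induction hypothesis.\<close>

lemma dkpair_bound:
  fixes x x' :: "(real,'n::{finite,linorder}) vec"
  assumes k: "k \<ge> 1"
  shows "norm x = r \<Longrightarrow> norm x' = r \<Longrightarrow> \<bar>dkpair k n m x x'\<bar> \<le> gcoef r n m * mehta TYPE('n) k"
proof (induction "n + m" arbitrary: n m x x' rule: less_induct)
  case less
  let ?M = "mehta TYPE('n) k"
  have k0: "k \<ge> 0" using k by simp
  have r: "r \<ge> 0" using less.prems by auto
  have main: "\<bar>dkpair k (Suc a) b x x'\<bar> \<le> gcoef r (Suc a) b * ?M"
    if ab: "Suc a + b = n + m" and nx: "norm x = r" "norm x' = r" for a b and x x' :: "(real,'n) vec"
  proof -
    have "\<bar>dkpair k (Suc a) b x x'\<bar> \<le> ((r\<^sup>2 * dkshift (\<lambda>n. gcoef r n b) a + r\<^sup>2 * dkshift (\<lambda>m. gcoef r a m) b) * ?M) / real (Suc a)"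
    proof (rule reflop_bound[where u="\<lambda>x. dkpair k (Suc a) b x x'" and x=x])
      fix s assume "s \<in> orbit x"
      then have s: "norm s = r" using orbit_norm nx by blast
      have 1: "\<bar>dkshift (\<lambda>n. dkpair k n b s x') a\<bar> \<le> dkshift (\<lambda>n. gcoef r n b) a * ?M"
      proof (cases a)
        case (Suc a')
        then show ?thesis using less.hyps[of a' b s x'] ab s nx by simp
      qed simp
      have 2: "\<bar>dkshift (\<lambda>m. dkpair k a m s x') b\<bar> \<le> dkshift (\<lambda>m. gcoef r a m) b * ?M"
      proof (cases b)
        case (Suc b')
        then show ?thesis using less.hyps[of a b' s x'] ab s nx by simp
      qed simp
      have "\<bar>s \<bullet> x'\<bar> \<le> r\<^sup>2" using Cauchy_Schwarz_ineq2[of s x'] s nx by (simp add: power2_eq_square)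
      then have "\<bar>(s \<bullet> x') * dkshift (\<lambda>m. dkpair k a m s x') b\<bar> \<le> r\<^sup>2 * (dkshift (\<lambda>m. gcoef r a m) b * ?M)"
        unfolding abs_mult by (intro mult_mono 2) auto
      moreover have "\<bar>(norm s)\<^sup>2 * dkshift (\<lambda>n. dkpair k n b s x') a\<bar> \<le> r\<^sup>2 * (dkshift (\<lambda>n. gcoef r n b) a * ?M)"
        unfolding abs_mult s by (intro mult_mono 1) auto
      ultimately show "\<bar>reflop k (real (Suc a)) (\<lambda>x. dkpair k (Suc a) b x x') s\<bar> \<le> (r\<^sup>2 * dkshift (\<lambda>n. gcoef r n b) a + r\<^sup>2 * dkshift (\<lambda>m. gcoef r a m) b) * ?M"
        unfolding dkpair_rec[OF k] by (simp add: distrib_right mult.assoc)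
    qed (use k0 in auto)
    also have "\<dots> = ((r\<^sup>2 * dkshift (\<lambda>n. gcoef r n b) a + r\<^sup>2 * dkshift (\<lambda>m. gcoef r a m) b) / real (Suc a)) * ?M"
      by simp
    also have "\<dots> = gcoef r (Suc a) b * ?M" unfolding gcoef_rec ..
    finally show ?thesis .
  qed
  show ?case
  proof (cases n)
    case (Suc a)
    then show ?thesis using main[of a m x x'] less.prems by simp
  next
    case n: 0
    show ?thesis
    proof (cases m)
      case 0
      then show ?thesis using n mehta_nonneg[where 'n='n] by (simp add: dkpair_0 gcoef_def)
    next
      case (Suc a)
      then have "\<bar>dkpair k m n x' x\<bar> \<le> gcoef r m n * ?M" using main[of a n x' x] less.prems by simp
      then show ?thesis by (simp add: dkpair_commute[of k n m] gcoef_commute[of r n m])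
    qed
  qed
qed

text \<open>The generating function at s = u = 1 is exp (2 r^2). The square of indices is enlarged
  to the triangle n + m < 2 K, where each antidiagonal sums binomial coefficients to a power of
  2.\<close>

lemma sum_gcoef_bound:
  assumes r: "r \<ge> 0"
  shows "(\<Sum>n<K. \<Sum>m<K. gcoef r n m) \<le> exp (2 * r\<^sup>2)"
proof -
  have S: "(\<Sum>n\<le>s. gcoef r n (s - n)) = (if even s then r ^ s * 2 ^ s / (2 ^ (s div 2) * fact (s div 2)) else 0)" for s
  proof -
    have "(\<Sum>n\<le>s. gcoef r n (s - n)) = (\<Sum>n\<le>s. if even s then r ^ s * real (s choose n) / (2 ^ (s div 2) * fact (s div 2)) else 0)"
      by (rule sum.cong) (auto simp: gcoef_def)
    also have "\<dots> = (if even s then r ^ s * (\<Sum>n\<le>s. real (s choose n)) / (2 ^ (s div 2) * fact (s div 2)) else 0)"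
      by (simp add: sum_divide_distrib sum_distrib_left)
    also have "(\<Sum>n\<le>s. real (s choose n)) = 2 ^ s" using choose_row_sum[of s] by (metis of_nat_sum of_nat_power of_nat_numeral)
    finally show ?thesis .
  qed
  have "(\<Sum>n<K. \<Sum>m<K. gcoef r n m) = (\<Sum>(n,m)\<in>{..<K}\<times>{..<K}. gcoef r n m)"
    by (rule sum.cartesian_product)
  also have "\<dots> = (\<Sum>(s,n)\<in>(\<lambda>(n,m). (n + m, n)) ` ({..<K}\<times>{..<K}). gcoef r n (s - n))"
    by (subst sum.reindex) (auto simp: inj_on_def intro!: sum.cong)
  also have "\<dots> \<le> (\<Sum>(s,n)\<in>Sigma {..<2 * K} (\<lambda>s. {..s}). gcoef r n (s - n))"
    by (rule sum_mono2) (auto intro: gcoef_nonneg r)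
  also have "\<dots> = (\<Sum>s<2 * K. \<Sum>n\<le>s. gcoef r n (s - n))"
    by (rule sum.Sigma[symmetric]) auto
  also have "\<dots> = (\<Sum>s<2 * K. if even s then r ^ s * 2 ^ s / (2 ^ (s div 2) * fact (s div 2)) else 0)"
    unfolding S ..
  also have "\<dots> = (\<Sum>l<K. (2 * r\<^sup>2) ^ l / fact l)"
  proof (induction K)
    case (Suc K)
    have "(4::real) ^ K = 2 ^ K * 2 ^ K" by (simp add: power_mult_distrib[symmetric])
    then have "r ^ (2 * K) * 2 ^ (2 * K) / (2 ^ K * fact K) = (2 * r\<^sup>2) ^ K / fact K"
      by (simp add: power_mult power_mult_distrib power2_eq_square)
    with Suc show ?case by simp
  qed simp
  also have "\<dots> \<le> (\<Sum>l. (2 * r\<^sup>2) ^ l / fact l)"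
    by (rule sum_le_suminf[OF sums_summable[OF exp_sums_real]]) auto
  also have "\<dots> = exp (2 * r\<^sup>2)" using exp_sums_real sums_unique by metis
  finally show ?thesis .
qed

lemma wt_integrable_bounded_exp:
  fixes f :: "(real,'n::{finite,linorder}) vec \<Rightarrow> real"
  assumes "k \<ge> 0" "a \<ge> 0" "f \<in> borel_measurable borel" "\<And>y. \<bar>f y\<bar> \<le> exp (a * norm y)"
  shows "integrable lborel (\<lambda>y. f y * wt k y)"
  by (rule wt_integrable) (use assms expbd_mono[OF expbd_exp[of a], of f] in auto)

text \<open>The pointwise bound justifies the passage to the limit of the series at fixed
  \<open>k\<close>; the constant comes from \<open>dkpair_bound\<close> and does not involve
  \<open>k\<close>.\<close>

lemma dunkl_kernel_L2:
  fixes x :: "(real,'n::{finite,linorder}) vec"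
  assumes k: "k \<ge> 1"
  shows "integrable lborel (\<lambda>y. (dunkl_kernel k x y)\<^sup>2 * wt k y)"
    and "(\<integral>y. (dunkl_kernel k x y)\<^sup>2 * wt k y \<partial>lborel) \<le> exp (2 * (norm x)\<^sup>2) * mehta TYPE('n) k"
proof -
  have k0: "k \<ge> 0" using k by simp
  note [measurable] = dunkl_kernel_measurable[OF k0]
  define S where "S K y = (\<Sum>n<K. dke k n x y)" for K y
  have Sp: "polyfun (S K)" for K unfolding S_def by (intro polyfun_sum dke_polyfun_right k0) auto
  have [measurable]: "S K \<in> borel_measurable borel" for K using Sp by (rule polyfun_measurable)
  have sqb: "u\<^sup>2 \<le> exp (2 * norm x * norm y)" if "\<bar>u\<bar> \<le> exp (norm x * norm y)" for u and y :: "(real,'n) vec"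
  proof -
    have "u\<^sup>2 \<le> (exp (norm x * norm y))\<^sup>2" using power_mono[OF that, of 2] by simp
    then show ?thesis by (simp add: exp_double[symmetric] mult.assoc)
  qed
  show int: "integrable lborel (\<lambda>y. (dunkl_kernel k x y)\<^sup>2 * wt k y)"
    by (rule wt_integrable_bounded_exp[OF k0, of "2 * norm x"]) (use sqb[OF dunkl_kernel_bound[OF k0]] in auto)
  have w: "integrable lborel (\<lambda>y. exp (2 * norm x * norm y) * wt k y)"
    by (rule wt_integrable_bounded_exp[OF k0, of "2 * norm x"]) auto
  have lim: "(\<lambda>K. \<integral>y. (S K y)\<^sup>2 * wt k y \<partial>lborel) \<longlonglongrightarrow> (\<integral>y. (dunkl_kernel k x y)\<^sup>2 * wt k y \<partial>lborel)"
  proof (rule integral_dominated_convergence[OF _ _ w])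
    show "AE y in lborel. (\<lambda>K. (S K y)\<^sup>2 * wt k y) \<longlonglongrightarrow> (dunkl_kernel k x y)\<^sup>2 * wt k y"
      unfolding S_def using dke_sums[OF k0, of x] by (intro AE_I2 tendsto_intros) (auto simp: sums_def)
    show "AE y in lborel. norm ((S K y)\<^sup>2 * wt k y) \<le> exp (2 * norm x * norm y) * wt k y" for K
      using sqb[OF dke_partial_bound[OF k0]] unfolding S_def
      by (intro AE_I2) (auto simp: abs_mult intro!: mult_right_mono)
  qed auto
  show "(\<integral>y. (dunkl_kernel k x y)\<^sup>2 * wt k y \<partial>lborel) \<le> exp (2 * (norm x)\<^sup>2) * mehta TYPE('n) k"
  proof (rule LIMSEQ_le_const2[OF lim], intro exI[of _ 0] allI impI)
    fix K
    have "(S K y)\<^sup>2 * wt k y = (\<Sum>n<K. \<Sum>m<K. (dke k n x y * dke k m x y) * wt k y)" for y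
      unfolding S_def power2_eq_square sum_product by (simp add: sum_distrib_right)
    then have "(\<integral>y. (S K y)\<^sup>2 * wt k y \<partial>lborel) = (\<integral>y. (\<Sum>n<K. \<Sum>m<K. (dke k n x y * dke k m x y) * wt k y) \<partial>lborel)"
      by simp
    also have "\<dots> = (\<Sum>n<K. \<Sum>m<K. dkpair k n m x x)"
      unfolding dkpair_def
      by (subst Bochner_Integration.integral_sum, intro Bochner_Integration.integrable_sum dkpair_integrable k,
          subst Bochner_Integration.integral_sum, intro dkpair_integrable k, rule refl)
    also have "\<dots> \<le> (\<Sum>n<K. \<Sum>m<K. gcoef (norm x) n m * mehta TYPE('n) k)"
      by (intro sum_mono order_trans[OF abs_ge_self dkpair_bound[OF k]]) auto
    also have "\<dots> = (\<Sum>n<K. \<Sum>m<K. gcoef (norm x) n m) * mehta TYPE('n) k"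
      by (simp add: sum_distrib_right)
    also have "\<dots> \<le> exp (2 * (norm x)\<^sup>2) * mehta TYPE('n) k"
      by (intro mult_right_mono sum_gcoef_bound mehta_nonneg) auto
    finally show "(\<integral>y. (S K y)\<^sup>2 * wt k y \<partial>lborel) \<le> exp (2 * (norm x)\<^sup>2) * mehta TYPE('n) k" .
  qed
qed

text \<open>For m = 0 the second term of \<open>dkpair_rec\<close> drops out. The proposed solution
  depends only on |x|, so all its reflection differences vanish and the reflection operator just
  multiplies it by the degree.\<close>

lemma dkpair_right_0:
  fixes x x' :: "(real,'n::{finite,linorder}) vec"
  assumes k: "k \<ge> 1"
  shows "dkpair k n 0 x x' = (if even n then ((norm x)\<^sup>2 / 2) ^ (n div 2) / fact (n div 2) * mehta TYPE('n) k else 0)"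
proof (induction n arbitrary: x rule: less_induct)
  case (less n)
  have k0: "k \<ge> 0" using k by simp
  show ?case
  proof (cases n)
    case 0
    then show ?thesis by (simp add: dkpair_0)
  next
    case (Suc a)
    define c where "c x = (if even (Suc a) then ((norm x)\<^sup>2 / 2) ^ (Suc a div 2) / fact (Suc a div 2) * mehta TYPE('n) k else 0)" for x :: "(real,'n) vec"
    have "dkpair k (Suc a) 0 x x' = c x"
    proof (rule reflop_inj[of "real (Suc a)" k x "\<lambda>x. dkpair k (Suc a) 0 x x'" c])
      fix s :: "(real,'n) vec"
      have "norm (swapvec i j s) = norm s" for i j by (simp add: swapvec_permvec norm_permvec bij_sw)
      then have "reflop k (real (Suc a)) c s = real (Suc a) * c s" by (simp add: reflop_def c_def)
      moreover have "(norm s)\<^sup>2 * dkshift (\<lambda>n. dkpair k n 0 s x') a = real (Suc a) * c s"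
      proof (cases a)
        case 0
        then show ?thesis by (simp add: c_def)
      next
        case (Suc b)
        have "dkpair k b 0 s x' = (if even b then ((norm s)\<^sup>2 / 2) ^ (b div 2) / fact (b div 2) * mehta TYPE('n) k else 0)"
          by (rule less.IH) (simp add: \<open>n = Suc a\<close> Suc)
        show ?thesis
        proof (cases "even b")
          case True
          then obtain l where l: "b = 2 * l" by blast
          have "real (2 * Suc l) * (((norm s)\<^sup>2 / 2) ^ Suc l / fact (Suc l)) = (norm s)\<^sup>2 * (((norm s)\<^sup>2 / 2) ^ l / fact l)"
            by (simp add: divide_simps del: of_nat_Suc) (simp add: algebra_simps)
          then have E: "real (2 * Suc l) * (((norm s)\<^sup>2 / 2) ^ Suc l / fact (Suc l) * mehta TYPE('n) k)
            = (norm s)\<^sup>2 * (((norm s)\<^sup>2 / 2) ^ l / fact l * mehta TYPE('n) k)"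
            by (metis mult.assoc)
          have "Suc a = 2 * Suc l" using Suc l by simp
          then have "real (Suc a) * c s = real (2 * Suc l) * (((norm s)\<^sup>2 / 2) ^ Suc l / fact (Suc l) * mehta TYPE('n) k)"
            by (simp only: c_def) simp
          then show ?thesis unfolding E using Suc l \<open>dkpair k b 0 s x' = _\<close> by simp
        next
          case False
          then show ?thesis using Suc \<open>dkpair k b 0 s x' = _\<close> by (simp add: c_def)
        qed
      qed
      ultimately show "reflop k (real (Suc a)) (\<lambda>x. dkpair k (Suc a) 0 x x') s = reflop k (real (Suc a)) c s"
        unfolding dkpair_rec[OF k] by simp
    qed (use k0 in auto)
    then show ?thesis unfolding Suc c_def .
  qed
qed

lemma dunkl_kernel_mass:
  fixes x :: "(real,'n::{finite,linorder}) vec"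
  assumes k: "k \<ge> 1"
  shows "integrable lborel (\<lambda>y. dunkl_kernel k x y * wt k y)"
    and "(\<integral>y. dunkl_kernel k x y * wt k y \<partial>lborel) = exp ((norm x)\<^sup>2 / 2) * mehta TYPE('n) k"
proof -
  have k0: "k \<ge> 0" using k by simp
  note [measurable] = dunkl_kernel_measurable[OF k0]
  define S where "S K y = (\<Sum>n<K. dke k n x y)" for K y
  have Sp: "polyfun (S K)" for K unfolding S_def by (intro polyfun_sum dke_polyfun_right k0) auto
  have [measurable]: "S K \<in> borel_measurable borel" for K using Sp by (rule polyfun_measurable)
  show int: "integrable lborel (\<lambda>y. dunkl_kernel k x y * wt k y)"
    by (rule wt_integrable_bounded_exp[OF k0, of "norm x"]) (use dunkl_kernel_bound[OF k0] in auto)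
  have w: "integrable lborel (\<lambda>y. exp (norm x * norm y) * wt k y)"
    by (rule wt_integrable_bounded_exp[OF k0, of "norm x"]) auto
  have lim: "(\<lambda>K. \<integral>y. S K y * wt k y \<partial>lborel) \<longlonglongrightarrow> (\<integral>y. dunkl_kernel k x y * wt k y \<partial>lborel)"
  proof (rule integral_dominated_convergence[OF _ _ w])
    show "AE y in lborel. (\<lambda>K. S K y * wt k y) \<longlonglongrightarrow> dunkl_kernel k x y * wt k y"
      unfolding S_def using dke_sums[OF k0, of x] by (intro AE_I2 tendsto_intros) (auto simp: sums_def)
    show "AE y in lborel. norm (S K y * wt k y) \<le> exp (norm x * norm y) * wt k y" for K
      using dke_partial_bound[OF k0] unfolding S_def
      by (intro AE_I2) (auto simp: abs_mult intro!: mult_right_mono)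
  qed auto
  have "S K y * wt k y = (\<Sum>n<K. (dke k n x y * dke k 0 x y) * wt k y)" for K y
    unfolding S_def by (simp add: sum_distrib_right)
  then have SI: "(\<integral>y. S K y * wt k y \<partial>lborel) = (\<Sum>n<K. dkpair k n 0 x x)" for K
    unfolding dkpair_def
    by (subst Bochner_Integration.integral_sum[symmetric], intro dkpair_integrable k) simp
  \<comment> \<open>Odd degrees contribute 0, so the series is followed along even cut-offs.\<close>
  have "(\<Sum>n<2 * K. dkpair k n 0 x x) = (\<Sum>l<K. ((norm x)\<^sup>2 / 2) ^ l / fact l) * mehta TYPE('n) k" for K
    unfolding dkpair_right_0[OF k] by (induction K) (auto simp: distrib_right)
  then have "(\<lambda>K. (\<Sum>l<K. ((norm x)\<^sup>2 / 2) ^ l / fact l) * mehta TYPE('n) k) \<longlonglongrightarrow> (\<integral>y. dunkl_kernel k x y * wt k y \<partial>lborel)"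
    using LIMSEQ_subseq_LIMSEQ[OF lim[unfolded SI], of "\<lambda>K. 2 * K"] by (simp add: strict_mono_def o_def)
  moreover have "(\<lambda>K. (\<Sum>l<K. ((norm x)\<^sup>2 / 2) ^ l / fact l) * mehta TYPE('n) k) \<longlonglongrightarrow> exp ((norm x)\<^sup>2 / 2) * mehta TYPE('n) k"
    using exp_sums_real[of "(norm x)\<^sup>2 / 2"] unfolding sums_def by (intro tendsto_mult_right)
  ultimately show "(\<integral>y. dunkl_kernel k x y * wt k y \<partial>lborel) = exp ((norm x)\<^sup>2 / 2) * mehta TYPE('n) k"
    by (rule LIMSEQ_unique)
qed

subsection \<open>Hermite polynomials\<close>

text \<open>The monic multiple 2^(-n) H_n. The coefficient field is left open because the resultant
  argument splits these polynomials over the complex numbers.\<close>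

primrec he :: "nat \<Rightarrow> 'a::field_char_0 poly" where
  "he 0 = 1"
| "he (Suc n) = [:0, 1:] * he n - smult (1 / 2) (pderiv (he n))"

lemma pderiv_he: "pderiv (he (Suc n)) = smult (of_nat (Suc n)) (he n :: 'a::field_char_0 poly)"
proof (induction n)
  case 0
  then show ?case by (simp add: pderiv_pCons)
next
  case (Suc n)
  have "pderiv (he (Suc (Suc n))) = he (Suc n) + [:0, 1:] * pderiv (he (Suc n)) - smult (1 / 2) (pderiv (pderiv (he (Suc n)))) "
    by (subst he.simps(2)) (simp add: pderiv_diff pderiv_mult pderiv_smult pderiv_pCons del: he.simps)
  also have "\<dots> = he (Suc n) + smult (of_nat (Suc n)) ([:0, 1:] * he n - smult (1 / 2) (pderiv (he n :: 'a poly)))"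
    unfolding Suc by (simp add: pderiv_smult smult_diff_right mult.commute del: he.simps of_nat_Suc)
  also have "\<dots> = smult (of_nat (Suc (Suc n))) (he (Suc n))"
  proof -
    have "of_nat (Suc (Suc n)) = 1 + (of_nat (Suc n) :: 'a)" by simp
    then show ?thesis unfolding he.simps(2)[symmetric] by (simp only: smult_add_left smult_1_left)
  qed
  finally show ?case .
qed

lemma he_rec: "he (Suc (Suc n)) = [:0, 1:] * he (Suc n) - smult (of_nat (Suc n) / 2) (he n :: 'a::field_char_0 poly)"
  by (subst he.simps(2), subst pderiv_he) simp

lemma he_ode: "poly (pderiv (pderiv (he n))) (x::'a::field_char_0) = 2 * x * poly (pderiv (he n)) x - 2 * of_nat n * poly (he n) x"
proof -
  have "pderiv (he (Suc n)) = he n + [:0, 1:] * pderiv (he n) - smult (1 / 2) (pderiv (pderiv (he n :: 'a poly)))"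
    by (subst he.simps(2)) (simp add: pderiv_diff pderiv_mult pderiv_smult pderiv_pCons)
  then have "poly (smult (of_nat (Suc n)) (he n)) x = poly (he n + [:0, 1:] * pderiv (he n) - smult (1 / 2) (pderiv (pderiv (he n)))) x"
    unfolding pderiv_he by (rule arg_cong)
  then show ?thesis by (simp add: field_simps)
qed

lemma he_monic: "degree (he n :: 'a::field_char_0 poly) \<le> n \<and> coeff (he n :: 'a poly) n = 1"
proof (induction n rule: less_induct)
  case (less n)
  show ?case
  proof (cases n)
    case (Suc m)
    have m: "degree (he m :: 'a poly) \<le> m" "coeff (he m :: 'a poly) m = 1" using less[of m] Suc by auto
    have "degree ([:0, 1:] * he m :: 'a poly) \<le> Suc m" using m(1) by (intro order_trans[OF degree_mult_le]) simp
    moreover have d: "degree (smult (1 / 2) (pderiv (he m)) :: 'a poly) \<le> m" using m(1) by (simp add: degree_pderiv)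
    ultimately have 1: "degree (he (Suc m) :: 'a poly) \<le> Suc m" by (auto intro!: degree_diff_le)
    have "coeff (smult (1 / 2) (pderiv (he m)) :: 'a poly) (Suc m) = 0" by (rule coeff_eq_0) (use d in linarith)
    then have "coeff (he (Suc m) :: 'a poly) (Suc m) = 1" using m(2) by simp
    with 1 Suc show ?thesis by blast
  qed simp
qed

lemma degree_he: "degree (he n :: 'a::field_char_0 poly) = n"
  using he_monic[of n, where 'a='a] le_degree[of "he n :: 'a poly" n] by auto

lemma hermite_he: "hermite n x = 2 ^ n * poly (he n) x"
proof -
  have "(deriv ^^ n) (\<lambda>u::real. exp (- (u\<^sup>2))) = (\<lambda>u. (-1) ^ n * 2 ^ n * poly (he n) u * exp (- (u\<^sup>2)))"
  proof (induction n)
    case (Suc n)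
    have "deriv (\<lambda>u::real. (-1) ^ n * 2 ^ n * poly (he n) u * exp (- (u\<^sup>2))) x
       = (-1) ^ Suc n * 2 ^ Suc n * poly (he (Suc n)) x * exp (- (x\<^sup>2))" for x
    proof (rule DERIV_imp_deriv)
      have "((\<lambda>u::real. (-1) ^ n * 2 ^ n * poly (he n) u * exp (- (u\<^sup>2))) has_real_derivative
        (-1) ^ n * 2 ^ n * (poly (pderiv (he n)) x * exp (- (x\<^sup>2)) + poly (he n) x * (exp (- (x\<^sup>2)) * (- (2 * x))))) (at x)"
        by (auto intro!: derivative_eq_intros simp: algebra_simps)
      then show "((\<lambda>u::real. (-1) ^ n * 2 ^ n * poly (he n) u * exp (- (u\<^sup>2))) has_real_derivative
        (-1) ^ Suc n * 2 ^ Suc n * poly (he (Suc n)) x * exp (- (x\<^sup>2))) (at x)"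
        by (rule DERIV_cong) (simp add: algebra_simps)
    qed
    then show ?case using Suc by auto
  qed simp
  then show ?thesis by (simp add: hermite_def exp_minus field_simps power_mult_distrib[symmetric])
qed

lemma he_complex: "poly (he n) (complex_of_real x) = complex_of_real (poly (he n) x)"
proof (induction n rule: less_induct)
  case (less n)
  consider "n = 0" | "n = 1" | m where "n = Suc (Suc m)" by (metis One_nat_def not0_implies_Suc)
  then show ?case
  proof cases
    case 3
    then show ?thesis using less[of m] less[of "Suc m"] by (simp add: he_rec del: he.simps)
  qed simp_all
qed

lemma norm_prod_mset: "norm (\<Prod>x\<in>#A. f x) = (\<Prod>x\<in>#A. norm (f x :: 'a::real_normed_field))"
  by (induction A) (auto simp: norm_mult)

text \<open>The product is, up to sign, the resultant of neighbouring polynomials. Exchanging the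
  two root multisets expresses it through values of the higher polynomial at the roots of the lower
  one, where the three-term recursion descends a degree. Complex multisets are used because only the
  zeros in top degree are given as real and simple.\<close>

lemma he_resultant:
  "(he (Suc n) :: complex poly) = (\<Prod>a\<in>#A. [:- a, 1:]) \<Longrightarrow> (\<Prod>a\<in>#A. norm (poly (he n) a)) = (\<Prod>m=1..n. (real m / 2) ^ m)"
proof (induction n arbitrary: A)
  case 0
  then show ?case by simp
next
  case (Suc n)
  obtain root where root: "smult (lead_coeff (he (Suc n) :: complex poly)) (\<Prod>i<degree (he (Suc n) :: complex poly). [:- root i, 1:]) = he (Suc n)"
    using complex_poly_decompose' by blast
  define B where "B = image_mset root (mset_set {..<degree (he (Suc n) :: complex poly)})"
  have B: "size B = degree (he (Suc n) :: complex poly)" "smult (lead_coeff (he (Suc n) :: complex poly)) (\<Prod>x\<in>#B. [:-x, 1:]) = he (Suc n)"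
    unfolding B_def using root by (simp_all add: prod_unfold_prod_mset image_mset.compositionality o_def del: he.simps)
  have lc: "lead_coeff (he (Suc n) :: complex poly) = 1" using he_monic[of "Suc n", where 'a=complex] degree_he[of "Suc n", where 'a=complex] by metis
  have B': "he (Suc n) = (\<Prod>x\<in>#B. [:-x, 1:])" using B(2) unfolding lc by simp
  have sB: "size B = Suc n" using B(1) degree_he[of "Suc n", where 'a=complex] by simp
  have "(\<Prod>a\<in>#A. norm (poly (he (Suc n)) a)) = (\<Prod>a\<in>#A. \<Prod>b\<in>#B. norm (a - b))"
    unfolding B' by (simp add: poly_prod_mset o_def norm_minus_commute norm_prod_mset)
  also have "\<dots> = (\<Prod>b\<in>#B. \<Prod>a\<in>#A. norm (a - b))" by (rule prod_mset.swap)
  also have "\<dots> = (\<Prod>b\<in>#B. norm (poly (he (Suc (Suc n))) b))"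
    unfolding Suc.prems by (simp add: poly_prod_mset o_def norm_minus_commute norm_prod_mset)
  also have "\<dots> = (\<Prod>b\<in>#B. (real (Suc n) / 2) * norm (poly (he n) b))"
  proof (intro arg_cong[where f=prod_mset] image_mset_cong)
    fix b assume "b \<in># B"
    then have "poly (he (Suc n)) b = 0" unfolding B' by (auto simp: poly_prod_mset prod_mset_zero_iff)
    then have "poly (he (Suc (Suc n))) b = - (of_nat (Suc n) / 2) * poly (he n) b" unfolding he_rec by simp
    then show "norm (poly (he (Suc (Suc n))) b) = (real (Suc n) / 2) * norm (poly (he n) b)"
      by (simp add: norm_mult norm_divide del: of_nat_Suc he.simps)
  qed
  also have "\<dots> = (real (Suc n) / 2) ^ Suc n * (\<Prod>b\<in>#B. norm (poly (he n) b))"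
    unfolding prod_mset.distrib by (simp add: sB)
  also have "(\<Prod>b\<in>#B. norm (poly (he n) b)) = (\<Prod>m=1..n. (real m / 2) ^ m)" using Suc.IH[OF B'] .
  finally show ?case by simp
qed

text \<open>Write he_N = (X - z_i) r_i; at z_i its first derivative is r_i and its second 2 r_i'.
  The Hermite equation then gives r_i' / r_i = z_i, the Stieltjes relation. The discriminant is the
  product of the |he_N'(z_i)|, and he_N' = N he_(N-1) reduces it to the resultant.\<close>

lemma
  fixes z :: "'i::finite \<Rightarrow> real"
  assumes inj: "inj z" and root: "\<And>i. poly (he CARD('i)) (z i) = 0"
  shows he_stieltjes: "(\<Sum>j\<in>UNIV - {i}. 1 / (z i - z j)) = z i"
    and he_discriminant: "(\<Prod>i\<in>UNIV. \<Prod>j\<in>UNIV - {i}. \<bar>z i - z j\<bar>) = real CARD('i) ^ CARD('i) * (\<Prod>m=1..<CARD('i). (real m / 2) ^ m)"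
proof -
  let ?N = "CARD('i)"
  have fac: "he ?N = (\<Prod>i\<in>UNIV. [:- z i, 1:])"
  proof (rule poly_eqI_degree_lead_coeff[where A="range z" and n="?N"])
    have dp: "degree (\<Prod>i\<in>UNIV. [:- z i, 1:]) = ?N" by (subst degree_prod_sum_eq) auto
    then show "degree (\<Prod>i\<in>UNIV. [:- z i, 1:]) \<le> ?N" by simp
    have "lead_coeff (\<Prod>i\<in>UNIV. [:- z i, 1:]) = 1" by (simp add: lead_coeff_prod)
    then show "coeff (he ?N) ?N = coeff (\<Prod>i\<in>UNIV. [:- z i, 1:]) ?N" using he_monic[of ?N, where 'a=real] dp by simp
    show "degree (he ?N :: real poly) \<le> ?N" by (simp add: degree_he)
    show "?N \<le> card (range z)" using inj by (simp add: card_image)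
    fix x assume "x \<in> range z"
    then show "poly (he ?N) x = poly (\<Prod>i\<in>UNIV. [:- z i, 1:]) x" using root by (auto simp: poly_prod)
  qed
  define r where "r i = (\<Prod>j\<in>UNIV - {i}. [:- z j, 1:])" for i
  have fr: "he ?N = [:- z i, 1:] * r i" for i unfolding fac r_def by (rule prod.remove) auto
  have ri: "poly (r i) (z i) = (\<Prod>j\<in>UNIV - {i}. z i - z j)" for i by (simp add: r_def poly_prod)
  have nz: "z i - z j \<noteq> 0" if "j \<in> UNIV - {i}" for i j using that inj by (auto simp: inj_def)
  have ri0: "poly (r i) (z i) \<noteq> 0" for i unfolding ri using nz by auto
  have dr: "poly (pderiv (r i)) (z i) = poly (r i) (z i) * (\<Sum>j\<in>UNIV - {i}. 1 / (z i - z j))" for i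
  proof -
    have "((\<lambda>x. \<Prod>j\<in>UNIV - {i}. x - z j) has_real_derivative (\<Prod>j\<in>UNIV - {i}. z i - z j) * (\<Sum>j\<in>UNIV - {i}. 1 / (z i - z j))) (at (z i))"
      by (rule has_field_derivative_prod') (use nz in \<open>auto intro!: derivative_eq_intros\<close>)
    moreover have "poly (r i) = (\<lambda>x. \<Prod>j\<in>UNIV - {i}. x - z j)" by (auto simp: r_def poly_prod)
    ultimately show ?thesis using poly_DERIV[of "r i" "z i"] DERIV_unique ri by metis
  qed
  have d1: "poly (pderiv (he ?N)) (z i) = poly (r i) (z i)" for i
    unfolding fr[of i] pderiv_mult by (simp add: pderiv_pCons)
  have d2: "poly (pderiv (pderiv (he ?N))) (z i) = 2 * poly (pderiv (r i)) (z i)" for i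
    unfolding fr[of i] pderiv_mult pderiv_add by (simp add: pderiv_pCons)
  have "2 * (poly (r i) (z i) * (\<Sum>j\<in>UNIV - {i}. 1 / (z i - z j))) = 2 * z i * poly (r i) (z i)"
    using he_ode[of ?N "z i"] by (simp add: d1 d2 dr root)
  then show "(\<Sum>j\<in>UNIV - {i}. 1 / (z i - z j)) = z i" using ri0[of i] by simp
  obtain n where n: "?N = Suc n" using not0_implies_Suc[of ?N] by auto
  have facC: "(he (Suc n) :: complex poly) = (\<Prod>a\<in>#image_mset (\<lambda>i. complex_of_real (z i)) (mset_set UNIV). [:- a, 1:])"
  proof (rule poly_eqI_degree_lead_coeff[where A="range (\<lambda>i. complex_of_real (z i))" and n="Suc n"])
    let ?p = "\<Prod>i\<in>UNIV. [:- complex_of_real (z i), 1:]"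
    have e: "(\<Prod>a\<in>#image_mset (\<lambda>i. complex_of_real (z i)) (mset_set UNIV). [:- a, 1:]) = ?p"
      by (simp add: prod_unfold_prod_mset image_mset.compositionality o_def)
    have dp: "degree ?p = Suc n" by (subst degree_prod_sum_eq) (auto simp: n)
    then show "degree (\<Prod>a\<in>#image_mset (\<lambda>i. complex_of_real (z i)) (mset_set UNIV). [:- a, 1:]) \<le> Suc n" unfolding e by simp
    have "lead_coeff ?p = 1" by (simp add: lead_coeff_prod)
    then show "coeff (he (Suc n)) (Suc n) = coeff (\<Prod>a\<in>#image_mset (\<lambda>i. complex_of_real (z i)) (mset_set UNIV). [:- a, 1:]) (Suc n)"
      unfolding e using he_monic[of "Suc n", where 'a=complex] dp by simp
    show "degree (he (Suc n) :: complex poly) \<le> Suc n" by (simp add: degree_he del: he.simps)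
    have "inj (\<lambda>i. complex_of_real (z i))" using inj by (auto simp: inj_def)
    then show "Suc n \<le> card (range (\<lambda>i. complex_of_real (z i)))" using n by (simp add: card_image)
    fix x assume "x \<in> range (\<lambda>i. complex_of_real (z i))"
    then obtain i where x: "x = complex_of_real (z i)" by auto
    have "poly (he (Suc n)) x = 0" using root[of i] unfolding x he_complex n by (simp del: he.simps)
    moreover have "poly ?p x = 0" unfolding x by (auto simp: poly_prod)
    ultimately show "poly (he (Suc n)) x = poly (\<Prod>a\<in>#image_mset (\<lambda>i. complex_of_real (z i)) (mset_set UNIV). [:- a, 1:]) x"
      unfolding e by simp
  qed
  have "(\<Prod>i\<in>UNIV. \<Prod>j\<in>UNIV - {i}. \<bar>z i - z j\<bar>) = (\<Prod>i\<in>UNIV. \<bar>poly (pderiv (he ?N)) (z i)\<bar>)"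
    by (simp add: d1 ri abs_prod)
  also have "\<dots> = (\<Prod>i\<in>UNIV. real (Suc n) * \<bar>poly (he n) (z i)\<bar>)"
    unfolding n pderiv_he by (simp add: abs_mult del: of_nat_Suc)
  also have "\<dots> = real (Suc n) ^ ?N * (\<Prod>i\<in>UNIV. \<bar>poly (he n) (z i)\<bar>)"
    by (simp add: prod.distrib)
  also have "(\<Prod>i\<in>UNIV. \<bar>poly (he n) (z i)\<bar>) = (\<Prod>a\<in>#image_mset (\<lambda>i. complex_of_real (z i)) (mset_set UNIV). norm (poly (he n) a))"
    by (simp add: prod_unfold_prod_mset image_mset.compositionality o_def he_complex)
  also have "\<dots> = (\<Prod>m=1..n. (real m / 2) ^ m)" by (rule he_resultant[OF facC])
  also have "{1..n} = {1..<?N}" unfolding n by auto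
  finally show "(\<Prod>i\<in>UNIV. \<Prod>j\<in>UNIV - {i}. \<bar>z i - z j\<bar>) = real ?N ^ ?N * (\<Prod>m=1..<?N. (real m / 2) ^ m)"
    by (simp add: n)
qed

subsection \<open>Stirling's formula for real arguments\<close>

text \<open>The estimate -s^2 / 2 valid on the negative side fails for s > 0. The weaker quotient
  follows from the monotonicity of (v - 1/v) / 2 - ln v, whose derivative is (1 - 1/v)^2 /
  2.\<close>

lemma ln_one_plus_upper:
  assumes "s \<ge> 0" shows "ln (1 + s) - s \<le> - s\<^sup>2 / (2 * (1 + s :: real))"
proof -
  define f where "f v = (v - inverse v) / 2 - ln v" for v :: real
  have "f 1 \<le> f (1 + s)"
  proof (rule DERIV_nonneg_imp_nondecreasing[of 1 "1 + s" f])
    fix x :: real assume x: "1 \<le> x" "x \<le> 1 + s"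
    have "(f has_real_derivative (1 - inverse x)\<^sup>2 / 2) (at x)"
      unfolding f_def using x
      by (auto intro!: derivative_eq_intros simp: power2_eq_square algebra_simps inverse_eq_divide add_divide_distrib diff_divide_distrib)
    then show "\<exists>y. (f has_real_derivative y) (at x) \<and> 0 \<le> y" by (intro exI conjI) auto
  qed (use assms in auto)
  moreover have "(1 + s - inverse (1 + s)) / 2 = s - s\<^sup>2 / (2 * (1 + s))"
    using assms by (simp add: field_simps power2_eq_square)
  ultimately show ?thesis by (simp add: f_def)
qed

lemma ln_one_plus_upper_neg:
  assumes "s \<le> 0" "s > -1" shows "ln (1 + s) - s \<le> - s\<^sup>2 / (2 :: real)"
proof -
  define f where "f s = - s\<^sup>2 / 2 - ln (1 + s) + s" for s :: real
  have "f 0 \<le> f s"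
  proof (rule DERIV_nonpos_imp_nonincreasing[OF assms(1)])
    fix x :: real assume x: "s \<le> x" "x \<le> 0"
    have "(f has_real_derivative - x\<^sup>2 / (1 + x)) (at x)"
      unfolding f_def using x assms
      by (auto intro!: derivative_eq_intros simp: divide_simps) (simp add: power2_eq_square algebra_simps)
    moreover have "- x\<^sup>2 / (1 + x) \<le> 0" using x assms by (simp add: divide_le_0_iff)
    ultimately show "\<exists>y. (f has_real_derivative y) (at x) \<and> y \<le> 0" by blast
  qed
  then show ?thesis by (simp add: f_def)
qed

lemma integrable_exp_abs: "integrable lborel (\<lambda>u::real. exp (- (\<bar>u\<bar> / 2)))"
proof -
  interpret prob_space "density lborel (exponential_density (1/2))" by (rule prob_space_exponential_density) simp
  have "integrable (density lborel (exponential_density (1/2))) (\<lambda>_. 1::real)" by simp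
  then have "integrable lborel (exponential_density (1/2))"
    by (subst (asm) integrable_density) (auto simp: exponential_density_nonneg)
  then have 1: "integrable lborel (\<lambda>u. 2 * exponential_density (1/2) u)" by simp
  then have 2: "integrable lborel (\<lambda>u. 2 * exponential_density (1/2) (- u))"
    using lborel_integrable_real_affine[OF 1, of "-1" 0] by simp
  from Bochner_Integration.integrable_add[OF 1 2] show ?thesis
    by (rule Bochner_Integration.integrable_bound) (auto simp: exponential_density_def)
qed

definition stirl :: "real \<Rightarrow> real" where
  "stirl x = sqrt (2 * pi * x) * exp (x * ln x - x)"

text \<open>Laplace's method for the Gamma integral: t = x + sqrt x u extracts sqrt x exp (x ln x -
  x) and leaves \<open>F x u\<close>, which tends to exp (-u^2 / 2).\<close>

lemma stirling_Gamma: "((\<lambda>x. Gamma (1 + x) / stirl x) \<longlongrightarrow> 1) at_top"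
proof -
  let ?g = "\<lambda>u :: real. exp (- (1 * u\<^sup>2) / 2)"
  let ?h = "\<lambda>x t :: real. indicator {0..} t * t powr (1 + x - 1) / exp t"
  define F where "F x u = (if u > - sqrt x then exp (x * ln (1 + u / sqrt x) - sqrt x * u) else 0)" for x u :: real
  have Fm[measurable]: "F x \<in> borel_measurable borel" for x unfolding F_def[abs_def] by measurable
  have F0: "F x u \<ge> 0" for x u by (simp add: F_def)
  \<comment> \<open>The Gaussian dominates for u < 0. For u >= 0 and x >= 1 the exponent is at most
    -u^2 / (2 (1 + u)) <= (1 - u) / 2, whence the exponential term with its factor exp
    (1/2).\<close>
  define w where "w u = ?g u + exp (1/2) * exp (- (\<bar>u\<bar> / 2))" for u :: real
  have g1: "has_bochner_integral lborel (\<lambda>u::real. ?g u) (sqrt (2 * pi / 1))"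
    by (rule has_bochner_integral_nn_integral) (use gauss_1d[of 1] in auto)
  have wint: "integrable lborel w" unfolding w_def
    by (intro Bochner_Integration.integrable_add integrable_mult_right integrable_exp_abs integrable.intros[OF g1])
  have Fw: "F x u \<le> w u" if x: "x \<ge> 1" for x u
  proof (cases "u > - sqrt x")
    case True
    define s where "s = u / sqrt x"
    have sx: "sqrt x > 0" "sqrt x \<ge> 1" using x by auto
    have su: "u = s * sqrt x" using sx by (simp add: s_def)
    have xx: "x = sqrt x * sqrt x" using x by simp
    have s1: "s > -1" using True sx unfolding su by (metis mult_less_cancel_right_pos mult_minus1)
    have e: "x * ln (1 + u / sqrt x) - sqrt x * u = x * (ln (1 + s) - s)"
      unfolding s_def[symmetric] su using xx by (simp add: algebra_simps)
    show ?thesis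
    proof (cases "s \<ge> 0")
      case False
      have "x * (ln (1 + s) - s) \<le> x * (- s\<^sup>2 / 2)" using x ln_one_plus_upper_neg[of s] s1 False by (intro mult_left_mono) auto
      also have "\<dots> = - (1 * u\<^sup>2) / 2" unfolding su power_mult_distrib using x by simp
      finally have "F x u \<le> ?g u" using True by (simp add: F_def e)
      then show ?thesis by (simp add: w_def add_increasing2)
    next
      case s0: True
      then have u0: "u \<ge> 0" unfolding su using sx by simp
      have "s \<le> u" unfolding s_def using u0 sx(2) by (simp add: divide_le_eq mult_le_cancel_left1)
      have "x * (ln (1 + s) - s) \<le> x * (- s\<^sup>2 / (2 * (1 + s)))" using x ln_one_plus_upper[OF s0] by (intro mult_left_mono) auto
      also have "\<dots> = - (u\<^sup>2 / (2 * (1 + s)))" unfolding su power_mult_distrib using x by simp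
      also have "\<dots> \<le> - (u\<^sup>2 / (2 * (1 + u)))" using s0 \<open>s \<le> u\<close> by (simp add: frac_le)
      also have "\<dots> \<le> 1 / 2 - u / 2"
        using u0 by (simp add: field_simps power2_eq_square)
      finally have "F x u \<le> exp (1 / 2 - u / 2)" using True by (simp add: F_def e)
      also have "\<dots> = exp (1/2) * exp (- (\<bar>u\<bar> / 2))" using u0 by (subst exp_add[symmetric]) simp
      finally show ?thesis by (simp add: w_def add_increasing)
    qed
  qed (simp add: F_def w_def)
  have Fint: "integrable lborel (F x)" if "x \<ge> 1" for x
    by (rule Bochner_Integration.integrable_bound[OF wint]) (use Fw[OF that] F0 order_trans[OF F0 Fw[OF that]] in auto)
  have Flim: "((\<lambda>x. F x u) \<longlongrightarrow> ?g u) at_top" for u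
  proof (rule Lim_transform_eventually)
    show "((\<lambda>x. exp (x * ln (1 + u / sqrt x) - sqrt x * u)) \<longlongrightarrow> ?g u) at_top"
    proof (rule tendsto_exp)
      have "((\<lambda>x. x * ln (1 + u / sqrt x) - sqrt x * u) \<longlongrightarrow> - (u * u / 2)) at_top" by real_asymp
      then show "((\<lambda>x. x * ln (1 + u / sqrt x) - sqrt x * u) \<longlongrightarrow> - (1 * u\<^sup>2) / 2) at_top"
        by (simp add: power2_eq_square)
    qed
    have "\<forall>\<^sub>F x in at_top. u > - sqrt x" by real_asymp
    then show "\<forall>\<^sub>F x in at_top. exp (x * ln (1 + u / sqrt x) - sqrt x * u) = F x u"
      by eventually_elim (simp add: F_def)
  qed
  have lim: "((\<lambda>x. \<integral>u. F x u \<partial>lborel) \<longlongrightarrow> (\<integral>u. ?g u \<partial>lborel)) at_top"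
  proof (rule integral_dominated_convergence_at_top[where w=w])
    show "\<forall>\<^sub>F x in at_top. AE u in lborel. norm (F x u) \<le> w u"
      using eventually_ge_at_top[of 1] by eventually_elim (use Fw F0 in auto)
  qed (use wint Flim in auto)
  have "(\<integral>u. ?g u \<partial>lborel) = sqrt (2 * pi)"
    using g1 by (simp add: has_bochner_integral_iff)
  with lim have lim2: "((\<lambda>x. (\<integral>u. F x u \<partial>lborel) / sqrt (2 * pi)) \<longlongrightarrow> 1) at_top"
    by (auto intro!: tendsto_eq_intros)
  have "Gamma (1 + x) / stirl x = (\<integral>u. F x u \<partial>lborel) / sqrt (2 * pi)" if x: "x \<ge> 1" for x
  proof -
    have sx: "sqrt x > 0" using x by simp
    have xx: "sqrt x * sqrt x = x" using x by simp
    have pt: "ennreal (?h x (x + sqrt x * u)) = ennreal (exp (x * ln x - x)) * ennreal (F x u)" for u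
    proof (cases "u > - sqrt x")
      case True
      then have "sqrt x * u > sqrt x * (- sqrt x)" using sx by (intro mult_strict_left_mono)
      then have p: "x + sqrt x * u > 0" using xx by simp
      have q: "x + sqrt x * u = x * (1 + u / sqrt x)" using sx xx x by (simp add: field_simps)
      have "1 + u / sqrt x > 0" using p x unfolding q by (simp add: zero_less_mult_iff)
      then have "ln (x + sqrt x * u) = ln x + ln (1 + u / sqrt x)" unfolding q using x by (simp add: ln_mult)
      then have "(x + sqrt x * u) powr x / exp (x + sqrt x * u) = exp (x * ln x - x) * F x u"
        using p True by (simp add: powr_def F_def exp_diff exp_add field_simps)
      then show ?thesis using p by (simp add: ennreal_mult'[symmetric])
    next
      case False
      then have "sqrt x * u \<le> sqrt x * (- sqrt x)" using sx by (intro mult_left_mono) auto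
      then have p: "x + sqrt x * u \<le> 0" using xx by simp
      then have "?h x (x + sqrt x * u) = 0"
        by (cases "x + sqrt x * u = 0") (auto simp: indicator_def)
      then show ?thesis using False by (simp add: F_def)
    qed
    have "ennreal (Gamma (1 + x)) = (\<integral>\<^sup>+t. ennreal (indicator {0..} t * t powr (1 + x - 1) / exp t) \<partial>lborel)"
      by (rule Gamma_conv_nn_integral_real) (use x in auto)
    also have "\<dots> = ennreal (sqrt x) * (\<integral>\<^sup>+u. ennreal (?h x (x + sqrt x * u)) \<partial>lborel)"
      by (subst nn_integral_real_affine[where c="sqrt x" and t=x]) (use sx in auto)
    also have "\<dots> = ennreal (sqrt x) * (ennreal (exp (x * ln x - x)) * (\<integral>\<^sup>+u. ennreal (F x u) \<partial>lborel))"
      unfolding pt by (subst nn_integral_cmult) auto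
    also have "(\<integral>\<^sup>+u. ennreal (F x u) \<partial>lborel) = ennreal (\<integral>u. F x u \<partial>lborel)"
      by (rule nn_integral_eq_integral) (use Fint[OF x] F0 in auto)
    also have "ennreal (sqrt x) * (ennreal (exp (x * ln x - x)) * ennreal (\<integral>u. F x u \<partial>lborel)) = ennreal (sqrt x * (exp (x * ln x - x) * (\<integral>u. F x u \<partial>lborel)))"
      using x by (simp add: ennreal_mult'[symmetric])
    finally have "Gamma (1 + x) = sqrt x * (exp (x * ln x - x) * (\<integral>u. F x u \<partial>lborel))"
      by (subst (asm) ennreal_inj) (use x in \<open>auto intro!: Gamma_real_nonneg integral_nonneg_AE mult_nonneg_nonneg simp: F0\<close>)
    then show ?thesis using sx by (simp add: stirl_def real_sqrt_mult field_simps)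
  qed
  then have "\<forall>\<^sub>F x in at_top. (\<integral>u. F x u \<partial>lborel) / sqrt (2 * pi) = Gamma (1 + x) / stirl x"
    by (intro eventually_mono[OF eventually_ge_at_top[of "1::real"]]) simp
  from Lim_transform_eventually[OF lim2 this] show ?thesis .
qed

subsection \<open>Decomposition into Weyl chambers\<close>

definition chamber :: "(real,'n::{finite,linorder}) vec set" where
  "chamber = {y. \<forall>i j. i < j \<longrightarrow> y $ i < y $ j}"

text \<open>Counting smaller values numbers both the abstract index type and the coordinates of a
  vector; matching the two numberings yields the sorting permutation.\<close>

definition order_rank :: "('n::finite \<Rightarrow> 'b::linorder) \<Rightarrow> 'n \<Rightarrow> nat" where
  "order_rank f i = card {j. f j < f i}"

lemma rank_less: "order_rank f i < order_rank f j \<longleftrightarrow> f i < f j"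
proof
  assume "f i < f j"
  then have "{l. f l < f i} \<subset> {l. f l < f j}" by auto
  then show "order_rank f i < order_rank f j" unfolding order_rank_def by (intro psubset_card_mono) auto
next
  assume r: "order_rank f i < order_rank f j"
  show "f i < f j"
  proof (rule ccontr)
    assume "\<not> f i < f j"
    then have "{l. f l < f j} \<subseteq> {l. f l < f i}" by auto
    then have "order_rank f j \<le> order_rank f i" unfolding order_rank_def by (intro card_mono) auto
    with r show False by simp
  qed
qed

lemma rank_bij:
  fixes f :: "'n::finite \<Rightarrow> 'b::linorder"
  assumes "inj f" shows "bij_betw (order_rank f) UNIV {..<CARD('n)}"
proof -
  have inj: "inj (order_rank f)"
  proof (rule injI)
    fix i j assume "order_rank f i = order_rank f j"
    then have "f i = f j" using rank_less[of f i j] rank_less[of f j i] by auto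
    then show "i = j" using assms by (simp add: inj_def)
  qed
  have "order_rank f i < CARD('n)" for i
    unfolding order_rank_def by (intro psubset_card_mono) auto
  then have "range (order_rank f) \<subseteq> {..<CARD('n)}" by auto
  moreover have "card (range (order_rank f)) = card {..<CARD('n)}" using inj by (simp add: card_image)
  ultimately have "range (order_rank f) = {..<CARD('n)}" by (intro card_subset_eq) auto
  with inj show ?thesis by (simp add: bij_betw_def)
qed

lemma chamber_unique:
  fixes y :: "(real,'n::{finite,linorder}) vec"
  assumes y: "distinct_coords y"
  shows "\<exists>!\<rho>. \<rho> permutes UNIV \<and> permvec \<rho> y \<in> chamber"
proof -
  let ?r = "order_rank (\<lambda>i. y $ i)" and ?s = "order_rank (\<lambda>i::'n. i)"
  have "inj (\<lambda>i. y $ i)" using y by (auto simp: distinct_coords_def inj_def)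
  then have r: "bij_betw ?r UNIV {..<CARD('n)}" by (rule rank_bij)
  have s: "bij_betw ?s UNIV {..<CARD('n)}" by (rule rank_bij) (simp add: inj_def)
  define \<rho> where "\<rho> i = inv_into UNIV ?r (?s i)" for i
  have rs: "?r (\<rho> i) = ?s i" for i
    unfolding \<rho>_def using r s by (intro f_inv_into_f) (auto simp: bij_betw_def)
  have rinj: "inj ?r" using r by (simp add: bij_betw_def)
  have "inj \<rho>"
  proof (rule injI)
    fix i j assume "\<rho> i = \<rho> j"
    then have "?s i = ?s j" using rs[of i] rs[of j] by simp
    then show "i = j" using s by (simp add: bij_betw_def inj_def)
  qed
  then have "\<rho> permutes UNIV" by (intro bij_imp_permutes) (auto simp: bij_betw_def finite_UNIV_inj_surj)
  moreover have "permvec \<rho> y \<in> chamber"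
    unfolding chamber_def mem_Collect_eq permvec_nth
  proof (intro allI impI)
    fix i j :: 'n assume "i < j"
    then have "?s i < ?s j" using rank_less[of "\<lambda>i::'n. i"] by blast
    then have "?r (\<rho> i) < ?r (\<rho> j)" by (simp only: rs)
    then show "y $ \<rho> i < y $ \<rho> j" using rank_less[of "\<lambda>i. y $ i"] by blast
  qed
  moreover have "\<rho>' = \<rho>" if p: "\<rho>' permutes UNIV" "permvec \<rho>' y \<in> chamber" for \<rho>'
  proof
    fix i
    have lt: "y $ \<rho>' a < y $ \<rho>' b \<longleftrightarrow> a < b" for a b
      using p(2) by (auto simp: chamber_def) (metis linorder_neqE order_less_asym order_less_irrefl)
    have b: "bij \<rho>'" using p(1) by (rule permutes_bij)
    have "{j. y $ j < y $ \<rho>' i} = \<rho>' ` {l. l < i}"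
    proof safe
      fix j assume j: "y $ j < y $ \<rho>' i"
      obtain l where "j = \<rho>' l" using b by (metis bij_pointE)
      with j lt show "j \<in> \<rho>' ` {l. l < i}" by auto
    qed (simp add: lt)
    then have "?r (\<rho>' i) = ?s i"
      unfolding order_rank_def by (simp add: card_image[OF inj_on_subset[OF bij_is_inj[OF b] subset_UNIV]])
    then show "\<rho>' i = \<rho> i" using rs[of i] rinj by (simp add: inj_def)
  qed
  ultimately show ?thesis by blast
qed

lemma chamber_borel [measurable]: "(chamber :: (real,'a::{finite,linorder}) vec set) \<in> sets borel"
proof -
  have "chamber = (\<Inter>p\<in>{(i::'a,j). i < j}. {y. y $ fst p < y $ snd p})" by (auto simp: chamber_def)
  moreover have "open \<dots>" by (intro open_INT ballI open_Collect_less continuous_intros) auto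
  ultimately show ?thesis by simp
qed

text \<open>Almost every point is moved into the chamber by exactly one permutation, and all
  chambers contribute equally.\<close>

lemma chamber_integral:
  fixes F :: "(real,'n::{finite,linorder}) vec \<Rightarrow> real"
  assumes F: "integrable lborel F" and inv: "\<And>g y. bij g \<Longrightarrow> F (permvec g y) = F y"
  shows "(\<integral>y. F y \<partial>lborel) = fact CARD('n) * (\<integral>y. indicator chamber y * F y \<partial>lborel)"
proof -
  let ?S = "{\<rho>. \<rho> permutes (UNIV :: 'n set)}"
  have [measurable]: "F \<in> borel_measurable borel" using F by auto
  have G: "integrable lborel (\<lambda>y. indicator chamber y * F y)"
    by (rule Bochner_Integration.integrable_bound[OF F]) (auto simp: indicator_def)
  have Gm: "(\<lambda>y. indicator chamber y * F y) \<in> borel_measurable borel" by measurable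
  have fin: "finite ?S" by (rule finite_permutations) simp
  have b: "bij \<rho>" if "\<rho> \<in> ?S" for \<rho> using that by (simp add: permutes_bij)
  have I: "integrable lborel (\<lambda>y. indicator chamber (permvec \<rho> y) * F (permvec \<rho> y))" if "\<rho> \<in> ?S" for \<rho>
    using integrable_permvec[OF b[OF that] Gm] G by simp
  have "(\<integral>y. F y \<partial>lborel) = (\<integral>y. (\<Sum>\<rho>\<in>?S. indicator chamber (permvec \<rho> y) * F (permvec \<rho> y)) \<partial>lborel)"
  proof (rule integral_cong_AE)
    show "(\<lambda>y. \<Sum>\<rho>\<in>?S. indicator chamber (permvec \<rho> y) * F (permvec \<rho> y)) \<in> borel_measurable lborel"
      by measurable
    show "AE y in lborel. F y = (\<Sum>\<rho>\<in>?S. indicator chamber (permvec \<rho> y) * F (permvec \<rho> y))"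
      using AE_distinct
    proof eventually_elim
      fix y :: "(real,'n) vec" assume "distinct_coords y"
      from chamber_unique[OF this] obtain \<rho> where \<rho>: "\<rho> \<in> ?S" "permvec \<rho> y \<in> chamber"
        "\<And>\<rho>'. \<rho>' \<in> ?S \<Longrightarrow> permvec \<rho>' y \<in> chamber \<Longrightarrow> \<rho>' = \<rho>" by blast
      have "(\<Sum>\<rho>\<in>?S. indicator chamber (permvec \<rho> y) * F (permvec \<rho> y)) = (\<Sum>\<rho>'\<in>?S. if \<rho>' = \<rho> then F y else 0)"
      proof (rule sum.cong[OF refl])
        fix \<rho>' assume p: "\<rho>' \<in> ?S"
        show "indicator chamber (permvec \<rho>' y) * F (permvec \<rho>' y) = (if \<rho>' = \<rho> then F y else 0)"
        proof (cases "\<rho>' = \<rho>")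
          case True
          then show ?thesis using \<rho>(2) inv[OF b[OF p], of y] by simp
        next
          case False
          then have "permvec \<rho>' y \<notin> chamber" using \<rho>(3)[OF p] by blast
          then show ?thesis using False by simp
        qed
      qed
      then have "(\<Sum>\<rho>\<in>?S. indicator chamber (permvec \<rho> y) * F (permvec \<rho> y)) = F y"
        using \<rho>(1) fin by (simp only: sum.delta if_True)
      then show "F y = (\<Sum>\<rho>\<in>?S. indicator chamber (permvec \<rho> y) * F (permvec \<rho> y))" by simp
    qed
  qed auto
  also have "\<dots> = (\<Sum>\<rho>\<in>?S. \<integral>y. indicator chamber (permvec \<rho> y) * F (permvec \<rho> y) \<partial>lborel)"
    by (rule Bochner_Integration.integral_sum) (rule I)
  also have "\<dots> = (\<Sum>\<rho>\<in>?S. \<integral>y. indicator chamber y * F y \<partial>lborel)"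
    by (rule sum.cong) (use integral_permvec[OF b Gm] in auto)
  also have "\<dots> = fact CARD('n) * (\<integral>y. indicator chamber y * F y \<partial>lborel)"
    by (simp add: card_permutations[OF refl])
  finally show ?thesis .
qed

lemma sum_offdiag_swap:
  fixes f :: "'n::finite \<Rightarrow> 'n \<Rightarrow> real"
  shows "(\<Sum>i\<in>UNIV. \<Sum>j\<in>UNIV - {i}. f i j) = (\<Sum>i\<in>UNIV. \<Sum>j\<in>UNIV - {i}. f j i)"
proof -
  have e: "(\<Sum>j\<in>UNIV - {i}. g j) = (\<Sum>j\<in>UNIV. if j = i then 0 else g j)" for i and g :: "'n \<Rightarrow> real"
    by (rule sum.mono_neutral_cong_left) auto
  show ?thesis unfolding e by (subst sum.swap) (auto intro!: sum.cong)
qed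

lemma sum_offdiag_pairs:
  fixes f :: "'n::{finite,linorder} \<Rightarrow> 'n \<Rightarrow> real"
  assumes sym: "\<And>i j. f i j = f j i"
  shows "(\<Sum>i\<in>UNIV. \<Sum>j\<in>UNIV - {i}. f i j) = 2 * (\<Sum>p\<in>{(i,j). i < j}. f (fst p) (snd p))"
proof -
  have s: "Sigma UNIV (\<lambda>i::'n. UNIV - {i}) = {(i,j). i < j} \<union> {(i,j). j < i}" by auto
  have "(\<Sum>i\<in>UNIV. \<Sum>j\<in>UNIV - {i}. f i j) = (\<Sum>p\<in>Sigma UNIV (\<lambda>i. UNIV - {i}). f (fst p) (snd p))"
    by (subst sum.Sigma) (auto simp: case_prod_beta)
  also have "\<dots> = (\<Sum>p\<in>{(i,j). i < j}. f (fst p) (snd p)) + (\<Sum>p\<in>{(i,j). j < i}. f (fst p) (snd p))"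
    unfolding s by (rule sum.union_disjoint) auto
  also have "(\<Sum>p\<in>{(i,j). j < i}. f (fst p) (snd p)) = (\<Sum>p\<in>{(i,j). i < j}. f (fst p) (snd p))"
    by (rule sum.reindex_bij_witness[of _ prod.swap prod.swap]) (auto simp: sym)
  finally show ?thesis by simp
qed

lemma prod_offdiag_pairs:
  fixes f :: "'n::{finite,linorder} \<Rightarrow> 'n \<Rightarrow> real"
  assumes sym: "\<And>i j. f i j = f j i"
  shows "(\<Prod>i\<in>UNIV. \<Prod>j\<in>UNIV - {i}. f i j) = (\<Prod>p\<in>{(i,j). i < j}. f (fst p) (snd p))\<^sup>2"
proof -
  have s: "Sigma UNIV (\<lambda>i::'n. UNIV - {i}) = {(i,j). i < j} \<union> {(i,j). j < i}" by auto
  have "(\<Prod>i\<in>UNIV. \<Prod>j\<in>UNIV - {i}. f i j) = (\<Prod>p\<in>Sigma UNIV (\<lambda>i. UNIV - {i}). f (fst p) (snd p))"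
    by (subst prod.Sigma) (auto simp: case_prod_beta)
  also have "\<dots> = (\<Prod>p\<in>{(i,j). i < j}. f (fst p) (snd p)) * (\<Prod>p\<in>{(i,j). j < i}. f (fst p) (snd p))"
    unfolding s by (rule prod.union_disjoint) auto
  also have "(\<Prod>p\<in>{(i,j). j < i}. f (fst p) (snd p)) = (\<Prod>p\<in>{(i,j). i < j}. f (fst p) (snd p))"
    by (rule prod.reindex_bij_witness[of _ prod.swap prod.swap]) (auto simp: sym)
  finally show ?thesis by (simp add: power2_eq_square)
qed

subsection \<open>The Hessian at the Hermite zeros\<close>

locale hermite_zeros =
  fixes z :: "(real,'n::{finite,linorder}) vec"
  assumes z_less: "i < j \<Longrightarrow> z $ i < z $ j" and z_root: "poly (he CARD('n)) (z $ i) = 0"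
begin

abbreviation P :: "('n \<times> 'n) set" where "P \<equiv> {(i, j). i < j}"

lemma z_inj: "inj (\<lambda>i. z $ i)"
  using z_less by (auto simp: inj_def) (metis less_irrefl linorder_neqE)

lemma z_ne: "i \<noteq> j \<Longrightarrow> z $ i - z $ j \<noteq> 0"
  using z_inj by (auto simp: inj_def)

lemma stieltjes: "(\<Sum>j\<in>UNIV - {i}. 1 / (z $ i - z $ j)) = z $ i"
  by (rule he_stieltjes[OF z_inj z_root])

text \<open>The left side is the derivative of ln |hN| at z in direction u, so this says that z is a
  critical point of |y|^2 / 2 - ln |hN y|.\<close>

lemma stieltjes_pairs: "(\<Sum>p\<in>P. (u $ snd p - u $ fst p) / (z $ snd p - z $ fst p)) = z \<bullet> u"
proof -
  have "2 * (\<Sum>p\<in>P. (u $ snd p - u $ fst p) / (z $ snd p - z $ fst p)) = (\<Sum>i\<in>UNIV. \<Sum>j\<in>UNIV - {i}. (u $ j - u $ i) / (z $ j - z $ i))"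
    by (rule sum_offdiag_pairs[of "\<lambda>i j. (u $ j - u $ i) / (z $ j - z $ i)", symmetric]) (metis minus_diff_eq minus_divide_divide)
  also have "\<dots> = (\<Sum>i\<in>UNIV. \<Sum>j\<in>UNIV - {i}. u $ i / (z $ i - z $ j) + u $ j / (z $ j - z $ i))"
  proof (intro sum.cong refl)
    fix i j :: 'n assume "j \<in> UNIV - {i}"
    then show "(u $ j - u $ i) / (z $ j - z $ i) = u $ i / (z $ i - z $ j) + u $ j / (z $ j - z $ i)"
      using z_ne[of i j] z_ne[of j i] by (simp add: divide_simps) (simp add: algebra_simps)
  qed
  also have "\<dots> = 2 * (\<Sum>i\<in>UNIV. \<Sum>j\<in>UNIV - {i}. u $ i / (z $ i - z $ j))"
    by (simp add: sum.distrib sum_offdiag_swap[of "\<lambda>i j. u $ j / (z $ j - z $ i)"])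
  also have "(\<Sum>i\<in>UNIV. \<Sum>j\<in>UNIV - {i}. u $ i / (z $ i - z $ j)) = (\<Sum>i\<in>UNIV. u $ i * z $ i)"
  proof (rule sum.cong[OF refl])
    fix i
    have "(\<Sum>j\<in>UNIV - {i}. u $ i / (z $ i - z $ j)) = u $ i * (\<Sum>j\<in>UNIV - {i}. 1 / (z $ i - z $ j))"
      by (simp add: sum_distrib_left)
    then show "(\<Sum>j\<in>UNIV - {i}. u $ i / (z $ i - z $ j)) = u $ i * z $ i" unfolding stieltjes .
  qed
  finally show ?thesis by (simp add: inner_vec_def mult.commute)
qed

text \<open>Testing \<open>stieltjes_pairs\<close> with u = z makes every summand 1.\<close>

lemma z_norm: "z \<bullet> z = real (card P)"
proof -
  have "(\<Sum>p\<in>P. (z $ snd p - z $ fst p) / (z $ snd p - z $ fst p)) = (\<Sum>p\<in>P. 1)"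
    by (rule sum.cong) (use z_ne in auto)
  then show ?thesis using stieltjes_pairs[of z] by simp
qed

text \<open>The Hessian of |y|^2 / 2 - ln |hN y| at z, as a linear operator.\<close>

definition hess :: "(real,'n) vec \<Rightarrow> (real,'n) vec" where
  "hess u = (\<chi> i. u $ i + (\<Sum>j\<in>UNIV - {i}. (u $ i - u $ j) / (z $ i - z $ j)\<^sup>2))"

lemma linear_hess: "linear hess"
  by (rule linearI)
     (auto simp: hess_def vec_eq_iff sum.distrib[symmetric] add_divide_distrib[symmetric] sum_distrib_left algebra_simps
       diff_divide_distrib intro!: sum.cong)

lemma hess_inner: "u \<bullet> hess v = u \<bullet> v + (\<Sum>p\<in>P. (u $ fst p - u $ snd p) * (v $ fst p - v $ snd p) / (z $ fst p - z $ snd p)\<^sup>2)"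
proof -
  have "2 * (\<Sum>p\<in>P. (u $ fst p - u $ snd p) * (v $ fst p - v $ snd p) / (z $ fst p - z $ snd p)\<^sup>2)
     = (\<Sum>i\<in>UNIV. \<Sum>j\<in>UNIV - {i}. (u $ i - u $ j) * (v $ i - v $ j) / (z $ i - z $ j)\<^sup>2)"
  proof (rule sum_offdiag_pairs[of "\<lambda>i j. (u $ i - u $ j) * (v $ i - v $ j) / (z $ i - z $ j)\<^sup>2", symmetric])
    fix i j :: 'n
    have "(z $ i - z $ j)\<^sup>2 = (z $ j - z $ i)\<^sup>2" by (rule power2_commute)
    moreover have "(u $ i - u $ j) * (v $ i - v $ j) = (u $ j - u $ i) * (v $ j - v $ i)" by (simp add: algebra_simps)
    ultimately show "(u $ i - u $ j) * (v $ i - v $ j) / (z $ i - z $ j)\<^sup>2 = (u $ j - u $ i) * (v $ j - v $ i) / (z $ j - z $ i)\<^sup>2"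
      by simp
  qed
  also have "\<dots> = (\<Sum>i\<in>UNIV. \<Sum>j\<in>UNIV - {i}. u $ i * (v $ i - v $ j) / (z $ i - z $ j)\<^sup>2 + u $ j * (v $ j - v $ i) / (z $ j - z $ i)\<^sup>2)"
  proof (intro sum.cong refl)
    fix i j :: 'n
    have c: "(z $ j - z $ i)\<^sup>2 = (z $ i - z $ j)\<^sup>2" by (rule power2_commute)
    have "(u $ i - u $ j) * (v $ i - v $ j) = u $ i * (v $ i - v $ j) + u $ j * (v $ j - v $ i)" by (simp add: algebra_simps)
    then show "(u $ i - u $ j) * (v $ i - v $ j) / (z $ i - z $ j)\<^sup>2 = u $ i * (v $ i - v $ j) / (z $ i - z $ j)\<^sup>2 + u $ j * (v $ j - v $ i) / (z $ j - z $ i)\<^sup>2"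
      unfolding c add_divide_distrib[symmetric] by simp
  qed
  also have "\<dots> = 2 * (\<Sum>i\<in>UNIV. \<Sum>j\<in>UNIV - {i}. u $ i * (v $ i - v $ j) / (z $ i - z $ j)\<^sup>2)"
    by (simp add: sum.distrib sum_offdiag_swap[of "\<lambda>i j. u $ j * (v $ j - v $ i) / (z $ j - z $ i)\<^sup>2"])
  also have "(\<Sum>i\<in>UNIV. \<Sum>j\<in>UNIV - {i}. u $ i * (v $ i - v $ j) / (z $ i - z $ j)\<^sup>2) = u \<bullet> hess v - u \<bullet> v"
    by (simp add: inner_vec_def hess_def distrib_left sum.distrib sum_distrib_left)
  finally show ?thesis by simp
qed

lemma hess_adj: "hess u \<bullet> v = u \<bullet> hess v"
  unfolding inner_commute[of "hess u" v] hess_inner by (simp add: inner_commute mult.commute)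

definition zpow :: "nat \<Rightarrow> (real,'n) vec" where "zpow m = (\<chi> i. (z $ i) ^ m)"

text \<open>Separates the simple pole at x = y from a polynomial remainder, so that the pole can be
  summed by the Stieltjes relations.\<close>

lemma power_diff_quotient2:
  fixes x y :: real
  assumes "x \<noteq> y"
  shows "(x ^ m - y ^ m) / (x - y)\<^sup>2 = real m * x ^ (m - 1) / (x - y)
    - (\<Sum>a<m. \<Sum>c<m - 1 - a. x ^ (a + c) * y ^ (m - 2 - a - c))"
proof -
  have d: "x - y \<noteq> 0" using assms by simp
  have "x ^ m - y ^ m = (x - y) * (\<Sum>a<m. y ^ (m - Suc a) * x ^ a)" by (rule power_diff_sumr2)
  also have "(\<Sum>a<m. y ^ (m - Suc a) * x ^ a) = (\<Sum>a<m. x ^ (m - 1) - x ^ a * (x ^ (m - Suc a) - y ^ (m - Suc a)))"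
    by (rule sum.cong) (auto simp: algebra_simps power_add[symmetric])
  also have "\<dots> = real m * x ^ (m - 1) - (\<Sum>a<m. x ^ a * (x ^ (m - Suc a) - y ^ (m - Suc a)))"
    by (simp add: sum_subtractf)
  also have "(\<Sum>a<m. x ^ a * (x ^ (m - Suc a) - y ^ (m - Suc a))) = (x - y) * (\<Sum>a<m. \<Sum>c<m - 1 - a. x ^ (a + c) * y ^ (m - 2 - a - c))"
    unfolding sum_distrib_left
  proof (rule sum.cong[OF refl])
    fix a
    have "x ^ (m - Suc a) - y ^ (m - Suc a) = (x - y) * (\<Sum>c<m - Suc a. y ^ (m - Suc a - Suc c) * x ^ c)" by (rule power_diff_sumr2)
    then show "x ^ a * (x ^ (m - Suc a) - y ^ (m - Suc a)) = (\<Sum>c<m - 1 - a. (x - y) * (x ^ (a + c) * y ^ (m - 2 - a - c)))"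
      by (simp add: sum_distrib_left power_add mult_ac numeral_2_eq_2 diff_diff_eq)
  qed
  finally have E: "x ^ m - y ^ m = (x - y) * (real m * x ^ (m - 1) - (x - y) * (\<Sum>a<m. \<Sum>c<m - 1 - a. x ^ (a + c) * y ^ (m - 2 - a - c)))" .
  have "(d * (A - d * S)) / d\<^sup>2 = A / d - S" if "d \<noteq> 0" for A S d :: real
    using that by (simp add: field_simps power2_eq_square)
  from this[OF d] show ?thesis unfolding E .
qed

text \<open>On power vectors the Hessian is triangular. The Stieltjes relation turns the polar part
  of \<open>power_diff_quotient2\<close> into m z_i^m, which makes the diagonal entry 1 + m; the
  rest is a polynomial in z_i of degree at most m - 2.\<close>

lemma hess_zpow: "hess (zpow m) - real (Suc m) *\<^sub>R zpow m \<in> span (zpow ` {..<m})"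
proof -
  have "hess (zpow m) - real (Suc m) *\<^sub>R zpow m
     = - (\<Sum>a<m. \<Sum>c<m - 1 - a. (\<Sum>j\<in>UNIV. (z $ j) ^ (m - 2 - a - c)) *\<^sub>R zpow (a + c) - zpow (m - 2))"
  proof (subst vec_eq_iff, intro allI)
    fix i
    have "(\<Sum>j\<in>UNIV - {i}. ((z $ i) ^ m - (z $ j) ^ m) / (z $ i - z $ j)\<^sup>2)
      = (\<Sum>j\<in>UNIV - {i}. real m * (z $ i) ^ (m - 1) * (1 / (z $ i - z $ j)) - (\<Sum>a<m. \<Sum>c<m - 1 - a. (z $ i) ^ (a + c) * (z $ j) ^ (m - 2 - a - c)))"
      by (rule sum.cong[OF refl], subst power_diff_quotient2) (use z_ne in auto)
    also have "\<dots> = real m * (z $ i) ^ (m - 1) * z $ i - (\<Sum>j\<in>UNIV - {i}. \<Sum>a<m. \<Sum>c<m - 1 - a. (z $ i) ^ (a + c) * (z $ j) ^ (m - 2 - a - c))"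
      unfolding sum_subtractf sum_distrib_left[symmetric] stieltjes ..
    also have "real m * (z $ i) ^ (m - 1) * z $ i = real m * (z $ i) ^ m" by (cases m) auto
    also have "(\<Sum>j\<in>UNIV - {i}. \<Sum>a<m. \<Sum>c<m - 1 - a. (z $ i) ^ (a + c) * (z $ j) ^ (m - 2 - a - c))
      = (\<Sum>a<m. \<Sum>c<m - 1 - a. \<Sum>j\<in>UNIV - {i}. (z $ i) ^ (a + c) * (z $ j) ^ (m - 2 - a - c))"
      by (subst sum.swap, rule sum.cong[OF refl], rule sum.swap)
    \<comment> \<open>The term j = i, equal to z_i^(m - 2), is restored so that the coefficients no
      longer depend on i. For m < 2 the sums are empty, so truncated subtraction does no
      harm.\<close>
    also have "\<dots> = (\<Sum>a<m. \<Sum>c<m - 1 - a. (\<Sum>j\<in>UNIV. (z $ j) ^ (m - 2 - a - c)) * (z $ i) ^ (a + c) - (z $ i) ^ (m - 2))"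
    proof (intro sum.cong refl)
      fix a c assume ac: "a \<in> {..<m}" "c \<in> {..<m - 1 - a}"
      have e1: "(\<Sum>j\<in>UNIV. (z $ j) ^ (m - 2 - a - c)) = (z $ i) ^ (m - 2 - a - c) + (\<Sum>j\<in>UNIV - {i}. (z $ j) ^ (m - 2 - a - c))"
        by (rule sum.remove) auto
      have e2: "(z $ i) ^ (m - 2 - a - c) * (z $ i) ^ (a + c) = (z $ i) ^ (m - 2)"
        using ac by (simp add: power_add[symmetric])
      show "(\<Sum>j\<in>UNIV - {i}. (z $ i) ^ (a + c) * (z $ j) ^ (m - 2 - a - c)) = (\<Sum>j\<in>UNIV. (z $ j) ^ (m - 2 - a - c)) * (z $ i) ^ (a + c) - (z $ i) ^ (m - 2)"
        unfolding e1 distrib_right e2 by (simp add: sum_distrib_left mult.commute)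
    qed
    finally show "(hess (zpow m) - real (Suc m) *\<^sub>R zpow m) $ i
      = (- (\<Sum>a<m. \<Sum>c<m - 1 - a. (\<Sum>j\<in>UNIV. (z $ j) ^ (m - 2 - a - c)) *\<^sub>R zpow (a + c) - zpow (m - 2))) $ i"
      by (simp add: hess_def zpow_def sum_component algebra_simps)
  qed
  also have "\<dots> \<in> span (zpow ` {..<m})"
    by (intro span_neg span_sum span_diff span_scale span_base) auto
  finally show ?thesis .
qed

text \<open>Otherwise a monic polynomial of degree m < N would vanish at all N zeros.\<close>

lemma zpow_independent:
  assumes "m < CARD('n)" shows "zpow m \<notin> span (zpow ` {..<m})"
proof
  have "\<exists>q. (\<forall>i\<ge>m. coeff q i = 0) \<and> v = (\<chi> i. poly q (z $ i))" if "v \<in> span (zpow ` {..<m})" for v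
    using that
  proof (induction rule: span_induct_alt)
    case base
    show ?case by (rule exI[of _ 0]) (auto simp: vec_eq_iff)
  next
    case (step c x y)
    then obtain l q where l: "l < m" "x = zpow l" and q: "\<forall>i\<ge>m. coeff q i = 0" "y = (\<chi> i. poly q (z $ i))" by auto
    show ?case
      by (rule exI[of _ "monom c l + q"]) (use l q in \<open>auto simp: vec_eq_iff zpow_def poly_monom\<close>)
  qed
  moreover assume "zpow m \<in> span (zpow ` {..<m})"
  ultimately obtain q where q: "\<forall>i\<ge>m. coeff q i = 0" "zpow m = (\<chi> i. poly q (z $ i))" by blast
  have dq: "degree (monom 1 m - q) \<le> m" by (rule degree_le) (use q in auto)
  have "monom 1 m - q = 0"
  proof (rule poly_eqI_degree[where A="range (\<lambda>i. z $ i)"])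
    show "poly (monom 1 m - q) x = poly 0 x" if "x \<in> range (\<lambda>i. z $ i)" for x
      using that q(2) by (auto simp: vec_eq_iff zpow_def poly_monom)
    show "degree (monom 1 m - q) < card (range (\<lambda>i. z $ i))" using dq assms z_inj by (simp add: card_image)
    show "degree (0 :: real poly) < card (range (\<lambda>i. z $ i))" using assms z_inj by (simp add: card_image)
  qed
  then have "coeff (monom 1 m - q) m = 0" by simp
  then show False using q by simp
qed

text \<open>The Hessian shifted by m + 1 maps the span of the first m + 1 power vectors into the
  span of the first m, which has smaller dimension; its kernel provides an eigenvector.\<close>

lemma hess_eigenvector:
  assumes m: "m < CARD('n)"
  obtains b where "norm b = 1" "hess b = real (Suc m) *\<^sub>R b"
proof -
  define B where "B v = hess v - real (Suc m) *\<^sub>R v" for v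
  have linB: "linear B"
    unfolding B_def using linear_hess by (intro linear_compose_sub linear_compose_scale_right linear_id[unfolded id_def])
  have sp: "span (zpow ` {..<l}) \<subseteq> span (zpow ` {..<m})" if "l \<le> m" for l
    using that by (intro span_mono) auto
  have base: "B (zpow l) \<in> span (zpow ` {..<m})" if "l < Suc m" for l
  proof (cases "l = m")
    case True
    then show ?thesis using hess_zpow[of m] by (simp add: B_def)
  next
    case False
    then have l: "l < m" using that by simp
    have "B (zpow l) = (hess (zpow l) - real (Suc l) *\<^sub>R zpow l) + (real (Suc l) - real (Suc m)) *\<^sub>R zpow l"
      by (simp add: B_def algebra_simps)
    also have "\<dots> \<in> span (zpow ` {..<m})"
      using sp[of l, THEN subsetD, OF _ hess_zpow] l by (intro span_add span_scale) (auto intro: span_base)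
    finally show ?thesis .
  qed
  let ?W = "span (zpow ` {..<Suc m})"
  have img: "B ` ?W \<subseteq> span (zpow ` {..<m})"
    unfolding linear_span_image[OF linB, symmetric] by (rule span_minimal) (use base in auto)
  have "\<not> inj_on B ?W"
  proof
    assume "inj_on B ?W"
    then have "dim (B ` (zpow ` {..<Suc m})) = dim (zpow ` {..<Suc m})"
      using linB by (intro dim_image_eq) auto
    also have "zpow ` {..<Suc m} = insert (zpow m) (zpow ` {..<m})" by (auto simp: lessThan_Suc)
    also have "dim \<dots> = dim (zpow ` {..<m}) + 1" using zpow_independent[OF m] by (simp add: dim_insert)
    finally have "dim (B ` (zpow ` {..<Suc m})) = dim (zpow ` {..<m}) + 1"
      by (simp add: lessThan_Suc)
    moreover have "dim (B ` (zpow ` {..<Suc m})) \<le> dim (span (zpow ` {..<m}))"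
      by (rule dim_subset) (use base in auto)
    ultimately show False by simp
  qed
  then obtain x y where "x \<noteq> y" "B x = B y" by (auto simp: inj_on_def)
  then have xy: "x - y \<noteq> 0" "B (x - y) = 0" using linear_diff[OF linB] by auto
  show ?thesis
  proof (rule that[of "(1 / norm (x - y)) *\<^sub>R (x - y)"])
    show "norm ((1 / norm (x - y)) *\<^sub>R (x - y)) = 1" using xy by simp
    show "hess ((1 / norm (x - y)) *\<^sub>R (x - y)) = real (Suc m) *\<^sub>R ((1 / norm (x - y)) *\<^sub>R (x - y))"
      using xy(2) linear_cmul[OF linear_hess, of "1 / norm (x - y)" "x - y"] by (simp add: B_def mult.commute)
  qed
qed

lemma prod_sqrt: "(\<Prod>i\<in>A. sqrt (f i)) = sqrt (\<Prod>i\<in>A. f i)"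
  by (induction A rule: infinite_finite_induct) (auto simp: real_sqrt_mult)

text \<open>Self-adjointness and distinct eigenvalues make the unit eigenvectors orthonormal, so an
  isometry diagonalizes the form, with determinant N!. The rank \<open>s\<close> distributes the
  eigenvalues 1, ..., N over the abstract index type.\<close>

lemma hess_gauss: "has_bochner_integral lborel (\<lambda>u. exp (- (u \<bullet> hess u) / 2)) (sqrt (2 * pi) ^ CARD('n) / sqrt (fact CARD('n)))"
proof -
  define s where "s = order_rank (\<lambda>i::'n. i)"
  have s: "bij_betw s UNIV {..<CARD('n)}" unfolding s_def by (rule rank_bij) (simp add: inj_def)
  have "\<forall>i. \<exists>b. norm b = 1 \<and> hess b = real (Suc (s i)) *\<^sub>R b"
    using hess_eigenvector s by (metis UNIV_I bij_betw_apply lessThan_iff)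
  then obtain b where b: "\<And>i. norm (b i) = 1" "\<And>i. hess (b i) = real (Suc (s i)) *\<^sub>R b i" by metis
  have orth: "b i \<bullet> b j = (if i = j then 1 else 0)" for i j
  proof (cases "i = j")
    case True
    then show ?thesis using b(1)[of i] by (simp add: norm_eq_1)
  next
    case False
    then have "s i \<noteq> s j" using s by (auto simp: bij_betw_def inj_def)
    moreover have "real (Suc (s i)) * (b i \<bullet> b j) = real (Suc (s j)) * (b i \<bullet> b j)"
      using hess_adj[of "b i" "b j"] unfolding b(2) by simp
    ultimately show ?thesis using False by auto
  qed
  define T where "T u = (\<Sum>i\<in>UNIV. u $ i *\<^sub>R b i)" for u :: "(real,'n) vec"
  have linT: "linear T" unfolding T_def
    by (rule linearI) (auto simp: algebra_simps sum.distrib scaleR_sum_right)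
  have TT: "T u \<bullet> T u = u \<bullet> u" for u
  proof -
    have "T u \<bullet> T u = (\<Sum>i\<in>UNIV. \<Sum>j\<in>UNIV. if i = j then u $ i * u $ j else 0)"
      unfolding T_def inner_sum_left inner_sum_right by (intro sum.cong refl) (auto simp: orth)
    then show ?thesis by (simp add: inner_vec_def)
  qed
  have nT: "norm (T u) = norm u" for u by (simp add: norm_eq_sqrt_inner TT)
  have THT: "T u \<bullet> hess (T u) = (\<Sum>i\<in>UNIV. real (Suc (s i)) * (u $ i)\<^sup>2)" for u
  proof -
    have "hess (T u) = (\<Sum>i\<in>UNIV. (u $ i * real (Suc (s i))) *\<^sub>R b i)"
      unfolding T_def by (simp add: linear_sum[OF linear_hess] linear_cmul[OF linear_hess] b(2) del: of_nat_Suc)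
    then have "T u \<bullet> hess (T u) = (\<Sum>i\<in>UNIV. \<Sum>j\<in>UNIV. if i = j then u $ i * (u $ j * real (Suc (s j))) else 0)"
      unfolding T_def inner_sum_left inner_sum_right by (simp only:) (intro sum.cong refl, auto simp: orth inner_sum_right if_distrib cong: if_cong)
    then show ?thesis by (simp add: power2_eq_square mult_ac)
  qed
  have "inj T" using linear_injective_0[OF linT] nT by (metis norm_eq_zero)
  then have "surj T" using linear_injective_imp_surjective[OF linT] by simp
  then have TS: "T (inv T x) = x" for x by (rule surj_f_inv_f)
  have cont: "continuous_on UNIV (\<lambda>u. u \<bullet> hess u)"
    by (intro continuous_intros linear_continuous_on[OF linear_hess[unfolded linear_conv_bounded_linear]])
  have [measurable]: "(\<lambda>u. exp (- (u \<bullet> hess u) / 2)) \<in> borel_measurable borel"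
    by (intro borel_measurable_continuous_onI continuous_intros cont) auto
  have g: "has_bochner_integral lborel (\<lambda>u. exp (- (T u \<bullet> hess (T u)) / 2)) (\<Prod>i\<in>UNIV. sqrt (2 * pi / real (Suc (s i))))"
    unfolding THT by (rule gauss_prod) simp
  have "(\<Prod>i\<in>UNIV. sqrt (2 * pi / real (Suc (s i)))) = sqrt (2 * pi) ^ CARD('n) / sqrt (\<Prod>i\<in>UNIV. real (Suc (s i)))"
    by (simp add: real_sqrt_divide prod_dividef prod_sqrt del: of_nat_Suc)
  also have "(\<Prod>i\<in>UNIV. real (Suc (s i))) = (\<Prod>m<CARD('n). real (Suc m))"
    by (rule prod.reindex_bij_betw[OF s])
  also have "\<dots> = fact CARD('n)" by (simp add: fact_prod_Suc atLeast0LessThan)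
  finally have c: "(\<Prod>i\<in>UNIV. sqrt (2 * pi / real (Suc (s i)))) = sqrt (2 * pi) ^ CARD('n) / sqrt (fact CARD('n))" .
  have fm: "(\<lambda>u. exp (- (u \<bullet> hess u) / 2)) \<in> borel_measurable borel" by measurable
  show ?thesis
    using g unfolding c has_bochner_integral_iff integral_isometry[OF linT nT TS fm] integrable_isometry[OF linT nT TS fm] .
qed

end

subsection \<open>Laplace asymptotics of the Gaussian ensemble\<close>

lemma hN_scaleR: "hN (c *\<^sub>R y) = c ^ card {(i::'n,j). i < j} * hN (y :: (real,'n::{finite,linorder}) vec)"
  by (simp add: hN_altdef prod.distrib[symmetric] right_diff_distrib flip: prod_constant)

lemma wt_pos: "distinct_coords y \<Longrightarrow> wt k y > 0"
  using hN_nonzero[of y] by (simp add: wt_def)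

definition mehta_const :: "nat \<Rightarrow> real \<Rightarrow> real" where
  "mehta_const N k = (\<Prod>j=1..N. Gamma (1 + k) / Gamma (1 + real j * k))"

context hermite_zeros
begin

text \<open>The factor sqrt 2 accounts for the exponent 2 k of |hN|: this is a critical point of
  |y|^2 / 2 - 2 ln |hN y|.\<close>

definition zeta :: "(real,'n) vec" where "zeta = sqrt 2 *\<^sub>R z"

text \<open>Relative change of the coordinate difference at the pair p when \<open>zeta\<close>
  moves by u.\<close>

definition gap :: "(real,'n) vec \<Rightarrow> 'n \<times> 'n \<Rightarrow> real" where
  "gap u p = (u $ snd p - u $ fst p) / (zeta $ snd p - zeta $ fst p)"

lemma zeta_pos: "p \<in> P \<Longrightarrow> zeta $ snd p - zeta $ fst p > 0"
  using z_less by (auto simp: zeta_def)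

text \<open>Criticality of \<open>zeta\<close>: the two sides are the first-order terms of 2 ln |hN
  y| and |y|^2 / 2, which is why no linear term survives in \<open>wt_ratio\<close>.\<close>

lemma gap_sum: "2 * (\<Sum>p\<in>P. gap u p) = zeta \<bullet> u"
proof -
  have ge: "gap u p = (u $ snd p - u $ fst p) / (z $ snd p - z $ fst p) / sqrt 2" for p
    by (simp add: gap_def zeta_def right_diff_distrib[symmetric])
  have "2 * (\<Sum>p\<in>P. gap u p) = 2 * ((z \<bullet> u) / sqrt 2)"
    unfolding ge sum_divide_distrib[symmetric] stieltjes_pairs ..
  also have "\<dots> = zeta \<bullet> u"
    using real_sqrt_mult_self[of 2] by (simp add: zeta_def field_simps)
  finally show ?thesis .
qed

lemma gap_hess: "u \<bullet> hess u = (norm u)\<^sup>2 + 2 * (\<Sum>p\<in>P. (gap u p)\<^sup>2)"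
proof -
  have "2 * (gap u p)\<^sup>2 = (u $ fst p - u $ snd p) * (u $ fst p - u $ snd p) / (z $ fst p - z $ snd p)\<^sup>2" for p
    by (simp add: gap_def zeta_def power_divide power_mult_distrib right_diff_distrib[symmetric] power2_commute[of "u $ fst p"] power2_commute[of "z $ fst p"] flip: power2_eq_square)
  then show ?thesis unfolding hess_inner by (simp add: sum_distrib_left power2_norm_eq_inner)
qed

lemma chamber_shift:
  assumes "k > 0" "sqrt k *\<^sub>R zeta + u \<in> chamber" "p \<in> P"
  shows "1 + gap u p / sqrt k > 0"
proof -
  let ?c = "zeta $ snd p - zeta $ fst p"
  have c: "?c > 0" by (rule zeta_pos[OF assms(3)])
  have "0 < (sqrt k *\<^sub>R zeta + u) $ snd p - (sqrt k *\<^sub>R zeta + u) $ fst p"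
    using assms(2,3) by (auto simp: chamber_def)
  also have "\<dots> = sqrt k * ?c * (1 + gap u p / sqrt k)"
    using c assms(1) by (simp add: gap_def field_simps)
  finally show ?thesis by (rule zero_less_mult_pos) (use c assms(1) in auto)
qed

text \<open>An exact identity without remainder: the linear term sqrt k (zeta . u) of the square is
  distributed over the pairs by \<open>gap_sum\<close>, so each logarithm appears with its
  first-order part removed.\<close>

lemma wt_ratio:
  assumes k: "k > 0" and u: "sqrt k *\<^sub>R zeta + u \<in> chamber"
  shows "wt k (sqrt k *\<^sub>R zeta + u) = wt k (sqrt k *\<^sub>R zeta) *
    exp (- (norm u)\<^sup>2 / 2 + (\<Sum>p\<in>P. 2 * k * (ln (1 + gap u p / sqrt k) - gap u p / sqrt k)))"
proof -
  let ?y = "sqrt k *\<^sub>R zeta + u"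
  have sk: "sqrt k > 0" "sqrt k * sqrt k = k" using k by auto
  have pos: "1 + gap u p / sqrt k > 0" if "p \<in> P" for p by (rule chamber_shift[OF k u that])
  have "?y $ snd p - ?y $ fst p = ((sqrt k *\<^sub>R zeta) $ snd p - (sqrt k *\<^sub>R zeta) $ fst p) * (1 + gap u p / sqrt k)" if "p \<in> P" for p
    using zeta_pos[OF that] sk(1) by (simp add: gap_def field_simps)
  then have "hN ?y = hN (sqrt k *\<^sub>R zeta) * (\<Prod>p\<in>P. 1 + gap u p / sqrt k)"
    unfolding hN_altdef prod.distrib[symmetric] by (intro prod.cong) auto
  moreover have Q: "(\<Prod>p\<in>P. 1 + gap u p / sqrt k) > 0" by (intro prod_pos) (use pos in auto)
  ultimately have h: "\<bar>hN ?y\<bar> powr (2 * k) = \<bar>hN (sqrt k *\<^sub>R zeta)\<bar> powr (2 * k) * (\<Prod>p\<in>P. 1 + gap u p / sqrt k) powr (2 * k)"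
    by (simp add: abs_mult powr_mult)
  have "ln (\<Prod>p\<in>P. 1 + gap u p / sqrt k) = (\<Sum>p\<in>P. ln (1 + gap u p / sqrt k))"
    by (rule ln_prod) (use pos in fastforce)+
  moreover have "(\<Prod>p\<in>P. 1 + gap u p / sqrt k) \<noteq> 0" using Q by linarith
  ultimately have p: "(\<Prod>p\<in>P. 1 + gap u p / sqrt k) powr (2 * k) = exp (2 * k * (\<Sum>p\<in>P. ln (1 + gap u p / sqrt k)))"
    by (simp only: powr_def if_False)
  have n: "(norm ?y)\<^sup>2 = (norm (sqrt k *\<^sub>R zeta))\<^sup>2 + 2 * sqrt k * (zeta \<bullet> u) + (norm u)\<^sup>2"
    unfolding power2_norm_eq_inner by (simp add: inner_add_left inner_add_right inner_commute algebra_simps)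
  have g: "sqrt k * (zeta \<bullet> u) = 2 * k * (\<Sum>p\<in>P. gap u p / sqrt k)"
  proof -
    have "2 * k * (\<Sum>p\<in>P. gap u p / sqrt k) = (k / sqrt k) * (2 * (\<Sum>p\<in>P. gap u p))"
      by (simp add: sum_divide_distrib[symmetric])
    also have "k / sqrt k = sqrt k" using k by (simp add: real_div_sqrt)
    finally show ?thesis by (simp add: gap_sum)
  qed
  have e: "- (norm ?y)\<^sup>2 / 2 = - (norm (sqrt k *\<^sub>R zeta))\<^sup>2 / 2 + (- (norm u)\<^sup>2 / 2 - 2 * k * (\<Sum>p\<in>P. gap u p / sqrt k))"
    unfolding n g[symmetric] by (simp add: field_simps del: norm_scaleR)
  have "wt k ?y = \<bar>hN (sqrt k *\<^sub>R zeta)\<bar> powr (2 * k) * (exp (2 * k * (\<Sum>p\<in>P. ln (1 + gap u p / sqrt k))) *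
      exp (- (norm (sqrt k *\<^sub>R zeta))\<^sup>2 / 2 + (- (norm u)\<^sup>2 / 2 - 2 * k * (\<Sum>p\<in>P. gap u p / sqrt k))))"
    unfolding wt_def h p e by (simp only: mult.assoc)
  also have "exp (2 * k * (\<Sum>p\<in>P. ln (1 + gap u p / sqrt k))) *
      exp (- (norm (sqrt k *\<^sub>R zeta))\<^sup>2 / 2 + (- (norm u)\<^sup>2 / 2 - 2 * k * (\<Sum>p\<in>P. gap u p / sqrt k)))
     = exp (- (norm (sqrt k *\<^sub>R zeta))\<^sup>2 / 2) * exp (- (norm u)\<^sup>2 / 2 + (\<Sum>p\<in>P. 2 * k * (ln (1 + gap u p / sqrt k) - gap u p / sqrt k)))"
    unfolding exp_add[symmetric] by (simp add: sum_subtractf sum_distrib_left right_diff_distrib)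
  finally show ?thesis by (simp add: wt_def mult.assoc)
qed

lemma distinct_zeta: "k > 0 \<Longrightarrow> distinct_coords (sqrt k *\<^sub>R zeta)"
  using z_ne by (auto simp: distinct_coords_def zeta_def)

text \<open>Fluctuations about sqrt k zeta are of order 1, hence a translation without rescaling. In
  the chamber all logarithms have positive arguments, and each term 2 k (ln (1 + d / sqrt k) - d /
  sqrt k) is at most 0, so exp (-|u|^2 / 2) dominates. Each term tends to -d^2, which produces the
  Hessian form.\<close>

lemma laplace_chamber:
  fixes g :: "(real,'n) vec \<Rightarrow> real"
  assumes g: "continuous_on UNIV g" and bd: "\<And>v. \<bar>g v\<bar> \<le> B"
  shows "((\<lambda>k. (\<integral>y. indicator chamber y * (wt k y * g ((1 / sqrt k) *\<^sub>R y)) \<partial>lborel) / wt k (sqrt k *\<^sub>R zeta))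
    \<longlongrightarrow> g zeta * (sqrt (2 * pi) ^ CARD('n) / sqrt (fact CARD('n)))) at_top"
proof -
  let ?X = "\<lambda>k u. exp (- (norm u)\<^sup>2 / 2 + (\<Sum>p\<in>P. 2 * k * (ln (1 + gap u p / sqrt k) - gap u p / sqrt k)))"
  let ?S = "\<lambda>k u. (\<Sum>p\<in>P. 2 * k * (ln (1 + gap u p / sqrt k) - gap u p / sqrt k))"
  let ?v = "\<lambda>k u. (1 / sqrt k) *\<^sub>R (sqrt k *\<^sub>R zeta + u)"
  let ?G = "\<lambda>u :: (real,'n) vec. exp (- ((1/2) * (norm u)\<^sup>2))"
  let ?d = "\<lambda>k u p. sqrt k * (zeta $ snd p - zeta $ fst p) + (u $ snd p - u $ fst p)"
  have gm[measurable]: "g \<in> borel_measurable borel" using g by (rule borel_measurable_continuous_onI)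
  define L where "L k u = indicator chamber (sqrt k *\<^sub>R zeta + u) * (wt k (sqrt k *\<^sub>R zeta + u) / wt k (sqrt k *\<^sub>R zeta) * g (?v k u))" for k u
  have Lm[measurable]: "L k \<in> borel_measurable borel" for k unfolding L_def[abs_def] by measurable
  have B0: "B \<ge> 0" using order_trans[OF abs_ge_zero bd] .
  have Lin: "L k u = ?X k u * g (?v k u)"
    if "k > 0" "sqrt k *\<^sub>R zeta + u \<in> chamber" for k u
    unfolding L_def wt_ratio[OF that] using that wt_pos[OF distinct_zeta[OF that(1)], of k] by simp
  have Lbd: "\<bar>L k u\<bar> \<le> B * ?G u" if k: "k > 0" for k u
  proof (cases "sqrt k *\<^sub>R zeta + u \<in> chamber")
    case True
    have "?S k u \<le> 0"
    proof (intro sum_nonpos mult_nonneg_nonpos)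
      fix p assume "p \<in> P"
      then have "1 + gap u p / sqrt k > 0" by (rule chamber_shift[OF k True])
      then show "ln (1 + gap u p / sqrt k) - gap u p / sqrt k \<le> 0" using ln_add_one_self_le_self2[of "gap u p / sqrt k"] by simp
    qed (use k in auto)
    then have "?X k u \<le> ?G u" by simp
    then have "\<bar>L k u\<bar> \<le> ?G u * B"
      unfolding Lin[OF k True] abs_mult by (intro mult_mono bd) auto
    then show ?thesis by (simp add: mult.commute)
  next
    case False
    then show ?thesis using B0 by (simp add: L_def)
  qed
  have lim: "((\<lambda>k. L k u) \<longlongrightarrow> exp (- (u \<bullet> hess u) / 2) * g zeta) at_top" for u
  proof (rule Lim_transform_eventually)
    have s: "((\<lambda>k. 2 * k * (ln (1 + d / sqrt k) - d / sqrt k)) \<longlongrightarrow> - (d * d)) at_top" for d :: real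
      by real_asymp
    have "((\<lambda>k. - (norm u)\<^sup>2 / 2 + ?S k u) \<longlongrightarrow> - (norm u)\<^sup>2 / 2 + (\<Sum>p\<in>P. - (gap u p * gap u p))) at_top"
      by (intro tendsto_intros s)
    also have "- (norm u)\<^sup>2 / 2 + (\<Sum>p\<in>P. - (gap u p * gap u p)) = - (u \<bullet> hess u) / 2"
      unfolding gap_hess by (simp add: power2_eq_square sum_negf)
    finally have 1: "((\<lambda>k. ?X k u) \<longlongrightarrow> exp (- (u \<bullet> hess u) / 2)) at_top"
      by (rule tendsto_exp)
    have "((\<lambda>k::real. 1 / sqrt k) \<longlongrightarrow> 0) at_top" by real_asymp
    then have "((\<lambda>k::real. zeta + (1 / sqrt k) *\<^sub>R u) \<longlongrightarrow> zeta + 0 *\<^sub>R u) at_top" by (intro tendsto_intros)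
    moreover have "\<forall>\<^sub>F k in at_top. zeta + (1 / sqrt k) *\<^sub>R u = (1 / sqrt k) *\<^sub>R (sqrt k *\<^sub>R zeta + u)"
      using eventually_gt_at_top[of 0] by eventually_elim (simp add: scaleR_add_right)
    ultimately have "((\<lambda>k::real. (1 / sqrt k) *\<^sub>R (sqrt k *\<^sub>R zeta + u)) \<longlongrightarrow> zeta) at_top"
      by (auto intro: Lim_transform_eventually)
    then have 2: "((\<lambda>k. g (?v k u)) \<longlongrightarrow> g zeta) at_top"
      using g by (intro isCont_tendsto_compose[of zeta g]) (auto simp: continuous_on_eq_continuous_at)
    show "((\<lambda>k. ?X k u * g (?v k u)) \<longlongrightarrow> exp (- (u \<bullet> hess u) / 2) * g zeta) at_top"
      by (intro tendsto_mult 1 2)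
    have "\<forall>\<^sub>F k in at_top. \<forall>p\<in>P. 0 < ?d k u p"
    proof (rule eventually_ball_finite)
      show "\<forall>p\<in>P. \<forall>\<^sub>F k in at_top. 0 < ?d k u p"
      proof
        fix p assume "p \<in> P"
        then have "zeta $ snd p - zeta $ fst p > 0" by (rule zeta_pos)
        then show "\<forall>\<^sub>F k in at_top. 0 < ?d k u p"
          by real_asymp
      qed
    qed simp
    then show "\<forall>\<^sub>F k in at_top. ?X k u * g (?v k u) = L k u"
      using eventually_gt_at_top[of 0]
    proof eventually_elim
      fix k :: real assume k: "k > 0" and p: "\<forall>p\<in>P. 0 < ?d k u p"
      have "sqrt k *\<^sub>R zeta + u \<in> chamber"
        unfolding chamber_def mem_Collect_eq
      proof (intro allI impI)
        fix i j :: 'n assume "i < j"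
        then have "0 < sqrt k * (zeta $ j - zeta $ i) + (u $ j - u $ i)" using p by auto
        then show "(sqrt k *\<^sub>R zeta + u) $ i < (sqrt k *\<^sub>R zeta + u) $ j" by (simp add: algebra_simps)
      qed
      from Lin[OF k this] show "?X k u * g (?v k u) = L k u" by simp
    qed
  qed
  have "((\<lambda>k. \<integral>u. L k u \<partial>lborel) \<longlongrightarrow> (\<integral>u. exp (- (u \<bullet> hess u) / 2) * g zeta \<partial>lborel)) at_top"
  proof (rule integral_dominated_convergence_at_top[where w="\<lambda>u. B * ?G u"])
    show "integrable lborel (\<lambda>u::(real,'n) vec. B * ?G u)"
      by (intro integrable_mult_right integrable_gauss) simp
    show "\<forall>\<^sub>F k in at_top. AE u in lborel. norm (L k u) \<le> B * ?G u"
      using eventually_gt_at_top[of 0] by eventually_elim (use Lbd in auto)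
    have "continuous_on UNIV (\<lambda>u. u \<bullet> hess u)"
      by (intro continuous_intros linear_continuous_on[OF linear_hess[unfolded linear_conv_bounded_linear]])
    then show "(\<lambda>u. exp (- (u \<bullet> hess u) / 2) * g zeta) \<in> borel_measurable lborel"
      by (auto intro!: borel_measurable_continuous_onI continuous_intros)
  qed (use lim in auto)
  moreover have "(\<integral>u. exp (- (u \<bullet> hess u) / 2) * g zeta \<partial>lborel) = g zeta * (sqrt (2 * pi) ^ CARD('n) / sqrt (fact CARD('n)))"
    using hess_gauss by (simp add: has_bochner_integral_iff)
  moreover have "(\<integral>u. L k u \<partial>lborel) = (\<integral>y. indicator chamber y * (wt k y * g ((1 / sqrt k) *\<^sub>R y)) \<partial>lborel) / wt k (sqrt k *\<^sub>R zeta)" for k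
  proof -
    let ?F = "\<lambda>y. indicator chamber y * (wt k y * g ((1 / sqrt k) *\<^sub>R y))"
    have "(\<integral>y. ?F y \<partial>lborel) = (\<integral>u. ?F (sqrt k *\<^sub>R zeta + u) \<partial>lborel)"
      by (subst lborel_distr_plus[of "sqrt k *\<^sub>R zeta", symmetric]) (subst integral_distr, auto)
    moreover have "L k u = ?F (sqrt k *\<^sub>R zeta + u) / wt k (sqrt k *\<^sub>R zeta)" for u by (simp add: L_def)
    ultimately show ?thesis by simp
  qed
  ultimately show ?thesis by simp
qed

section \<open>The weight at the scaled zeros and the normalizing constant\<close>

lemma card_P: "2 * real (card P) = real CARD('n) * (real CARD('n) - 1)"
proof -
  have "(\<Sum>i\<in>UNIV. \<Sum>j\<in>UNIV - {i::'n}. 1::real) = 2 * real (card P)" by (subst sum_offdiag_pairs) auto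
  moreover have "(\<Sum>i\<in>UNIV. \<Sum>j\<in>UNIV - {i::'n}. 1::real) = real CARD('n) * (real CARD('n) - 1)"
    by (simp add: of_nat_diff)
  ultimately show ?thesis by simp
qed

lemma sum_upto_card: "(\<Sum>m=1..CARD('n). real m) = real CARD('n) + real (card P)"
proof -
  have "2 * (\<Sum>m=1..N. real m) = real N * (real N + 1)" for N
    by (induction N) (auto simp: algebra_simps)
  from this[of "CARD('n)"] show ?thesis using card_P by (simp add: algebra_simps)
qed

text \<open>The discriminant evaluates |hN z|; its powers of 1/2 cancel the powers of sqrt 2
  contained in \<open>zeta\<close>. The Gaussian factor uses that |z|^2 is the number of
  pairs.\<close>

lemma wt_zeta:
  fixes k :: real
  assumes k: "k > 0"
  shows "wt k (sqrt k *\<^sub>R zeta) = exp (k * real (card P) * ln k - k * real (card P) + k * (\<Sum>m=1..CARD('n). real m * ln (real m)))"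
proof -
  let ?N = "CARD('n)"
  let ?D = "(\<Prod>p\<in>P. \<bar>z $ fst p - z $ snd p\<bar>)"
  have D: "?D > 0" by (intro prod_pos) (use z_ne in auto)
  have "?D\<^sup>2 = (\<Prod>i\<in>UNIV. \<Prod>j\<in>UNIV - {i}. \<bar>z $ i - z $ j\<bar>)"
    by (rule prod_offdiag_pairs[symmetric]) (rule abs_minus_commute)
  also have "\<dots> = real ?N ^ ?N * (\<Prod>m=1..<?N. (real m / 2) ^ m)" by (rule he_discriminant[OF z_inj z_root])
  finally have disc: "?D\<^sup>2 = real ?N ^ ?N * (\<Prod>m=1..<?N. (real m / 2) ^ m)" .
  have "ln (\<Prod>m=1..<?N. (real m / 2) ^ m) = (\<Sum>m=1..<?N. ln ((real m / 2) ^ m))"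
    by (rule ln_prod) auto
  also have "\<dots> = (\<Sum>m=1..<?N. m * ln m) - (\<Sum>m=1..<?N. real m) * ln 2"
    by (simp add: ln_realpow ln_div right_diff_distrib sum_subtractf sum_distrib_right)
  finally have l1: "ln (\<Prod>m=1..<?N. (real m / 2) ^ m) = (\<Sum>m=1..<?N. m * ln m) - (\<Sum>m=1..<?N. real m) * ln 2" .
  have spl: "{1..?N} = insert ?N {1..<?N}" by (auto simp: Suc_le_eq)
  have "(\<Sum>m=1..?N. real m) = real ?N + (\<Sum>m=1..<?N. real m)" unfolding spl by (subst sum.insert) auto
  then have sP: "(\<Sum>m=1..<?N. real m) = card P" using sum_upto_card by simp
  have sL: "(\<Sum>m=1..?N. m * ln m) = ?N * ln ?N + (\<Sum>m=1..<?N. m * ln m)" unfolding spl by (subst sum.insert) auto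
  have "2 * ln ?D = ln (?D\<^sup>2)" using D by (simp add: ln_realpow)
  also have "\<dots> = ?N * ln ?N + ((\<Sum>m=1..<?N. m * ln m) - card P * ln 2)"
  proof -
    have "0 < (\<Prod>m=1..<?N. (real m / 2) ^ m)" by (intro prod_pos) auto
    then have "ln (?D\<^sup>2) = ln (real ?N ^ ?N) + ln (\<Prod>m=1..<?N. (real m / 2) ^ m)"
      unfolding disc by (subst ln_mult) auto
    then show ?thesis unfolding l1 sP by (simp add: ln_realpow)
  qed
  finally have lD: "2 * ln ?D = (\<Sum>m=1..?N. m * ln m) - card P * ln 2" unfolding sL by simp
  have "\<bar>hN z\<bar> = ?D" unfolding hN_altdef abs_prod by (rule prod.cong) (auto simp: abs_minus_commute)
  moreover have "sqrt k *\<^sub>R zeta = sqrt (2 * k) *\<^sub>R z" by (simp add: zeta_def real_sqrt_mult)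
  ultimately have h: "\<bar>hN (sqrt k *\<^sub>R zeta)\<bar> = (sqrt (2 * k)) ^ card P * ?D"
    using k by (simp only: hN_scaleR abs_mult power_abs[symmetric]) simp
  have "2 * ln \<bar>hN (sqrt k *\<^sub>R zeta)\<bar> = card P * ln (2 * k) + 2 * ln ?D"
  proof -
    have "2 * ln (sqrt (2 * k) ^ c * d) = real c * ln (2 * k) + 2 * ln d" if "d > 0" for c and d :: real
      using that k by (simp add: ln_mult ln_realpow ln_sqrt)
    from this[OF D] show ?thesis unfolding h .
  qed
  also have "\<dots> = card P * ln k + (\<Sum>m=1..?N. m * ln m)"
    unfolding lD using k by (simp add: ln_mult algebra_simps)
  finally have lh: "2 * ln \<bar>hN (sqrt k *\<^sub>R zeta)\<bar> = card P * ln k + (\<Sum>m=1..?N. m * ln m)" .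
  have "\<bar>hN (sqrt k *\<^sub>R zeta)\<bar> powr (2 * k) = exp (k * (2 * ln \<bar>hN (sqrt k *\<^sub>R zeta)\<bar>))"
    using hN_nonzero[OF distinct_zeta[OF k]] by (simp add: powr_def mult_ac)
  moreover have "(norm (sqrt k *\<^sub>R zeta))\<^sup>2 / 2 = k * card P"
  proof -
    have "(norm z)\<^sup>2 = real (card P)" by (simp add: power2_norm_eq_inner z_norm)
    then show ?thesis using k by (simp add: zeta_def power_mult_distrib)
  qed
  ultimately show ?thesis unfolding wt_def lh minus_divide_left[symmetric]
    by (simp add: exp_add[symmetric] algebra_simps)
qed

text \<open>Stirling's leading terms cancel the closed form in \<open>wt_zeta\<close> exactly,
  except for the square roots, whose quotients 1 / sqrt j multiply to 1 / sqrt N!. Only ratios of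
  Gamma to its approximation remain, each tending to 1.\<close>

lemma mehta_const_wt_zeta:
  fixes k :: real
  assumes k: "k > 0"
  shows "mehta_const CARD('n) k * wt k (sqrt k *\<^sub>R zeta)
    = (1 / sqrt (fact CARD('n))) * (\<Prod>j=1..CARD('n). (Gamma (1 + k) / stirl k) / (Gamma (1 + real j * k) / stirl (real j * k)))"
proof -
  let ?N = "CARD('n)"
  have sp: "stirl (real j * k) > 0" if "real j \<ge> 1" for j using that k by (simp add: stirl_def)
  have "stirl k / stirl (real j * k) = (1 / sqrt (real j)) * exp (k * ln k - k - real j * k * (ln (real j) + ln k) + real j * k)" if j: "j \<in> {1..?N}" for j :: nat
  proof -
    have j0: "real j > 0" using j by simp
    have "stirl k / stirl (real j * k) = (sqrt (2 * pi * k) / sqrt (2 * pi * (real j * k))) * (exp (k * ln k - k) / exp (real j * k * ln (real j * k) - real j * k))"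
      by (simp add: stirl_def)
    also have "sqrt (2 * pi * k) / sqrt (2 * pi * (real j * k)) = 1 / sqrt (real j)"
      using k j0 by (simp add: real_sqrt_mult)
    also have "exp (k * ln k - k) / exp (real j * k * ln (real j * k) - real j * k) = exp (k * ln k - k - real j * k * (ln (real j) + ln k) + real j * k)"
      using k j0 by (simp add: exp_diff[symmetric] ln_mult algebra_simps)
    finally show ?thesis .
  qed
  then have "(\<Prod>j=1..?N. stirl k / stirl (real j * k)) = (\<Prod>j=1..?N. (1 / sqrt (real j)) * exp (k * ln k - k - real j * k * (ln (real j) + ln k) + real j * k))"
    by (rule prod.cong[OF refl])
  also have "\<dots> = (\<Prod>j=1..?N. 1 / sqrt (real j)) * exp (\<Sum>j=1..?N. k * ln k - k - real j * k * (ln (real j) + ln k) + real j * k)"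
    unfolding prod.distrib by (simp only: exp_sum finite_atLeastAtMost)
  also have "(\<Prod>j=1..?N. 1 / sqrt (real j)) = 1 / sqrt (fact ?N)"
    by (simp add: prod_dividef prod_sqrt fact_prod)
  also have "(\<Sum>j=1..?N. k * ln k - k - real j * k * (ln (real j) + ln k) + real j * k)
     = ?N * (k * ln k - k) - k * (\<Sum>j=1..?N. real j * ln (real j)) - (k * ln k - k) * (\<Sum>j=1..?N. real j)"
    by (simp add: sum.distrib sum_subtractf sum_distrib_left algebra_simps)
  also have "\<dots> = - (k * card P * ln k - k * card P + k * (\<Sum>m=1..?N. real m * ln (real m)))"
    unfolding sum_upto_card by (simp add: algebra_simps)
  finally have "(\<Prod>j=1..?N. stirl k / stirl (real j * k)) * wt k (sqrt k *\<^sub>R zeta) = 1 / sqrt (fact ?N)"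
    unfolding wt_zeta[OF k] by (simp only: mult.assoc mult_exp_exp left_minus exp_zero mult_1_right)
  moreover have "mehta_const ?N k = (\<Prod>j=1..?N. stirl k / stirl (real j * k)) * (\<Prod>j=1..?N. (Gamma (1 + k) / stirl k) / (Gamma (1 + real j * k) / stirl (real j * k)))"
    unfolding mehta_const_def prod.distrib[symmetric]
  proof (rule prod.cong[OF refl])
    fix j assume "j \<in> {1..?N}"
    then have "stirl (real j * k) > 0" "stirl k > 0" using sp[of j] sp[of 1] by auto
    then show "Gamma (1 + k) / Gamma (1 + real j * k) = stirl k / stirl (real j * k) * (Gamma (1 + k) / stirl k / (Gamma (1 + real j * k) / stirl (real j * k)))"
      by simp
  qed
  moreover have "M * W = c * B" if "A * W = c" "M = A * B" for A B M W c :: real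
    unfolding that(2) that(1)[symmetric] by (simp only: mult_ac)
  ultimately show ?thesis by blast
qed

lemma mehta_const_limit: "((\<lambda>k. mehta_const CARD('n) k * wt k (sqrt k *\<^sub>R zeta)) \<longlongrightarrow> 1 / sqrt (fact CARD('n))) at_top"
proof (rule Lim_transform_eventually)
  have "((\<lambda>k::real. (Gamma (1 + k) / stirl k) / (Gamma (1 + real j * k) / stirl (real j * k))) \<longlongrightarrow> 1 / 1) at_top" if "j \<in> {1..CARD('n)}" for j :: nat
  proof -
    have "filterlim (\<lambda>k. real j * k) at_top at_top"
      using that by (intro filterlim_tendsto_pos_mult_at_top[OF tendsto_const] filterlim_ident) auto
    from filterlim_compose[OF stirling_Gamma this] show ?thesis
      by (intro tendsto_divide stirling_Gamma) auto
  qed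
  then have "((\<lambda>k::real. \<Prod>j=1..CARD('n). (Gamma (1 + k) / stirl k) / (Gamma (1 + real j * k) / stirl (real j * k))) \<longlongrightarrow> (\<Prod>j=1..CARD('n). 1 / 1)) at_top"
    by (rule tendsto_prod)
  then show "((\<lambda>k::real. (1 / sqrt (fact CARD('n))) * (\<Prod>j=1..CARD('n). (Gamma (1 + k) / stirl k) / (Gamma (1 + real j * k) / stirl (real j * k)))) \<longlongrightarrow> 1 / sqrt (fact CARD('n))) at_top"
    by (rule tendsto_eq_rhs[OF tendsto_mult[OF tendsto_const]]) simp
  show "\<forall>\<^sub>F k in at_top. (1 / sqrt (fact CARD('n))) * (\<Prod>j=1..CARD('n). (Gamma (1 + k) / stirl k) / (Gamma (1 + real j * k) / stirl (real j * k))) = mehta_const CARD('n) k * wt k (sqrt k *\<^sub>R zeta)"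
    using eventually_gt_at_top[of 0] by eventually_elim (simp add: mehta_const_wt_zeta)
qed

lemma wt_bounded_integrable:
  fixes g :: "(real,'n) vec \<Rightarrow> real"
  assumes "k \<ge> 0" "continuous_on UNIV g" "\<And>v. \<bar>g v\<bar> \<le> B"
  shows "integrable lborel (\<lambda>y. wt k y * g (c *\<^sub>R y))"
proof -
  have [measurable]: "g \<in> borel_measurable borel" using assms(2) by (rule borel_measurable_continuous_onI)
  have "integrable lborel (\<lambda>y. g (c *\<^sub>R y) * wt k y)"
    by (rule wt_integrable[OF assms(1)]) (auto intro!: expbd_mono[OF expbd_const[of B]] order_trans[OF assms(3)])
  then show ?thesis by (simp add: mult.commute)
qed

text \<open>Symmetry reduces the integral to N! copies of one chamber. This factor meets 1 / sqrt N!
  from the normalization and 1 / sqrt N! from the Hessian determinant, and their product is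
  1.\<close>

lemma ensemble_limit:
  fixes g :: "(real,'n) vec \<Rightarrow> real"
  assumes g: "continuous_on UNIV g" and bd: "\<And>v. \<bar>g v\<bar> \<le> B" and inv: "\<And>\<rho> v. bij \<rho> \<Longrightarrow> g (permvec \<rho> v) = g v"
  shows "((\<lambda>k. mehta_const CARD('n) k / sqrt (2 * pi) ^ CARD('n) * (\<integral>y. wt k y * g ((1 / sqrt k) *\<^sub>R y) \<partial>lborel)) \<longlongrightarrow> g zeta) at_top"
proof (rule Lim_transform_eventually)
  let ?c = "sqrt (2 * pi) ^ CARD('n)" and ?f = "fact CARD('n) :: real"
  let ?I = "\<lambda>k. (\<integral>y. indicator chamber y * (wt k y * g ((1 / sqrt k) *\<^sub>R y)) \<partial>lborel)"
  have c: "?c > 0" and f: "?f > 0" by auto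
  have "((\<lambda>k. ?f / ?c * ((mehta_const CARD('n) k * wt k (sqrt k *\<^sub>R zeta)) * (?I k / wt k (sqrt k *\<^sub>R zeta)))) \<longlongrightarrow> ?f / ?c * ((1 / sqrt ?f) * (g zeta * (?c / sqrt ?f)))) at_top"
    by (intro tendsto_mult tendsto_const mehta_const_limit laplace_chamber[OF g bd])
  also have "?f / ?c * ((1 / sqrt ?f) * (g zeta * (?c / sqrt ?f))) = g zeta"
    using c by (simp add: field_simps)
  finally show "((\<lambda>k. ?f / ?c * ((mehta_const CARD('n) k * wt k (sqrt k *\<^sub>R zeta)) * (?I k / wt k (sqrt k *\<^sub>R zeta)))) \<longlongrightarrow> g zeta) at_top" .
  show "\<forall>\<^sub>F k in at_top. ?f / ?c * ((mehta_const CARD('n) k * wt k (sqrt k *\<^sub>R zeta)) * (?I k / wt k (sqrt k *\<^sub>R zeta)))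
    = mehta_const CARD('n) k / ?c * (\<integral>y. wt k y * g ((1 / sqrt k) *\<^sub>R y) \<partial>lborel)"
    using eventually_gt_at_top[of 0]
  proof eventually_elim
    fix k :: real assume k: "k > 0"
    have "(\<integral>y. wt k y * g ((1 / sqrt k) *\<^sub>R y) \<partial>lborel) = ?f * ?I k"
      by (rule chamber_integral) (use k in \<open>auto intro!: wt_bounded_integrable[OF _ g bd] simp: wt_permvec permvec_scaleR[symmetric] inv\<close>)
    moreover have "wt k (sqrt k *\<^sub>R zeta) > 0" by (rule wt_pos[OF distinct_zeta[OF k]])
    ultimately show "?f / ?c * ((mehta_const CARD('n) k * wt k (sqrt k *\<^sub>R zeta)) * (?I k / wt k (sqrt k *\<^sub>R zeta)))
      = mehta_const CARD('n) k / ?c * (\<integral>y. wt k y * g ((1 / sqrt k) *\<^sub>R y) \<partial>lborel)" by simp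
  qed
qed

end

subsection \<open>The freezing limit\<close>

lemma integral_Cauchy_Schwarz:
  fixes a b :: "'a \<Rightarrow> real"
  assumes "integrable M (\<lambda>x. (a x)\<^sup>2)" "integrable M (\<lambda>x. (b x)\<^sup>2)" "integrable M (\<lambda>x. a x * b x)"
  shows "(\<integral>x. a x * b x \<partial>M)\<^sup>2 \<le> (\<integral>x. (a x)\<^sup>2 \<partial>M) * (\<integral>x. (b x)\<^sup>2 \<partial>M)"
proof -
  let ?A = "\<integral>x. (a x)\<^sup>2 \<partial>M" and ?B = "\<integral>x. (b x)\<^sup>2 \<partial>M" and ?C = "\<integral>x. a x * b x \<partial>M"
  have q: "0 \<le> ?A - 2 * s * ?C + s\<^sup>2 * ?B" for s
  proof -
    have "0 \<le> (\<integral>x. (a x - s * b x)\<^sup>2 \<partial>M)" by (rule integral_nonneg_AE) simp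
    also have "(\<lambda>x. (a x - s * b x)\<^sup>2) = (\<lambda>x. (a x)\<^sup>2 - 2 * s * (a x * b x) + s\<^sup>2 * (b x)\<^sup>2)"
      by (auto simp: power2_eq_square algebra_simps)
    also have "(\<integral>x. (a x)\<^sup>2 - 2 * s * (a x * b x) + s\<^sup>2 * (b x)\<^sup>2 \<partial>M) = ?A - 2 * s * ?C + s\<^sup>2 * ?B"
      using assms by simp
    finally show ?thesis .
  qed
  have B: "?B \<ge> 0" by (rule integral_nonneg_AE) simp
  show ?thesis
  proof (cases "?B = 0")
    case False
    with B have "?B > 0" by (simp only: less_le) simp
    moreover have "0 \<le> ?A - 2 * (?C / ?B) * ?C + (?C / ?B)\<^sup>2 * ?B" by (rule q)
    ultimately show ?thesis by (simp add: field_simps power2_eq_square)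
  next
    case True
    have "?C = 0"
    proof (rule ccontr)
      assume "?C \<noteq> 0"
      \<comment> \<open>For \<open>?B = 0\<close> the quadratic in s is affine, and this s gives it
        the value -1.\<close>
      then show False using q[of "(?A + 1) / (2 * ?C)"] True by simp
    qed
    then show ?thesis using True by simp
  qed
qed

definition ens :: "nat \<Rightarrow> real \<Rightarrow> real" where
  "ens N k = mehta_const N k / sqrt (2 * pi) ^ N"

context hermite_zeros
begin

lemma ens_nonneg: "k > 0 \<Longrightarrow> ens N k \<ge> 0"
  unfolding ens_def mehta_const_def by (intro divide_nonneg_nonneg prod_nonneg) (auto intro!: Gamma_real_nonneg divide_nonneg_nonneg add_pos_nonneg)

text \<open>The test function 1 shows that the Gamma product normalizes the weight
  asymptotically.\<close>

lemma ens_mehta: "((\<lambda>k. ens CARD('n) k * mehta TYPE('n) k) \<longlongrightarrow> 1) at_top"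
  using ensemble_limit[of "\<lambda>_. 1" 1] by (simp add: mehta_def ens_def)

text \<open>Cauchy-Schwarz with the weight split into square roots: the kernel factor is at most exp
  (2 |x|^2) times the normalized mass, and the other factor is the ensemble average of the symmetric
  function \<open>\<psi>\<close> squared, which tends to its value 0 at \<open>zeta\<close>.\<close>

lemma kernel_vanishing:
  fixes \<psi> :: "(real,'n) vec \<Rightarrow> real"
  assumes c: "continuous_on UNIV \<psi>" and bd: "\<And>v. \<bar>\<psi> v\<bar> \<le> B" and inv: "\<And>\<rho> v. bij \<rho> \<Longrightarrow> \<psi> (permvec \<rho> v) = \<psi> v"
    and z0: "\<psi> zeta = 0"
  shows "((\<lambda>k. ens CARD('n) k * (\<integral>y. wt k y * (dunkl_kernel k x y * \<psi> ((1 / sqrt k) *\<^sub>R y)) \<partial>lborel)) \<longlongrightarrow> 0) at_top"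
proof -
  let ?v = "\<lambda>k y. \<psi> ((1 / sqrt k) *\<^sub>R y)"
  let ?w = "exp (2 * (norm x)\<^sup>2)"
  have m[measurable]: "\<psi> \<in> borel_measurable borel" using c by (rule borel_measurable_continuous_onI)
  define Q where "Q k = ens CARD('n) k * (\<integral>y. wt k y * (?v k y)\<^sup>2 \<partial>lborel)" for k
  define I where "I k = ens CARD('n) k * (\<integral>y. wt k y * (dunkl_kernel k x y * ?v k y) \<partial>lborel)" for k
  have sq: "\<bar>(\<psi> v)\<^sup>2\<bar> \<le> B\<^sup>2" for v using power_mono[OF bd[of v], of 2] by simp
  have "(Q \<longlongrightarrow> (\<psi> zeta)\<^sup>2) at_top"
    unfolding Q_def[abs_def] ens_def by (rule ensemble_limit[of "\<lambda>v. (\<psi> v)\<^sup>2" "B\<^sup>2"]) (use c sq inv in \<open>auto intro!: continuous_intros\<close>)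
  then have Q0: "(Q \<longlongrightarrow> 0) at_top" by (simp add: z0)
  have bound: "(I k)\<^sup>2 \<le> ?w * (ens CARD('n) k * mehta TYPE('n) k) * Q k" if k: "k \<ge> 1" for k
  proof -
    have k0: "k \<ge> 0" "k > 0" using k by auto
    note [measurable] = dunkl_kernel_measurable[OF k0(1)]
    let ?E = "\<lambda>y. sqrt (wt k y) * dunkl_kernel k x y" and ?F = "\<lambda>y. sqrt (wt k y) * ?v k y"
    have E2: "(?E y)\<^sup>2 = (dunkl_kernel k x y)\<^sup>2 * wt k y" and F2: "(?F y)\<^sup>2 = wt k y * (?v k y)\<^sup>2"
      and EF: "?E y * ?F y = wt k y * (dunkl_kernel k x y * ?v k y)" for y
    proof -
      show "(?E y)\<^sup>2 = (dunkl_kernel k x y)\<^sup>2 * wt k y" "(?F y)\<^sup>2 = wt k y * (?v k y)\<^sup>2"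
        by (simp_all add: power_mult_distrib)
      have "?E y * ?F y = (sqrt (wt k y) * sqrt (wt k y)) * (dunkl_kernel k x y * ?v k y)" by (simp only: mult_ac)
      then show "?E y * ?F y = wt k y * (dunkl_kernel k x y * ?v k y)" by simp
    qed
    have iE: "integrable lborel (\<lambda>y. (?E y)\<^sup>2)" unfolding E2 by (rule dunkl_kernel_L2(1)[OF k])
    have iF: "integrable lborel (\<lambda>y. (?F y)\<^sup>2)" unfolding F2
      by (rule wt_bounded_integrable[OF k0(1), of "\<lambda>v. (\<psi> v)\<^sup>2"]) (use c sq in \<open>auto intro!: continuous_intros\<close>)
    have iEF: "integrable lborel (\<lambda>y. ?E y * ?F y)"
    proof (rule Bochner_Integration.integrable_bound[OF Bochner_Integration.integrable_add[OF iE iF]])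
      show "AE y in lborel. norm (?E y * ?F y) \<le> norm ((?E y)\<^sup>2 + (?F y)\<^sup>2)"
      proof (rule AE_I2)
        fix y
        have "\<bar>a * b\<bar> \<le> \<bar>a\<^sup>2 + b\<^sup>2\<bar>" for a b :: real
        proof -
          have "2 * (\<bar>a\<bar> * \<bar>b\<bar>) \<le> a\<^sup>2 + b\<^sup>2"
            using sum_squares_bound[of "\<bar>a\<bar>" "\<bar>b\<bar>"] by (simp add: mult.assoc)
          moreover have "0 \<le> \<bar>a\<bar> * \<bar>b\<bar>" by simp
          ultimately show ?thesis unfolding abs_mult by linarith
        qed
        then show "norm (?E y * ?F y) \<le> norm ((?E y)\<^sup>2 + (?F y)\<^sup>2)" by simp
      qed
    qed measurable
    have "(I k)\<^sup>2 = (ens CARD('n) k)\<^sup>2 * (\<integral>y. ?E y * ?F y \<partial>lborel)\<^sup>2"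
      unfolding I_def EF by (simp only: power_mult_distrib)
    also have "\<dots> \<le> (ens CARD('n) k)\<^sup>2 * ((\<integral>y. (?E y)\<^sup>2 \<partial>lborel) * (\<integral>y. (?F y)\<^sup>2 \<partial>lborel))"
      by (intro mult_left_mono integral_Cauchy_Schwarz iE iF iEF) auto
    also have "\<dots> = (ens CARD('n) k * (\<integral>y. (?E y)\<^sup>2 \<partial>lborel)) * Q k"
      unfolding Q_def F2 by (simp add: power2_eq_square)
    also have "\<dots> \<le> (ens CARD('n) k * (?w * mehta TYPE('n) k)) * Q k"
    proof (intro mult_right_mono mult_left_mono ens_nonneg k0(2))
      show "(\<integral>y. (?E y)\<^sup>2 \<partial>lborel) \<le> ?w * mehta TYPE('n) k"
        unfolding E2 by (rule dunkl_kernel_L2(2)[OF k])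
      show "0 \<le> Q k" unfolding Q_def by (intro mult_nonneg_nonneg ens_nonneg k0(2) integral_nonneg_AE) auto
    qed
    finally show ?thesis by (simp only: mult_ac)
  qed
  have "((\<lambda>k. ?w * (ens CARD('n) k * mehta TYPE('n) k) * Q k) \<longlongrightarrow> ?w * 1 * 0) at_top"
    by (intro tendsto_mult tendsto_const ens_mehta Q0)
  then have U: "((\<lambda>k. ?w * (ens CARD('n) k * mehta TYPE('n) k) * Q k) \<longlongrightarrow> 0) at_top" by simp
  have "((\<lambda>k. (I k)\<^sup>2) \<longlongrightarrow> 0) at_top"
  proof (rule tendsto_sandwich[OF _ _ tendsto_const U])
    show "\<forall>\<^sub>F k in at_top. (I k)\<^sup>2 \<le> ?w * (ens CARD('n) k * mehta TYPE('n) k) * Q k"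
      using eventually_ge_at_top[of 1] by eventually_elim (rule bound)
  qed simp
  then have "(I \<longlongrightarrow> 0) at_top"
    using tendsto_real_sqrt[of "\<lambda>k. (I k)\<^sup>2" 0 at_top] by (simp add: tendsto_rabs_zero_iff)
  then show ?thesis unfolding I_def[abs_def] .
qed

text \<open>The averaged test function is its value at \<open>zeta\<close> plus a symmetric
  remainder vanishing there. The remainder is disposed of by \<open>kernel_vanishing\<close>; the
  constant is multiplied by the exact mass of the kernel.\<close>

lemma symmetric_kernel_limit:
  fixes \<phi> :: "(real,'n) vec \<Rightarrow> real"
  assumes c: "continuous_on UNIV \<phi>" and bd: "\<And>v. \<bar>\<phi> v\<bar> \<le> B"
  defines "S \<equiv> {\<rho>. \<rho> permutes (UNIV :: 'n set)}"
  shows "((\<lambda>k. ens CARD('n) k * exp (- (norm x)\<^sup>2 / 2) * (\<integral>y. wt k y * ((\<Sum>\<rho>\<in>S. dunkl_kernel k (permvec \<rho> x) y) * \<phi> ((1 / sqrt k) *\<^sub>R y)) \<partial>lborel))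
    \<longlongrightarrow> (\<Sum>\<rho>\<in>S. \<phi> (permvec \<rho> zeta))) at_top"
proof -
  let ?K = "\<lambda>k \<rho> \<psi>. \<integral>y. wt k y * (dunkl_kernel k (permvec \<rho> x) y * \<psi> ((1 / sqrt k) *\<^sub>R y)) \<partial>lborel"
  let ?e = "exp (- (norm x)\<^sup>2 / 2)" and ?M = "\<lambda>k. ens CARD('n) k * mehta TYPE('n) k"
  let ?s = "\<lambda>k y. (1 / sqrt k) *\<^sub>R y :: (real,'n) vec"
  have m[measurable]: "\<phi> \<in> borel_measurable borel" using c by (rule borel_measurable_continuous_onI)
  have finS: "finite S" and cardS: "card S = fact CARD('n)"
    unfolding S_def by (auto simp: finite_permutations card_permutations[OF refl])
  have bS: "\<rho> \<in> S \<Longrightarrow> bij \<rho>" for \<rho> unfolding S_def by (simp add: permutes_bij)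
  have f0: "(fact CARD('n) :: real) \<noteq> 0" by simp
  have S_comp: "(\<Sum>\<rho>\<in>S. F (\<rho> \<circ> g)) = (\<Sum>\<rho>\<in>S. F \<rho>)" "(\<Sum>\<rho>\<in>S. F (g \<circ> \<rho>)) = (\<Sum>\<rho>\<in>S. F \<rho>)" if g: "g \<in> S" for g and F :: "('n \<Rightarrow> 'n) \<Rightarrow> real"
  proof -
    have p: "g permutes UNIV" using g by (simp add: S_def)
    note o = permutes_inv_o[OF p] permutes_inv[OF p]
    show "(\<Sum>\<rho>\<in>S. F (\<rho> \<circ> g)) = (\<Sum>\<rho>\<in>S. F \<rho>)"
      by (rule sum.reindex_bij_witness[of _ "\<lambda>\<rho>. \<rho> \<circ> inv g" "\<lambda>\<rho>. \<rho> \<circ> g"])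
         (use p o in \<open>auto simp: S_def o_assoc[symmetric] permutes_compose\<close>)
    show "(\<Sum>\<rho>\<in>S. F (g \<circ> \<rho>)) = (\<Sum>\<rho>\<in>S. F \<rho>)"
      by (rule sum.reindex_bij_witness[of _ "\<lambda>\<rho>. inv g \<circ> \<rho>" "\<lambda>\<rho>. g \<circ> \<rho>"])
         (use p o in \<open>auto simp: S_def o_assoc permutes_compose\<close>)
  qed
  have bij_S: "bij g \<Longrightarrow> g \<in> S" for g unfolding S_def by (auto intro: bij_imp_permutes)
  define \<phi>s where "\<phi>s v = (\<Sum>\<rho>\<in>S. \<phi> (permvec \<rho> v)) / fact CARD('n)" for v
  define \<psi> where "\<psi> v = \<phi>s v - \<phi>s zeta" for v
  have lc: "continuous_on UNIV (permvec \<rho> :: (real,'n) vec \<Rightarrow> _)" for \<rho>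
    by (intro linear_continuous_on linear_conv_bounded_linear[THEN iffD1] linear_permvec)
  have cs: "continuous_on UNIV \<phi>s" unfolding \<phi>s_def
    by (intro continuous_intros continuous_on_compose2[OF c lc]) auto
  have inv_s: "\<phi>s (permvec g v) = \<phi>s v" if "bij g" for g v
    unfolding \<phi>s_def permvec_permvec by (subst S_comp(2)[OF bij_S[OF that], of "\<lambda>\<rho>. \<phi> (permvec \<rho> v)"]) (rule refl)
  have bs: "\<bar>\<phi>s v\<bar> \<le> B" for v
  proof -
    have "\<bar>\<Sum>\<rho>\<in>S. \<phi> (permvec \<rho> v)\<bar> \<le> (\<Sum>\<rho>\<in>S. B)" by (rule order_trans[OF sum_abs]) (intro sum_mono bd)
    then show ?thesis by (simp add: \<phi>s_def cardS divide_le_eq mult.commute)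
  qed
  have cpsi: "continuous_on UNIV \<psi>" unfolding \<psi>_def by (intro continuous_intros cs)
  have bpsi: "\<bar>\<psi> v\<bar> \<le> 2 * B" for v unfolding \<psi>_def using bs[of v] bs[of zeta] by linarith
  have lim1: "((\<lambda>k. ens CARD('n) k * ?K k \<rho> \<psi>) \<longlongrightarrow> 0) at_top" for \<rho>
    by (rule kernel_vanishing[OF cpsi bpsi]) (auto simp: \<psi>_def inv_s)
  have lim: "((\<lambda>k. ?e * (\<Sum>\<rho>\<in>S. ens CARD('n) k * ?K k \<rho> \<psi>)
     + \<phi>s zeta * fact CARD('n) * ?M k) \<longlongrightarrow> ?e * (\<Sum>\<rho>\<in>S. 0) + \<phi>s zeta * fact CARD('n) * 1) at_top"
    by (intro tendsto_intros lim1 ens_mehta)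
  have tgt: "?e * (\<Sum>\<rho>\<in>S. 0) + \<phi>s zeta * fact CARD('n) * 1 = (\<Sum>\<rho>\<in>S. \<phi> (permvec \<rho> zeta))"
    by (simp add: \<phi>s_def)
  show ?thesis
  proof (rule Lim_transform_eventually[OF lim[unfolded tgt]])
    show "\<forall>\<^sub>F k in at_top. ?e * (\<Sum>\<rho>\<in>S. ens CARD('n) k * ?K k \<rho> \<psi>)
       + \<phi>s zeta * fact CARD('n) * ?M k
      = ens CARD('n) k * ?e * (\<integral>y. wt k y * ((\<Sum>\<rho>\<in>S. dunkl_kernel k (permvec \<rho> x) y) * \<phi> (?s k y)) \<partial>lborel)"
      using eventually_ge_at_top[of 1]
    proof eventually_elim
      fix k :: real assume k: "k \<ge> 1"
      have k0: "k \<ge> 0" using k by simp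
      note [measurable] = dunkl_kernel_measurable[OF k0]
      have cm: "\<phi>s \<in> borel_measurable borel" "\<psi> \<in> borel_measurable borel"
        using cs cpsi by (auto intro: borel_measurable_continuous_onI)
      define E where "E y = (\<Sum>\<rho>\<in>S. dunkl_kernel k (permvec \<rho> x) y)" for y
      have Em[measurable]: "E \<in> borel_measurable borel" unfolding E_def[abs_def] by measurable
      \<comment> \<open>A permutation of y is transferred to x and absorbed by the sum over the
        group.\<close>
      have E_inv: "E (permvec g y) = E y" if g: "bij g" for g y
      proof -
        have "dunkl_kernel k (permvec \<rho> x) (permvec g y) = dunkl_kernel k (permvec (\<rho> \<circ> inv g) x) y" for \<rho>
        proof -
          have "permvec \<rho> x = permvec g (permvec (\<rho> \<circ> inv g) x)"
            unfolding permvec_permvec by (simp add: o_assoc[symmetric] inv_o_cancel[OF bij_is_inj[OF g]])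
          then show ?thesis using dunkl_kernel_permvec[OF k0 g] by metis
        qed
        then show ?thesis unfolding E_def
          using S_comp(1)[OF bij_S[OF bij_imp_bij_inv[OF g]], of "\<lambda>\<rho>. dunkl_kernel k (permvec \<rho> x) y"] by simp
      qed
      have int: "integrable lborel (\<lambda>y. wt k y * (dunkl_kernel k a y * h (?s k y)))"
        if h: "h \<in> borel_measurable borel" "\<And>v. \<bar>h v\<bar> \<le> D" for a and h :: "(real,'n) vec \<Rightarrow> real" and D
      proof -
        note [measurable] = h(1)
        have D0: "D \<ge> 0" using order_trans[OF abs_ge_zero h(2)] .
        have "expbd (\<lambda>y :: (real,'n) vec. D * exp (norm a * norm y))" by (intro expbd_mult expbd_const expbd_exp) auto
        moreover have "\<bar>dunkl_kernel k a y * h (?s k y)\<bar> \<le> \<bar>D * exp (norm a * norm y)\<bar>" for y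
        proof -
          have "\<bar>dunkl_kernel k a y * h (?s k y)\<bar> \<le> exp (norm a * norm y) * D"
            unfolding abs_mult by (intro mult_mono dunkl_kernel_bound k0 h(2)) auto
          then show ?thesis using D0 by (simp add: mult.commute)
        qed
        ultimately have "expbd (\<lambda>y. dunkl_kernel k a y * h (?s k y))" by (rule expbd_mono)
        then have "integrable lborel (\<lambda>y. (dunkl_kernel k a y * h (?s k y)) * wt k y)"
          by (rule wt_integrable[OF k0]) measurable
        then show ?thesis by (simp add: mult.commute)
      qed
      have split: "(\<integral>y. wt k y * (E y * h (?s k y)) \<partial>lborel) = (\<Sum>\<rho>\<in>S. \<integral>y. wt k y * (dunkl_kernel k (permvec \<rho> x) y * h (?s k y)) \<partial>lborel)"
        if h: "h \<in> borel_measurable borel" "\<And>v. \<bar>h v\<bar> \<le> D" for h :: "(real,'n) vec \<Rightarrow> real" and D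
        unfolding E_def sum_distrib_right sum_distrib_left by (rule Bochner_Integration.integral_sum) (rule int[OF h])
      have intE: "integrable lborel (\<lambda>y. wt k y * (E y * h (?s k y)))"
        if h: "h \<in> borel_measurable borel" "\<And>v. \<bar>h v\<bar> \<le> D" for h :: "(real,'n) vec \<Rightarrow> real" and D
        unfolding E_def sum_distrib_right sum_distrib_left by (rule Bochner_Integration.integrable_sum) (rule int[OF h])
      let ?J = "\<lambda>h :: (real,'n) vec \<Rightarrow> real. (\<integral>y. wt k y * (E y * h (?s k y)) \<partial>lborel)"
      \<comment> \<open>Weight and kernel sum are invariant, so the test function may be permuted,
        hence averaged.\<close>
      have Jperm: "?J (\<lambda>v. \<phi> (permvec \<rho> v)) = ?J \<phi>" if "\<rho> \<in> S" for \<rho>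
        using integral_permvec[OF bS[OF that], of "\<lambda>y. wt k y * (E y * \<phi> (?s k y))"]
        by (simp add: wt_permvec[OF bS[OF that]] E_inv[OF bS[OF that]] permvec_scaleR)
      have "?J \<phi>s = (\<integral>y. (\<Sum>\<rho>\<in>S. wt k y * (E y * \<phi> (permvec \<rho> (?s k y)))) / fact CARD('n) \<partial>lborel)"
        by (simp add: \<phi>s_def sum_distrib_left)
      also have "\<dots> = (\<Sum>\<rho>\<in>S. ?J (\<lambda>v. \<phi> (permvec \<rho> v))) / fact CARD('n)"
        using intE[of "\<lambda>v. \<phi> (permvec \<rho> v)" B for \<rho>] bd by (simp add: Bochner_Integration.integral_sum)
      also have "\<dots> = ?J \<phi>" by (simp add: Jperm cardS)
      finally have J1: "?J \<phi>s = ?J \<phi>" .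
      have "?J \<phi>s = (\<integral>y. wt k y * (E y * \<psi> (?s k y)) + \<phi>s zeta * (wt k y * (E y * (\<lambda>_. 1) (?s k y))) \<partial>lborel)"
        by (rule Bochner_Integration.integral_cong) (auto simp: \<psi>_def algebra_simps)
      also have "\<dots> = ?J \<psi> + \<phi>s zeta * ?J (\<lambda>_. 1)"
        using intE[OF cm(2) bpsi] intE[of "\<lambda>_. 1" 1] by simp
      finally have J2: "?J \<phi>s = ?J \<psi> + \<phi>s zeta * ?J (\<lambda>_. 1)" .
      have "?J (\<lambda>_. 1) = (\<Sum>\<rho>\<in>S. \<integral>y. wt k y * (dunkl_kernel k (permvec \<rho> x) y * 1) \<partial>lborel)"
        by (rule split[of "\<lambda>_. 1" 1]) auto
      also have "\<dots> = (\<Sum>\<rho>\<in>S. exp ((norm x)\<^sup>2 / 2) * mehta TYPE('n) k)"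
        by (rule sum.cong) (auto simp: mult.commute[of "wt k _"] dunkl_kernel_mass(2)[OF k] norm_permvec[OF bS])
      finally have J3: "?J (\<lambda>_. 1) = fact CARD('n) * (exp ((norm x)\<^sup>2 / 2) * mehta TYPE('n) k)" by (simp add: cardS)
      \<comment> \<open>The mass factor exp (|x|^2 / 2) of each kernel cancels the Gaussian in x:
        here the dependence on x disappears.\<close>
      have "?e * exp ((norm x)\<^sup>2 / 2) = 1" by (simp add: exp_add[symmetric])
      then have ee: "?e * (exp ((norm x)\<^sup>2 / 2) * c) = c" for c :: real by (simp add: mult.assoc[symmetric])
      have "ens CARD('n) k * ?e * ?J \<phi> = ?e * (ens CARD('n) k * ?J \<psi>)
         + \<phi>s zeta * fact CARD('n) * (ens CARD('n) k * (?e * (exp ((norm x)\<^sup>2 / 2) * mehta TYPE('n) k)))"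
        unfolding J1[symmetric] J2 J3 by (simp only: distrib_left mult_ac)
      also have "\<dots> = ?e * (\<Sum>\<rho>\<in>S. ens CARD('n) k * ?K k \<rho> \<psi>)
         + \<phi>s zeta * fact CARD('n) * ?M k"
        unfolding ee split[OF cm(2) bpsi] sum_distrib_left[symmetric] ..
      finally show "?e * (\<Sum>\<rho>\<in>S. ens CARD('n) k * ?K k \<rho> \<psi>)
         + \<phi>s zeta * fact CARD('n) * ?M k
        = ens CARD('n) k * ?e * (\<integral>y. wt k y * ((\<Sum>\<rho>\<in>S. dunkl_kernel k (permvec \<rho> x) y) * \<phi> (?s k y)) \<partial>lborel)"
        unfolding E_def by simp
    qed
  qed
qed

end

section \<open>The transition density\<close>

lemma pk_measurable:
  fixes x :: "(real,'n::{finite,linorder}) vec"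
  assumes "k \<ge> 0" shows "(\<lambda>y. pk k t y x) \<in> borel_measurable borel"
proof -
  note [measurable] = dunkl_kernel_measurable[OF assms]
  show ?thesis unfolding pk_def dimv_def by measurable
qed

lemma pk_scaled:
  fixes x y :: "(real,'n::{finite,linorder}) vec"
  assumes t: "t > 0"
  shows "pk k t (sqrt t *\<^sub>R y) x = mehta_const CARD('n) k / (2 * pi * t) powr (real CARD('n) / 2)
    * exp (- (norm ((1 / sqrt t) *\<^sub>R x))\<^sup>2 / 2) * (wt k y * dunkl_kernel k ((1 / sqrt t) *\<^sub>R x) y)"
proof -
  have y: "(1 / sqrt t) *\<^sub>R (sqrt t *\<^sub>R y) = y" using t by simp
  have "- ((norm x)\<^sup>2 + (norm (sqrt t *\<^sub>R y))\<^sup>2) / (2 * t) = - (norm ((1 / sqrt t) *\<^sub>R x))\<^sup>2 / 2 + - (norm y)\<^sup>2 / 2"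
    using t by (simp add: power_mult_distrib power_divide field_simps)
  then have e: "exp (- ((norm x)\<^sup>2 + (norm (sqrt t *\<^sub>R y))\<^sup>2) / (2 * t)) = exp (- (norm ((1 / sqrt t) *\<^sub>R x))\<^sup>2 / 2) * exp (- (norm y)\<^sup>2 / 2)"
    by (simp only: exp_add)
  show ?thesis unfolding pk_def y e dimv_def mehta_const_def wt_def by simp
qed

text \<open>Convergence to a sum of delta measures is expressed as weak convergence, tested on
  bounded continuous functions, with \<open>k\<close> tending to infinity through the reals; each
  delta becomes an evaluation of the test function.\<close>

theorem theorem4:
  fixes t :: real and x z :: "real^'n::{finite,linorder}"
  assumes "CARD('n::{finite,linorder}) \<ge> 2"
    and "t > 0"
    and "\<forall>i j. i < j \<longrightarrow> z $ i < z $ j"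
    and "\<forall>i. hermite CARD('n::{finite,linorder}) (z $ i) = 0"
  shows "\<forall>f :: real^'n::{finite,linorder} \<Rightarrow> real. continuous_on UNIV f \<and> bounded (range f) \<longrightarrow>
    ((\<lambda>k. \<integral>v. k powr (real CARD('n::{finite,linorder}) / 2) * pk_sym k t (sqrt k *\<^sub>R v) x * f v \<partial>lborel)
      \<longlongrightarrow> (\<Sum>\<rho>\<in>{\<rho>. \<rho> permutes (UNIV::'n::{finite,linorder} set)}. f (sqrt (2 * t) *\<^sub>R permvec \<rho> z))) at_top"
proof (intro allI impI)
  fix f :: "(real,'n) vec \<Rightarrow> real"
  assume f: "continuous_on UNIV f \<and> bounded (range f)"
  interpret hermite_zeros z
    by unfold_locales (use assms(3,4) in \<open>auto simp: hermite_he\<close>)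
  obtain B where B: "\<And>v. \<bar>f v\<bar> \<le> B" using f unfolding bounded_iff by auto
  let ?S = "{\<rho>. \<rho> permutes (UNIV :: 'n set)}"
  let ?N = "CARD('n)"
  define X where "X = (1 / sqrt t) *\<^sub>R x"
  define \<phi> where "\<phi> v = f (sqrt t *\<^sub>R v)" for v
  have t: "t > 0" by fact
  have c\<phi>: "continuous_on UNIV \<phi>" unfolding \<phi>_def
    by (rule continuous_on_compose2[OF conjunct1[OF f]]) (auto intro!: continuous_intros)
  have fm[measurable]: "f \<in> borel_measurable borel" using f by (intro borel_measurable_continuous_onI) auto
  have lim: "((\<lambda>k. ens CARD('n) k * exp (- (norm X)\<^sup>2 / 2) * (\<integral>y. wt k y * ((\<Sum>\<rho>\<in>?S. dunkl_kernel k (permvec \<rho> X) y) * \<phi> ((1 / sqrt k) *\<^sub>R y)) \<partial>lborel))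
    \<longlongrightarrow> (\<Sum>\<rho>\<in>?S. \<phi> (permvec \<rho> zeta))) at_top"
    by (rule symmetric_kernel_limit[OF c\<phi>, of B]) (simp add: \<phi>_def B)
  have tgt: "(\<Sum>\<rho>\<in>?S. \<phi> (permvec \<rho> zeta)) = (\<Sum>\<rho>\<in>?S. f (sqrt (2 * t) *\<^sub>R permvec \<rho> z))"
    by (simp add: \<phi>_def zeta_def permvec_scaleR real_sqrt_mult mult.commute)
  show "((\<lambda>k. \<integral>v. k powr (real ?N / 2) * pk_sym k t (sqrt k *\<^sub>R v) x * f v \<partial>lborel)
      \<longlongrightarrow> (\<Sum>\<rho>\<in>?S. f (sqrt (2 * t) *\<^sub>R permvec \<rho> z))) at_top"
  proof (rule Lim_transform_eventually[OF lim[unfolded tgt]])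
    show "\<forall>\<^sub>F k in at_top. ens CARD('n) k * exp (- (norm X)\<^sup>2 / 2) * (\<integral>y. wt k y * ((\<Sum>\<rho>\<in>?S. dunkl_kernel k (permvec \<rho> X) y) * \<phi> ((1 / sqrt k) *\<^sub>R y)) \<partial>lborel)
      = (\<integral>v. k powr (real ?N / 2) * pk_sym k t (sqrt k *\<^sub>R v) x * f v \<partial>lborel)"
      using eventually_gt_at_top[of 0]
    proof eventually_elim
      fix k :: real assume k: "k > 0"
      note [measurable] = pk_measurable[OF less_imp_le[OF k]]
      let ?F = "\<lambda>v. k powr (real ?N / 2) * pk_sym k t (sqrt k *\<^sub>R v) x * f v"
      \<comment> \<open>Substituting v = sqrt (t / k) y turns sqrt k v into sqrt t y, as in
        \<open>pk_scaled\<close>. The Jacobian (t / k)^(N/2) cancels k^(N/2) and the power of t in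
        the Gaussian normalization.\<close>
      let ?c = "sqrt (t / k)"
      have c: "?c > 0" using t k by simp
      have pm[measurable]: "(\<lambda>y. pk_sym k t y x) \<in> borel_measurable borel" unfolding pk_sym_def by measurable
      have Fm: "?F \<in> borel_measurable borel" by measurable
      have sc: "sqrt k *\<^sub>R (?c *\<^sub>R y) = sqrt t *\<^sub>R y" for y :: "(real,'n) vec"
        using k t by (simp add: real_sqrt_divide)
      have cf: "f (?c *\<^sub>R y) = \<phi> ((1 / sqrt k) *\<^sub>R y)" for y
        by (simp add: \<phi>_def real_sqrt_divide)
      define A where "A = mehta_const ?N k / (2 * pi * t) powr (real ?N / 2) * exp (- (norm X)\<^sup>2 / 2)"
      have pks: "pk_sym k t (sqrt t *\<^sub>R y) x = A * (wt k y * (\<Sum>\<rho>\<in>?S. dunkl_kernel k (permvec \<rho> X) y))" for y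
      proof -
        have "pk k t (sqrt t *\<^sub>R y) (permvec \<rho> x) = A * (wt k y * dunkl_kernel k (permvec \<rho> X) y)" if "\<rho> \<in> ?S" for \<rho>
        proof -
          have b: "bij \<rho>" using that by (simp add: permutes_bij)
          have X\<rho>: "(1 / sqrt t) *\<^sub>R permvec \<rho> x = permvec \<rho> X" by (simp add: X_def permvec_scaleR)
          show ?thesis unfolding pk_scaled[OF t] X\<rho> norm_permvec[OF b] A_def ..
        qed
        then show ?thesis unfolding pk_sym_def sum_distrib_left by (rule sum.cong[OF refl])
      qed
      have "(\<integral>v. ?F v \<partial>lborel) = ?c ^ ?N * (\<integral>y. ?F (?c *\<^sub>R y) \<partial>lborel)"
        using integral_lborel_scale[OF c Fm] by simp
      also have "(\<integral>y. ?F (?c *\<^sub>R y) \<partial>lborel) = (\<integral>y. (k powr (real ?N / 2) * A) * (wt k y * ((\<Sum>\<rho>\<in>?S. dunkl_kernel k (permvec \<rho> X) y) * \<phi> ((1 / sqrt k) *\<^sub>R y))) \<partial>lborel)"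
        unfolding sc cf pks by (simp only: mult.assoc)
      also have "\<dots> = (k powr (real ?N / 2) * A) * (\<integral>y. wt k y * ((\<Sum>\<rho>\<in>?S. dunkl_kernel k (permvec \<rho> X) y) * \<phi> ((1 / sqrt k) *\<^sub>R y)) \<partial>lborel)"
        by simp
      finally have I: "(\<integral>v. ?F v \<partial>lborel) = ?c ^ ?N * ((k powr (real ?N / 2) * A) * (\<integral>y. wt k y * ((\<Sum>\<rho>\<in>?S. dunkl_kernel k (permvec \<rho> X) y) * \<phi> ((1 / sqrt k) *\<^sub>R y)) \<partial>lborel))" .
      have pw: "a powr (real ?N / 2) = sqrt a ^ ?N" if "a > 0" for a :: real
        using that by (simp add: powr_half_sqrt[symmetric] powr_powr powr_realpow[symmetric])
      have "k powr (real ?N / 2) = sqrt k ^ ?N" "(2 * pi * t) powr (real ?N / 2) = sqrt (2 * pi) ^ ?N * sqrt t ^ ?N"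
        using k t pw[of k] pw[of "2 * pi * t"] by (simp_all add: real_sqrt_mult power_mult_distrib)
      moreover have "?c ^ ?N = sqrt t ^ ?N / sqrt k ^ ?N" by (simp add: real_sqrt_divide power_divide)
      moreover have "sqrt t ^ ?N \<noteq> 0" "sqrt k ^ ?N \<noteq> 0" using k t by auto
      ultimately have "?c ^ ?N * (k powr (real ?N / 2) * A) = ens CARD('n) k * exp (- (norm X)\<^sup>2 / 2)"
        unfolding A_def ens_def by simp
      then show "ens CARD('n) k * exp (- (norm X)\<^sup>2 / 2) * (\<integral>y. wt k y * ((\<Sum>\<rho>\<in>?S. dunkl_kernel k (permvec \<rho> X) y) * \<phi> ((1 / sqrt k) *\<^sub>R y)) \<partial>lborel) = (\<integral>v. ?F v \<partial>lborel)"
        unfolding I mult.assoc[symmetric] by simp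
    qed
  qed
qed

end
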